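(* Let $G$ be a (finite) tree, let $n\geq 4$ be an integer, and let $J_n(G)$ be the $n$-path ideal of $G$ over a field $\Bbbk$. Then the following statements are equivalent: (1) $J_n(G)$ has linear resolution; (2) $J_n(G)$ has linear quotients; (3) either of the following holds: (i) $n=4$, and $G$ does not contain $P_4+P_4$ or $L_{5,3}$ as an induced subgraph; (ii) $n\geq 5$, and $G$ does not contain $P_n+P_n$ as an induced subgraph, and $G$ does not contain $L_{n,k}$ as an induced subgraph for any integer $k\in[3,(n+1)/2]$.
   Context: Graphs are finite and simple. "Contains $H$ as an induced subgraph" means up to isomorphism. $P_n$ is the path graph on $n$ vertices, and $G+H$ denotes the disjoint union of graphs. For a graph $G$ with $V(G)=\{x_1,\dots,x_m\}$ and a field $\Bbbk$, the $n$-path ideal $J_n(G)\subseteq \Bbbk[x_1,\dots,x_m]$ is the ideal generated by all monomials $x_{i_1}x_{i_2}\cdots x_{i_n}$ such that $x_{i_1},\dots,x_{i_n}$ are $n$ distinct vertices with $x_{i_j}x_{i_{j+1}}\in E(G)$ for $1\le j\le n-1$ (an $n$-path in $G$). For integers $n\geq 5$ and $k\in[3,n-2]$, $L_{n,k}$ is the graph with vertex set $\{x_1,\dots,x_n\}\cup\{y_1,\dots,y_{k-1}\}$ (all distinct) and edge set $\{x_ix_{i+1}: 1\le i\le n-1\}\cup\{y_iy_{i+1}: 1\le i\le k-2\}\cup\{y_{k-1}x_k\}$. $\mathrm{Mingens}(I)$ is the unique minimal monomial generating set of a monomial ideal $I$. A monomial ideal $I$ generated in a single degree $d$ has linear resolution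 if its Castelnuovo–Mumford regularity $\operatorname{reg} I=\max\{j-i:\beta_{i,j}(I)\ne 0\}$ equals $d$. A monomial ideal $I$ has linear quotients if $\mathrm{Mingens}(I)$ can be ordered as $m_1,\dots,m_q$ so that for every $1\le k\le q-1$ the colon ideal $(m_1,\dots,m_k):(m_{k+1})$ is generated by a set of variables. The zero ideal is regarded as having linear quotients and linear resolution. *)

theory Defs
  imports
    "HOL-Library.Poly_Mapping"
    "HOL-Library.Extended_Real"
    "Graph_Theory.Graph_Theory"
    "Jordan_Normal_Form.Matrix_Kernel"
begin

section \<open>Graphs\<close>

text \<open>
  A finite simple graph is a digraph satisfying \<^locale>\<open>pair_graph\<close>: finite, loopfree, and with
  every edge represented by its two opposite arcs.
\<close>

definition graph_of_edges :: "'a set \<Rightarrow> ('a \<times> 'a) set \<Rightarrow> 'a pair_pre_digraph" where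
  "graph_of_edges V E = \<lparr> pverts = V, parcs = E \<union> E\<inverse> \<rparr>"

text \<open>
  The library's \<^const>\<open>tree\<close> is unsuitable here: a back-and-forth walk along one edge of a
  symmetric digraph counts as a \<^const>\<open>pre_digraph.cycle\<close> (of length 2), so a symmetric digraph
  with an edge is never a \<^const>\<open>tree\<close>.  The cycles of the undirected graph are those of length
  at least 3.
\<close>

definition tree_graph :: "'a pair_pre_digraph \<Rightarrow> bool" where
  "tree_graph G \<longleftrightarrow> pair_graph G \<and> connected (with_proj G) \<and>
     \<not> (\<exists>p. pre_digraph.cycle (with_proj G) p \<and> 3 \<le> length p)"

definition contains_induced :: "'a pair_pre_digraph \<Rightarrow> 'b pair_pre_digraph \<Rightarrow> bool" where
  "contains_induced G H \<longleftrightarrow>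
     (\<exists>H'. induced_subgraph H' (with_proj G) \<and> digraph_iso (with_proj H) H')"

definition path_graph :: "nat \<Rightarrow> nat pair_pre_digraph" where
  "path_graph n = graph_of_edges {1..n} {(i, i + 1) | i. 1 \<le> i \<and> i + 1 \<le> n}"

definition disjoint_union ::
  "'a pair_pre_digraph \<Rightarrow> 'b pair_pre_digraph \<Rightarrow> ('a + 'b) pair_pre_digraph" where
  "disjoint_union G H = \<lparr> pverts = pverts G <+> pverts H,
     parcs = map_prod Inl Inl ` parcs G \<union> map_prod Inr Inr ` parcs H \<rparr>"

datatype L_vertex = X nat | Y nat

text \<open>Intended for \<open>n \<ge> 5\<close> and \<open>3 \<le> k \<le> n - 2\<close>.\<close>

definition L_graph :: "nat \<Rightarrow> nat \<Rightarrow> L_vertex pair_pre_digraph" where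
  "L_graph n k = graph_of_edges (X ` {1..n} \<union> Y ` {1..k - 1})
     ({(X i, X (i + 1)) | i. 1 \<le> i \<and> i \<le> n - 1} \<union>
      {(Y i, Y (i + 1)) | i. 1 \<le> i \<and> i \<le> k - 2} \<union>
      {(Y (k - 1), X k)})"


section \<open>Monomial ideals in a polynomial ring\<close>

text \<open>
  \<open>('a, 'k) pring\<close> is the polynomial ring over \<open>'k\<close> with one variable for each element of \<open>'a\<close>:
  an exponent vector \<open>'a \<Rightarrow>\<^sub>0 nat\<close> is a power product, and a polynomial maps power products to
  coefficients.
\<close>

type_synonym ('a, 'k) pring = "('a \<Rightarrow>\<^sub>0 nat) \<Rightarrow>\<^sub>0 'k"

definition var :: "'a \<Rightarrow> ('a, 'k::field) pring" where
  "var v = Poly_Mapping.single (Poly_Mapping.single v 1) 1"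

definition monomials :: "('a, 'k::field) pring set" where
  "monomials = range (\<lambda>t. Poly_Mapping.single t 1)"

definition exp_degree :: "('a \<Rightarrow>\<^sub>0 nat) \<Rightarrow> nat" where
  "exp_degree t = (\<Sum>v\<in>Poly_Mapping.keys t. Poly_Mapping.lookup t v)"

definition homogeneous :: "nat \<Rightarrow> ('a, 'k::field) pring \<Rightarrow> bool" where
  "homogeneous d p \<longleftrightarrow> (\<forall>t\<in>Poly_Mapping.keys p. exp_degree t = d)"

text \<open>\<open>HOL-Algebra\<close> also has a locale \<open>module\<close>, hence the qualified name.\<close>

definition ideal_gen :: "'r::comm_ring_1 set \<Rightarrow> 'r set" where
  "ideal_gen B = Modules.module.span (*) B"

definition colon_ideal :: "'r::comm_ring_1 set \<Rightarrow> 'r set \<Rightarrow> 'r set" where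
  "colon_ideal I J = {f. \<forall>g\<in>J. f * g \<in> I}"

definition monomial_ideal :: "('a, 'k::field) pring set \<Rightarrow> bool" where
  "monomial_ideal I \<longleftrightarrow> (\<exists>B \<subseteq> monomials. I = ideal_gen B)"

definition Mingens :: "('a, 'k::field) pring set \<Rightarrow> ('a, 'k) pring set" where
  "Mingens I = (THE B. B \<subseteq> monomials \<and> ideal_gen B = I \<and> (\<forall>C. C \<subset> B \<longrightarrow> ideal_gen C \<noteq> I))"

text \<open>
  Lists are indexed from 0, so \<open>take k ms\<close> is \<open>m\<^sub>1, \<dots>, m\<^sub>k\<close> and \<open>ms ! k\<close> is \<open>m\<^bsub>k+1\<^esub>\<close>.
\<close>

definition linear_quotients :: "('a, 'k::field) pring set \<Rightarrow> bool" where
  "linear_quotients I \<longleftrightarrow> monomial_ideal I \<and>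
     (\<exists>ms. distinct ms \<and> set ms = Mingens I \<and>
        (\<forall>k. 1 \<le> k \<and> k < length ms \<longrightarrow>
           (\<exists>A. colon_ideal (ideal_gen (set (take k ms))) (ideal_gen {ms ! k}) = ideal_gen (var ` A))))"


section \<open>Minimal graded free resolutions and regularity\<close>

text \<open>
  Write \<open>S\<close> for the polynomial ring.  \<open>min_graded_free_resolution I (D, \<delta>)\<close> says that
  \<open>\<dots> \<rightarrow> F\<^sub>1 \<rightarrow> F\<^sub>0 \<rightarrow> I \<rightarrow> 0\<close> is a minimal graded free resolution of \<open>I\<close>.  Here \<open>F\<^sub>i\<close> is the direct
  sum of the shifted modules \<open>S(-j)\<close> for \<open>j\<close> in the list \<open>D i\<close>, i.e. \<open>D i\<close> lists the degrees of
  the basis elements of \<open>F\<^sub>i\<close>; the matrix of \<open>F\<^bsub>i+1\<^esub> \<rightarrow> F\<^sub>i\<close> is \<open>\<delta> (Suc i)\<close>, and the one-row matrix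
  \<open>\<delta> 0\<close> is the augmentation \<open>F\<^sub>0 \<rightarrow> I \<subseteq> S\<close>.  The conditions are, in order: the sizes of the
  matrices; the maps preserve degrees; the image of \<open>\<delta> 0\<close> is \<open>I\<close>; exactness at every \<open>F\<^sub>i\<close>;
  minimality, i.e. \<open>\<delta> (Suc i)\<close> has all its entries in the ideal generated by the variables.
  Shifts are natural numbers because \<open>I \<subseteq> S\<close> forces the shifts in a minimal resolution to be
  nonnegative.
\<close>

fun min_graded_free_resolution ::
  "('a, 'k::field) pring set \<Rightarrow> (nat \<Rightarrow> nat list) \<times> (nat \<Rightarrow> ('a, 'k) pring mat) \<Rightarrow> bool" where
  "min_graded_free_resolution I (D, \<delta>) \<longleftrightarrow>
     \<delta> 0 \<in> carrier_mat 1 (length (D 0)) \<and>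
     (\<forall>i. \<delta> (Suc i) \<in> carrier_mat (length (D i)) (length (D (Suc i)))) \<and>
     (\<forall>c < length (D 0). homogeneous (D 0 ! c) (\<delta> 0 $$ (0, c))) \<and>
     (\<forall>i. \<forall>r < length (D i). \<forall>c < length (D (Suc i)).
        \<forall>t \<in> Poly_Mapping.keys (\<delta> (Suc i) $$ (r, c)). exp_degree t + D i ! r = D (Suc i) ! c) \<and>
     I = {(\<delta> 0 *\<^sub>v w) $ 0 | w. w \<in> carrier_vec (length (D 0))} \<and>
     (\<forall>i. mat_kernel (\<delta> i) = {\<delta> (Suc i) *\<^sub>v w | w. w \<in> carrier_vec (length (D (Suc i)))}) \<and>
     (\<forall>i. \<forall>r < length (D i). \<forall>c < length (D (Suc i)).
        \<delta> (Suc i) $$ (r, c) \<in> ideal_gen (range var))"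

text \<open>
  The graded Betti number \<open>\<beta>\<^sub>i\<^sub>,\<^sub>j(I)\<close>: the number of summands \<open>S(-j)\<close> of \<open>F\<^sub>i\<close>.  A minimal graded
  free resolution of a homogeneous ideal in finitely many variables exists and is unique up to
  isomorphism, so the choice does not matter.
\<close>

definition betti :: "('a, 'k::field) pring set \<Rightarrow> nat \<Rightarrow> nat \<Rightarrow> nat" where
  "betti I i j = count_list (fst (SOME F. min_graded_free_resolution I F) i) j"

text \<open>
  The set is finite by Hilbert's syzygy theorem, so for \<open>I \<noteq> {0}\<close> the supremum is the maximum; \<open>{0}\<close> has regularity \<open>-\<infinity>\<close>.
\<close>

definition regularity :: "('a, 'k::field) pring set \<Rightarrow> ereal" where
  "regularity I = Sup {ereal (real j - real i) | i j. betti I i j \<noteq> 0}"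

definition linear_resolution :: "('a, 'k::field) pring set \<Rightarrow> bool" where
  "linear_resolution I \<longleftrightarrow> I = {0} \<or>
     monomial_ideal I \<and> (\<exists>d. (\<forall>m\<in>Mingens I. homogeneous d m) \<and> regularity I = ereal (real d))"


section \<open>Path ideals\<close>

text \<open>
  \<^term>\<open>vpath vs (with_proj G)\<close> says that \<open>vs\<close> is a nonempty list of distinct vertices, consecutive
  ones being adjacent.
\<close>

definition path_ideal :: "nat \<Rightarrow> 'a pair_pre_digraph \<Rightarrow> ('a, 'k::field) pring set" where
  "path_ideal n G =
     ideal_gen {prod_list (map var vs) | vs. vpath vs (with_proj G) \<and> length vs = n}"

end

theory Submission imports Defs begin

text \<open>
  A squarefree monomial ideal has a free resolution whose matrix entries are scalar multiples of
  monomials, and its exactness can be tested on scalar matrices, one squarefree degree at a time.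
  Linear quotients give such a resolution by iterated mapping cones over Koszul complexes, and by
  minimality the degrees occurring in any minimal graded resolution are the same; so linear quotients
  imply linear resolution.

  If all first syzygies are linear, then any two generators \<open>u \<noteq> v\<close> admit a generator inside
  \<open>u \<union> v\<close> with exactly one vertex outside \<open>u\<close>. Two non-adjacent disjoint paths violate this,
  and so does the graph \<open>L\<^sub>n\<^sub>,\<^sub>k\<close>. The case \<open>L\<^sub>5\<^sub>,\<^sub>3\<close>, \<open>n = 4\<close>, fails one step later: its six generators form a
  hexagon of linear syzygies, and going around it is a second syzygy that is not linear.

  Conversely, fix a longest path \<open>D\<close> of the tree. The excluded subgraphs force every \<open>n\<close>-path to
  have all its vertices on \<open>D\<close> except possibly its two ends; ordering the \<open>n\<close>-paths lexicographically
  by position on \<open>D\<close>, left end and right end then gives linear quotients.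
\<close>

text \<open>\<open>betti\<close> is read off a resolution picked by \<open>SOME\<close>, so
  linearity yields nothing until a minimal resolution is known to exist and its degrees are known
  not to depend on the choice. Hence both directions pass through an explicit squarefree resolution:
  mapping cones supply it from linear quotients, minimal generators of strand kernels supply it in
  general. Linearity then is a bound on the sizes of its degrees; multiplicities never matter.

  The two conditions on L have a common form, which keeps the ordering argument uniform in n: no
  three arms of lengths p <= q and r, all at least 2, with p + r >= n - 1. For n >= 5 such arms can
  be shortened to lengths a, a, n - 1 - a with 2 <= a and 2a <= n - 1, which is
  \<open>L_graph n (a + 1)\<close>. For n = 4 no such a exists, and arms of lengths 2, 2, 2, that is
  \<open>L_graph 5 3\<close>, take over.

  A longest path D is the right axis because a branch leaving D is never longer than either side of
  D at that vertex. A branch of length at least 2 thus comes with two more arms at least as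
  long.\<close>

section \<open>Resolutions in squarefree degrees and mapping cones\<close>

text \<open>
  In the complex encoded by \<open>sres N dg C\<close>, the module in homological position \<open>i\<close> has \<open>N i\<close>
  generators, the \<open>c\<close>-th in squarefree degree \<open>dg i c\<close>; position \<open>0\<close> is the polynomial ring itself,
  so that the generators of the ideal are \<open>dg 1 c\<close>. The scalar \<open>C i r c\<close> is the coefficient of the
  monomial entry \<open>(r, c)\<close> of the map from position \<open>i + 1\<close> to position \<open>i\<close>. Exactness is required at
  every position \<open>i + 1\<close> and in every squarefree degree \<open>W\<close>, where the strand consists of the scalar
  vectors supported on the generators of degree contained in \<open>W\<close>.
\<close>

definition mv :: "nat \<Rightarrow> (nat \<Rightarrow> nat \<Rightarrow> 'k::comm_ring_1) \<Rightarrow> (nat \<Rightarrow> 'k) \<Rightarrow> nat \<Rightarrow> 'k" where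
  "mv N C v r = (\<Sum>c<N. C r c * v c)"

definition supp_in :: "nat \<Rightarrow> (nat \<Rightarrow> 'a set) \<Rightarrow> 'a set \<Rightarrow> (nat \<Rightarrow> 'k::zero) \<Rightarrow> bool" where
  "supp_in N dg W v \<longleftrightarrow> (\<forall>c<N. v c \<noteq> 0 \<longrightarrow> dg c \<subseteq> W)"

definition sres :: "(nat \<Rightarrow> nat) \<Rightarrow> (nat \<Rightarrow> nat \<Rightarrow> 'a set) \<Rightarrow> (nat \<Rightarrow> nat \<Rightarrow> nat \<Rightarrow> 'k::field) \<Rightarrow> bool" where
  "sres N dg C \<longleftrightarrow>
     N 0 = 1 \<and> dg 0 0 = {} \<and> (\<forall>c<N (Suc 0). C 0 0 c = 1) \<and>
     (\<forall>i r c. r < N i \<longrightarrow> c < N (Suc i) \<longrightarrow> C i r c \<noteq> 0 \<longrightarrow> dg i r \<subseteq> dg (Suc i) c) \<and>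
     (\<forall>i r e. r < N i \<longrightarrow> e < N (Suc (Suc i)) \<longrightarrow>
        mv (N (Suc i)) (C i) (\<lambda>c. C (Suc i) c e) r = 0) \<and>
     (\<forall>i W v. supp_in (N (Suc i)) (dg (Suc i)) W v \<longrightarrow> (\<forall>r<N i. mv (N (Suc i)) (C i) v r = 0) \<longrightarrow>
        (\<exists>u. supp_in (N (Suc (Suc i))) (dg (Suc (Suc i))) W u \<and>
             (\<forall>c<N (Suc i). v c = mv (N (Suc (Suc i))) (C (Suc i)) u c)))"

text \<open>Membership of the squarefree monomial with support \<open>W\<close> in the ideal being
  resolved.\<close>

definition has_gen :: "(nat \<Rightarrow> nat) \<Rightarrow> (nat \<Rightarrow> nat \<Rightarrow> 'a set) \<Rightarrow> 'a set \<Rightarrow> bool" where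
  "has_gen N dg W \<longleftrightarrow> (\<exists>c<N (Suc 0). dg (Suc 0) c \<subseteq> W)"

lemma sresD:
  assumes "sres N dg C"
  shows "N 0 = 1" "dg 0 0 = {}" "\<And>c. c < N (Suc 0) \<Longrightarrow> C 0 0 c = 1"
    "\<And>i r c. r < N i \<Longrightarrow> c < N (Suc i) \<Longrightarrow> C i r c \<noteq> 0 \<Longrightarrow> dg i r \<subseteq> dg (Suc i) c"
    "\<And>i r e. r < N i \<Longrightarrow> e < N (Suc (Suc i)) \<Longrightarrow> mv (N (Suc i)) (C i) (\<lambda>c. C (Suc i) c e) r = 0"
  using assms by (auto simp: sres_def)

lemma sres_exact:
  assumes "sres N dg C" "supp_in (N (Suc i)) (dg (Suc i)) W v"
    "\<And>r. r < N i \<Longrightarrow> mv (N (Suc i)) (C i) v r = 0"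
  obtains u where "supp_in (N (Suc (Suc i))) (dg (Suc (Suc i))) W u"
    "\<And>c. c < N (Suc i) \<Longrightarrow> v c = mv (N (Suc (Suc i))) (C (Suc i)) u c"
proof -
  have "\<forall>i W v. supp_in (N (Suc i)) (dg (Suc i)) W v \<longrightarrow> (\<forall>r<N i. mv (N (Suc i)) (C i) v r = 0) \<longrightarrow>
        (\<exists>u. supp_in (N (Suc (Suc i))) (dg (Suc (Suc i))) W u \<and>
             (\<forall>c<N (Suc i). v c = mv (N (Suc (Suc i))) (C (Suc i)) u c))"
    using assms(1) unfolding sres_def by (elim conjE) assumption
  then show ?thesis using assms(2,3) that by blast
qed

lemma mv_cong: "(\<And>c. c < N \<Longrightarrow> C r c = C' r' c) \<Longrightarrow> (\<And>c. c < N \<Longrightarrow> v c = v' c) \<Longrightarrow> mv N C v r = mv N C' v' r'"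
  by (auto simp: mv_def)

lemma mv_uminus: "mv N C (\<lambda>c. - v c) r = - mv N C v r"
  by (simp add: mv_def sum_negf)

lemma mv_diff: "mv N C (\<lambda>c. u c - v c) r = mv N C u r - mv N C v r"
  by (simp add: mv_def sum_subtractf algebra_simps)

lemma mv_zero [simp]: "mv N C (\<lambda>c. 0) r = 0"
  by (simp add: mv_def)

lemma mv_unit: "j < N \<Longrightarrow> mv N C (\<lambda>c. if c = j then a else 0) r = C r j * a"
  by (simp add: mv_def sum.delta if_distrib cong: if_cong)

lemma mv_mv: "mv N C (\<lambda>c. mv N' C' u c) r = mv N' (\<lambda>r e. mv N C (\<lambda>c. C' c e) r) u r"
proof -
  have "mv N C (\<lambda>c. mv N' C' u c) r = (\<Sum>c<N. \<Sum>e<N'. C r c * C' c e * u e)"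
    by (simp add: mv_def sum_distrib_left mult.assoc)
  also have "\<dots> = (\<Sum>e<N'. \<Sum>c<N. C r c * C' c e * u e)" by (rule sum.swap)
  finally show ?thesis by (simp add: mv_def sum_distrib_right)
qed

lemma sum_lessThan_add: "(\<Sum>i<a + b. f i) = (\<Sum>i<a. f i) + (\<Sum>i<b. f (a + i :: nat) :: 'k::comm_monoid_add)"
  by (induction b) (simp_all add: add.assoc)

lemma mv_nonzero: "mv N C v r \<noteq> 0 \<Longrightarrow> \<exists>c<N. C r c \<noteq> 0 \<and> v c \<noteq> 0"
  by (rule ccontr) (auto simp: mv_def intro!: sum.neutral)

section \<open>Mapping cones\<close>

definition shiftN :: "(nat \<Rightarrow> nat) \<Rightarrow> nat \<Rightarrow> nat" where
  "shiftN N i = (case i of 0 \<Rightarrow> 0 | Suc j \<Rightarrow> N j)"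

lemma shiftN_simps [simp]: "shiftN N 0 = 0" "shiftN N (Suc j) = N j"
  by (simp_all add: shiftN_def)

definition cone_N :: "(nat \<Rightarrow> nat) \<Rightarrow> (nat \<Rightarrow> nat) \<Rightarrow> nat \<Rightarrow> nat" where
  "cone_N N N' i = N i + shiftN N' i"

text \<open>A generator of the second complex enters one position higher, with its degree multiplied
  by the monomial \<open>m\<close>. The union is the product when the two sets are disjoint, which
  the applications ensure.\<close>

definition cone_dg :: "(nat \<Rightarrow> nat) \<Rightarrow> (nat \<Rightarrow> nat \<Rightarrow> 'a set) \<Rightarrow> 'a set \<Rightarrow> (nat \<Rightarrow> nat \<Rightarrow> 'a set) \<Rightarrow> nat \<Rightarrow> nat \<Rightarrow> 'a set" where
  "cone_dg N dg m dg' i c = (if c < N i then dg i c else m \<union> dg' (i - 1) (c - N i))"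

text \<open>Block triangular: \<open>C\<close> on the old generators, \<open>C'\<close> on the new
  ones, \<open>\<theta>\<close> from new to old. No sign stands in front of \<open>C'\<close>,
  because \<open>\<theta>\<close> is chosen to anticommute with the differentials.\<close>

definition cone_C :: "(nat \<Rightarrow> nat) \<Rightarrow> (nat \<Rightarrow> nat \<Rightarrow> nat \<Rightarrow> 'k::field) \<Rightarrow> (nat \<Rightarrow> nat \<Rightarrow> nat \<Rightarrow> 'k) \<Rightarrow>
    (nat \<Rightarrow> nat \<Rightarrow> nat \<Rightarrow> 'k) \<Rightarrow> nat \<Rightarrow> nat \<Rightarrow> nat \<Rightarrow> 'k" where
  "cone_C N C C' \<theta> i r c =
     (if c < N (Suc i) then (if r < N i then C i r c else 0)
      else if r < N i then \<theta> i r (c - N (Suc i)) else C' (i - 1) (r - N i) (c - N (Suc i)))"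

lemma mv_cone_old:
  "r < N i \<Longrightarrow> mv (cone_N N N' (Suc i)) (cone_C N C C' \<theta> i) v r =
     mv (N (Suc i)) (C i) v r + mv (N' i) (\<theta> i) (\<lambda>e. v (N (Suc i) + e)) r"
  by (simp add: mv_def cone_N_def sum_lessThan_add cone_C_def)

lemma mv_cone_new:
  "mv (cone_N N N' (Suc (Suc j))) (cone_C N C C' \<theta> (Suc j)) v (N (Suc j) + f) =
     mv (N' (Suc j)) (C' j) (\<lambda>e. v (N (Suc (Suc j)) + e)) f"
  by (simp add: mv_def cone_N_def sum_lessThan_add cone_C_def)

text \<open>Lifts multiplication by \<open>m\<close> to a map from the second resolution to the
  first; by \<open>col\<close>, \<open>m\<close> carries the ideal of the second into that of the
  first. The minus sign makes the differential of the cone square to zero.\<close>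

lemma comparison_map:
  fixes C C' :: "nat \<Rightarrow> nat \<Rightarrow> nat \<Rightarrow> 'k::field"
  assumes L: "sres N dg C" and K: "sres N' dg' C'"
    and col: "\<And>W. has_gen N' dg' W \<Longrightarrow> has_gen N dg (W \<union> m)"
  obtains \<theta> where "\<theta> 0 0 0 = 1"
    "\<And>i r e. r < N i \<Longrightarrow> e < N' i \<Longrightarrow> \<theta> i r e \<noteq> 0 \<Longrightarrow> dg i r \<subseteq> m \<union> dg' i e"
    "\<And>i r e. r < N i \<Longrightarrow> e < N' (Suc i) \<Longrightarrow>
       mv (N (Suc i)) (C i) (\<lambda>c. \<theta> (Suc i) c e) r = - mv (N' i) (\<theta> i) (\<lambda>f. C' i f e) r"
proof -
  \<comment> \<open>The last clause of \<open>P\<close> says that \<open>\<theta>\<close> after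
    \<open>C'\<close> lands in cycles; carrying it along makes exactness applicable at the next
    position.\<close>
  define P where "P = (\<lambda>i \<theta>. (\<forall>r<N i. \<forall>e<N' i. \<theta> r e \<noteq> (0::'k) \<longrightarrow> dg i r \<subseteq> m \<union> dg' i e) \<and> (i = 0 \<longrightarrow> \<theta> 0 0 = 1) \<and>
    (\<forall>j. i = Suc j \<longrightarrow> (\<forall>r<N j. \<forall>e<N' (Suc i). mv (N i) (C j) (\<lambda>c. mv (N' i) \<theta> (\<lambda>f. C' i f e) c) r = 0)))"
  define Q where "Q = (\<lambda>i (\<theta>::nat \<Rightarrow> nat \<Rightarrow> 'k) \<theta>'. \<forall>r<N i. \<forall>e<N' (Suc i).
     mv (N (Suc i)) (C i) (\<lambda>c. \<theta>' c e) r = - mv (N' i) \<theta> (\<lambda>f. C' i f e) r)"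
  have "\<exists>\<theta>. \<forall>i. P i (\<theta> i) \<and> Q i (\<theta> i) (\<theta> (Suc i))"
  proof (rule dependent_nat_choice)
    show "\<exists>\<theta>. P 0 \<theta>"
      unfolding P_def by (rule exI[of _ "\<lambda>_ _. 1"]) (use sresD(1,2)[OF L] in auto)
  next
    fix \<theta> i assume P: "P i \<theta>"
    have "\<exists>u. supp_in (N (Suc i)) (dg (Suc i)) (m \<union> dg' (Suc i) e) u \<and>
       (\<forall>r<N i. mv (N (Suc i)) (C i) u r = - mv (N' i) \<theta> (\<lambda>f. C' i f e) r)" if e: "e < N' (Suc i)" for e
    proof (cases i)
      case 0
      have "has_gen N' dg' (dg' (Suc 0) e)" using e 0 by (auto simp: has_gen_def)
      from col[OF this] obtain c0 where c0: "c0 < N (Suc 0)" "dg (Suc 0) c0 \<subseteq> m \<union> dg' (Suc 0) e"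
        by (auto simp: has_gen_def)
      have t: "\<theta> 0 0 = 1" using P 0 by (auto simp: P_def)
      \<comment> \<open>Exactness says nothing about position 0, so a generator \<open>c0\<close>
        inside the required degree is used directly. The first row consists of ones, hence the
        coefficient -1.\<close>
      show ?thesis
        by (rule exI[of _ "\<lambda>c. if c = c0 then -1 else 0"])
          (use c0 0 e t sresD(1,3)[OF L] sresD(1,3)[OF K] in \<open>auto simp: supp_in_def mv_unit mv_def[of "Suc 0"]\<close>)
    next
      case (Suc j)
      define v where "v = (\<lambda>c. - mv (N' i) \<theta> (\<lambda>f. C' i f e) c)"
      have s: "supp_in (N (Suc j)) (dg (Suc j)) (m \<union> dg' (Suc i) e) v"
        unfolding supp_in_def
      proof (intro allI impI)
        fix c assume c: "c < N (Suc j)" "v c \<noteq> 0"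
        then obtain f where f: "f < N' i" "\<theta> c f \<noteq> 0" "C' i f e \<noteq> 0"
          unfolding v_def using mv_nonzero[of "N' i" \<theta> _ c] by auto
        have "dg i c \<subseteq> m \<union> dg' i f" using P f c Suc by (auto simp: P_def)
        moreover have "dg' i f \<subseteq> dg' (Suc i) e" using sresD(4)[OF K f(1) e f(3)] .
        ultimately show "dg (Suc j) c \<subseteq> m \<union> dg' (Suc i) e" using Suc by auto
      qed
      have k: "mv (N (Suc j)) (C j) v r = 0" if "r < N j" for r
        using P that e Suc unfolding v_def mv_uminus P_def by auto
      obtain u where "supp_in (N (Suc (Suc j))) (dg (Suc (Suc j))) (m \<union> dg' (Suc i) e) u"
        "\<And>c. c < N (Suc j) \<Longrightarrow> v c = mv (N (Suc (Suc j))) (C (Suc j)) u c"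
        using sres_exact[OF L s k] by blast
      then show ?thesis using Suc by (intro exI[of _ u]) (auto simp: v_def)
    qed
    then obtain U where U: "\<And>e. e < N' (Suc i) \<Longrightarrow> supp_in (N (Suc i)) (dg (Suc i)) (m \<union> dg' (Suc i) e) (U e)"
      "\<And>e r. e < N' (Suc i) \<Longrightarrow> r < N i \<Longrightarrow> mv (N (Suc i)) (C i) (U e) r = - mv (N' i) \<theta> (\<lambda>f. C' i f e) r"
      by metis
    define \<theta>' where "\<theta>' = (\<lambda>c e. U e c)"
    have Q: "Q i \<theta> \<theta>'" using U(2) by (auto simp: Q_def \<theta>'_def)
    have "mv (N (Suc i)) (C i) (mv (N' (Suc i)) \<theta>' (\<lambda>f. C' (Suc i) f e)) r = 0"
      if "r < N i" "e < N' (Suc (Suc i))" for r e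
    proof -
      have "mv (N (Suc i)) (C i) (mv (N' (Suc i)) \<theta>' (\<lambda>f. C' (Suc i) f e)) r
        = mv (N' (Suc i)) (\<lambda>r g. mv (N (Suc i)) (C i) (\<lambda>c. \<theta>' c g) r) (\<lambda>f. C' (Suc i) f e) r" by (rule mv_mv)
      also have "\<dots> = mv (N' (Suc i)) (\<lambda>r g. - mv (N' i) \<theta> (\<lambda>f. C' i f g) r) (\<lambda>f. C' (Suc i) f e) r"
        by (rule mv_cong) (use Q that in \<open>auto simp: Q_def\<close>)
      also have "\<dots> = - mv (N' (Suc i)) (\<lambda>r g. mv (N' i) \<theta> (\<lambda>f. C' i f g) r) (\<lambda>f. C' (Suc i) f e) r"
        by (simp add: mv_def sum_negf)
      also have "\<dots> = - mv (N' i) \<theta> (mv (N' (Suc i)) (C' i) (\<lambda>f. C' (Suc i) f e)) r"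
        by (simp add: mv_mv)
      also have "\<dots> = - mv (N' i) \<theta> (\<lambda>f. 0) r"
      proof -
        have "mv (N' i) \<theta> (mv (N' (Suc i)) (C' i) (\<lambda>f. C' (Suc i) f e)) r = mv (N' i) \<theta> (\<lambda>f. 0) r"
          by (rule mv_cong) (use sresD(5)[OF K] that in auto)
        then show ?thesis by simp
      qed
      finally show ?thesis by simp
    qed
    then have "P (Suc i) \<theta>'" using U(1) by (auto simp: P_def \<theta>'_def supp_in_def)
    with Q show "\<exists>y. P (Suc i) y \<and> Q i \<theta> y" by auto
  qed
  then obtain \<theta> where \<theta>: "\<And>i. P i (\<theta> i)" "\<And>i. Q i (\<theta> i) (\<theta> (Suc i))" by auto
  show ?thesis
  proof (rule that[of \<theta>])
    show "\<theta> 0 0 0 = 1" using \<theta>(1)[of 0] by (auto simp: P_def)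
    show "r < N i \<Longrightarrow> e < N' i \<Longrightarrow> \<theta> i r e \<noteq> 0 \<Longrightarrow> dg i r \<subseteq> m \<union> dg' i e" for i r e
      using \<theta>(1)[of i] by (auto simp: P_def)
    show "r < N i \<Longrightarrow> e < N' (Suc i) \<Longrightarrow>
       mv (N (Suc i)) (C i) (\<lambda>c. \<theta> (Suc i) c e) r = - mv (N' i) (\<theta> i) (\<lambda>f. C' i f e) r" for i r e
      using \<theta>(2)[of i] by (auto simp: Q_def)
  qed
qed

lemma less_cone_N_cases:
  assumes "c < cone_N N N' i"
  obtains "c < N i" | j e where "i = Suc j" "c = N i + e" "e < N' j"
proof (cases "c < N i")
  case False
  then obtain e where "c = N i + e" by (metis add.commute le_Suc_ex not_less)
  then show ?thesis using assms that(2) by (cases i) (auto simp: cone_N_def)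
qed (use that in auto)

text \<open>If the second complex resolves the colon of the ideal by \<open>m\<close>, the cone
  resolves the ideal enlarged by \<open>m\<close>. One half of \<open>col\<close> gives the
  comparison map. The other half is needed for exactness at position 1, where the new component
  lives in position 0 of the second complex, outside the range of its exactness.\<close>

theorem sres_cone:
  fixes C C' :: "nat \<Rightarrow> nat \<Rightarrow> nat \<Rightarrow> 'k::field"
  assumes L: "sres N dg C" and K: "sres N' dg' C'"
    and col: "\<And>W. has_gen N' dg' W \<longleftrightarrow> has_gen N dg (W \<union> m)"
  obtains C'' :: "nat \<Rightarrow> nat \<Rightarrow> nat \<Rightarrow> 'k" where "sres (cone_N N N') (cone_dg N dg m dg') C''"
proof -
  obtain \<theta> where t0: "\<theta> 0 0 0 = 1"
    and t1: "\<And>i r e. r < N i \<Longrightarrow> e < N' i \<Longrightarrow> \<theta> i r e \<noteq> 0 \<Longrightarrow> dg i r \<subseteq> m \<union> dg' i e"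
    and t2: "\<And>i r e. r < N i \<Longrightarrow> e < N' (Suc i) \<Longrightarrow>
       mv (N (Suc i)) (C i) (\<lambda>c. \<theta> (Suc i) c e) r = - mv (N' i) (\<theta> i) (\<lambda>f. C' i f e) r"
    using comparison_map[OF L K] col by metis
  let ?N = "cone_N N N'" and ?d = "cone_dg N dg m dg'" and ?C = "cone_C N C C' \<theta>"
  have old: "?d i c = dg i c" if "c < N i" for i c using that by (simp add: cone_dg_def)
  have new: "?d (Suc i) (N (Suc i) + e) = m \<union> dg' i e" for i e by (simp add: cone_dg_def)
  have "sres ?N ?d ?C"
    unfolding sres_def
  proof (intro conjI allI impI)
    show "?N 0 = 1" using sresD(1)[OF L] by (simp add: cone_N_def)
    show "?d 0 0 = {}" using sresD(1,2)[OF L] by (simp add: cone_dg_def)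
  next
    fix c assume "c < ?N (Suc 0)"
    then show "?C 0 0 c = 1"
      by (cases rule: less_cone_N_cases) (use sresD(1,3)[OF L] sresD(1)[OF K] t0 in \<open>auto simp: cone_C_def\<close>)
  next
    fix i r c assume r: "r < ?N i" and c: "c < ?N (Suc i)" and nz: "?C i r c \<noteq> 0"
    from c show "?d i r \<subseteq> ?d (Suc i) c"
    proof (cases rule: less_cone_N_cases)
      case 1
      then have "r < N i" "C i r c \<noteq> 0" using nz by (auto simp: cone_C_def split: if_splits)
      then show ?thesis using 1 sresD(4)[OF L] by (simp add: old)
    next
      case (2 j e)
      then have ce: "c = N (Suc i) + e" "e < N' i" by auto
      from r show ?thesis
      proof (cases rule: less_cone_N_cases)
        case 1
        then have "\<theta> i r e \<noteq> 0" using nz ce by (auto simp: cone_C_def)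
        then show ?thesis using 1 ce t1 by (simp add: old new)
      next
        case (2 k f)
        then have "C' k f e \<noteq> 0" using nz ce by (auto simp: cone_C_def)
        then have "dg' k f \<subseteq> dg' (Suc k) e" using sresD(4)[OF K] 2 ce by auto
        then show ?thesis using 2 ce by (auto simp: new)
      qed
    qed
  next
    fix i r c assume r: "r < ?N i" and c: "c < ?N (Suc (Suc i))"
    from r show "mv (?N (Suc i)) (?C i) (\<lambda>b. ?C (Suc i) b c) r = 0"
    proof (cases rule: less_cone_N_cases)
      case 1
      have e: "mv (?N (Suc i)) (?C i) (\<lambda>b. ?C (Suc i) b c) r =
         mv (N (Suc i)) (C i) (\<lambda>b. ?C (Suc i) b c) r + mv (N' i) (\<theta> i) (\<lambda>e. ?C (Suc i) (N (Suc i) + e) c) r"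
        using 1 by (rule mv_cone_old)
      from c show ?thesis
      proof (cases rule: less_cone_N_cases)
        case 1
        have "mv (N (Suc i)) (C i) (\<lambda>b. ?C (Suc i) b c) r = mv (N (Suc i)) (C i) (\<lambda>b. C (Suc i) b c) r"
          by (rule mv_cong) (use 1 in \<open>auto simp: cone_C_def\<close>)
        moreover have "mv (N' i) (\<theta> i) (\<lambda>e. ?C (Suc i) (N (Suc i) + e) c) r = mv (N' i) (\<theta> i) (\<lambda>e. 0) r"
          by (rule mv_cong) (use 1 in \<open>auto simp: cone_C_def\<close>)
        ultimately show ?thesis using e sresD(5)[OF L \<open>r < N i\<close> 1] by simp
      next
        case (2 j b)
        then have 2: "c = N (Suc (Suc i)) + b" "b < N' (Suc i)" by auto
        have "mv (N (Suc i)) (C i) (\<lambda>b. ?C (Suc i) b c) r = mv (N (Suc i)) (C i) (\<lambda>a. \<theta> (Suc i) a b) r"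
          by (rule mv_cong) (use 2 in \<open>auto simp: cone_C_def\<close>)
        moreover have "mv (N' i) (\<theta> i) (\<lambda>e. ?C (Suc i) (N (Suc i) + e) c) r = mv (N' i) (\<theta> i) (\<lambda>e. C' i e b) r"
          by (rule mv_cong) (use 2 in \<open>auto simp: cone_C_def\<close>)
        ultimately show ?thesis using e t2[OF \<open>r < N i\<close>] 2 by simp
      qed
    next
      case (2 k f)
      have e: "mv (?N (Suc i)) (?C i) (\<lambda>b. ?C (Suc i) b c) r = mv (N' (Suc k)) (C' k) (\<lambda>e. ?C (Suc i) (N (Suc i) + e) c) f"
        using 2 by (simp add: mv_cone_new)
      from c show ?thesis
      proof (cases rule: less_cone_N_cases)
        case 1
        have "mv (N' (Suc k)) (C' k) (\<lambda>e. ?C (Suc i) (N (Suc i) + e) c) f = mv (N' (Suc k)) (C' k) (\<lambda>e. 0) f"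
          by (rule mv_cong) (use 1 in \<open>auto simp: cone_C_def\<close>)
        then show ?thesis using e by simp
      next
        case c: (2 j b)
        have "mv (N' (Suc k)) (C' k) (\<lambda>e. ?C (Suc i) (N (Suc i) + e) c) f = mv (N' (Suc k)) (C' k) (\<lambda>e. C' (Suc k) e b) f"
          by (rule mv_cong) (use c 2 in \<open>auto simp: cone_C_def\<close>)
        then show ?thesis using e sresD(5)[OF K] 2 c by simp
      qed
    qed
  next
    fix i W v
    assume s: "supp_in (?N (Suc i)) (?d (Suc i)) W v" and z: "\<forall>r<?N i. mv (?N (Suc i)) (?C i) v r = 0"
    define vK where "vK = (\<lambda>e. v (N (Suc i) + e))"
    have sL: "supp_in (N (Suc i)) (dg (Suc i)) W v"
      unfolding supp_in_def
    proof (intro allI impI)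
      fix c assume "c < N (Suc i)" "v c \<noteq> 0"
      then show "dg (Suc i) c \<subseteq> W" using s[unfolded supp_in_def, rule_format, of c] old[of c "Suc i"] by (simp add: cone_N_def)
    qed
    have sK: "m \<union> dg' i e \<subseteq> W" if "e < N' i" "vK e \<noteq> 0" for e
      using s[unfolded supp_in_def, rule_format, of "N (Suc i) + e"] that new[of i e] by (simp add: cone_N_def vK_def)
    have zL: "mv (N (Suc i)) (C i) v r + mv (N' i) (\<theta> i) vK r = 0" if "r < N i" for r
      using z mv_cone_old[of r N i N' C C' \<theta> v] that by (auto simp: vK_def cone_N_def)
    \<comment> \<open>The part of the cycle on the new generators is a boundary of the second
      complex; it is solved first, and the old part is corrected by it afterwards.\<close>
    obtain uK where uK: "supp_in (N' (Suc i)) (\<lambda>e. m \<union> dg' (Suc i) e) W uK"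
      "\<And>e. e < N' i \<Longrightarrow> vK e = mv (N' (Suc i)) (C' i) uK e"
    proof (cases "\<exists>e<N' i. vK e \<noteq> 0")
      case False
      then show ?thesis by (intro that[of "\<lambda>_. 0"]) (auto simp: supp_in_def)
    next
      case True
      then have m: "m \<subseteq> W" using sK by auto
      show ?thesis
      proof (cases i)
        case 0
        \<comment> \<open>A nonzero new component in position 0 must be cancelled by old generators.
          So some old generator lies in \<open>W\<close>, and the colon hypothesis turns it into a
          generator \<open>e\<close> of the second complex inside \<open>W\<close>.\<close>
        have "vK 0 \<noteq> 0" using True 0 sresD(1)[OF K] by auto
        then have "mv (N (Suc 0)) (C 0) v 0 \<noteq> 0"
          using zL[of 0] t0 sresD(1)[OF L] sresD(1)[OF K] 0 by (auto simp: mv_def[of "Suc 0"])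
        then obtain c where c: "c < N (Suc 0)" "v c \<noteq> 0" using mv_nonzero by blast
        then have "has_gen N dg W" using sL 0 by (auto simp: has_gen_def supp_in_def)
        then have "has_gen N' dg' W" using col[of W] m by (simp add: Un_absorb2)
        then obtain e where e: "e < N' (Suc 0)" "dg' (Suc 0) e \<subseteq> W" by (auto simp: has_gen_def)
        show ?thesis
          by (rule that[of "\<lambda>c. if c = e then vK 0 else 0"])
             (use e m 0 sresD(1,3)[OF K] in \<open>auto simp: supp_in_def mv_unit\<close>)
      next
        case (Suc j)
        have s': "supp_in (N' (Suc j)) (dg' (Suc j)) W vK" using sK Suc by (auto simp: supp_in_def)
        have "mv (N' (Suc j)) (C' j) vK f = 0" if "f < N' j" for f
        proof -
          have "mv (?N (Suc i)) (?C i) v (N i + f) = 0" using z that Suc by (auto simp: cone_N_def)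
          then show ?thesis using Suc by (simp add: mv_cone_new vK_def)
        qed
        from sres_exact[OF K s' this] obtain u where "supp_in (N' (Suc (Suc j))) (dg' (Suc (Suc j))) W u"
          "\<And>c. c < N' (Suc j) \<Longrightarrow> vK c = mv (N' (Suc (Suc j))) (C' (Suc j)) u c" by blast
        then show ?thesis using Suc m by (intro that[of u]) (auto simp: supp_in_def)
      qed
    qed
    \<comment> \<open>Subtracting the image of \<open>uK\<close> leaves a vector on the old
      generators that is a cycle by itself, since \<open>\<theta>\<close> anticommutes with the
      differentials.\<close>
    define vL where "vL = (\<lambda>c. v c - mv (N' (Suc i)) (\<theta> (Suc i)) uK c)"
    have "supp_in (N (Suc i)) (dg (Suc i)) W vL"
      unfolding supp_in_def
    proof (intro allI impI)
      fix c assume c: "c < N (Suc i)" "vL c \<noteq> 0"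
      show "dg (Suc i) c \<subseteq> W"
      proof (cases "v c = 0")
        case True
        then obtain e where e: "e < N' (Suc i)" "\<theta> (Suc i) c e \<noteq> 0" "uK e \<noteq> 0"
          using c mv_nonzero[of "N' (Suc i)" "\<theta> (Suc i)" uK c] by (auto simp: vL_def)
        then show ?thesis using t1[OF c(1) e(1,2)] uK(1) by (auto simp: supp_in_def)
      qed (use sL c in \<open>auto simp: supp_in_def\<close>)
    qed
    moreover have "mv (N (Suc i)) (C i) vL r = 0" if r: "r < N i" for r
    proof -
      have "mv (N (Suc i)) (C i) (mv (N' (Suc i)) (\<theta> (Suc i)) uK) r
        = mv (N' (Suc i)) (\<lambda>r e. mv (N (Suc i)) (C i) (\<lambda>c. \<theta> (Suc i) c e) r) uK r" by (rule mv_mv)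
      also have "\<dots> = mv (N' (Suc i)) (\<lambda>r e. - mv (N' i) (\<theta> i) (\<lambda>f. C' i f e) r) uK r"
        by (rule mv_cong) (use t2 r in auto)
      also have "\<dots> = - mv (N' i) (\<theta> i) (mv (N' (Suc i)) (C' i) uK) r"
        by (simp add: mv_mv) (simp add: mv_def sum_negf)
      also have "mv (N' i) (\<theta> i) (mv (N' (Suc i)) (C' i) uK) r = mv (N' i) (\<theta> i) vK r"
        by (rule mv_cong) (use uK(2) in auto)
      finally show ?thesis using zL[OF r] by (simp add: vL_def mv_diff)
    qed
    ultimately obtain uL where uL: "supp_in (N (Suc (Suc i))) (dg (Suc (Suc i))) W uL"
      "\<And>c. c < N (Suc i) \<Longrightarrow> vL c = mv (N (Suc (Suc i))) (C (Suc i)) uL c"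
      using sres_exact[OF L] by blast
    define u where "u = (\<lambda>c. if c < N (Suc (Suc i)) then uL c else uK (c - N (Suc (Suc i))))"
    show "\<exists>u. supp_in (?N (Suc (Suc i))) (?d (Suc (Suc i))) W u \<and>
             (\<forall>c<?N (Suc i). v c = mv (?N (Suc (Suc i))) (?C (Suc i)) u c)"
    proof (intro exI[of _ u] conjI allI impI)
      show "supp_in (?N (Suc (Suc i))) (?d (Suc (Suc i))) W u"
        unfolding supp_in_def
      proof (intro allI impI)
        fix c assume c: "c < ?N (Suc (Suc i))" "u c \<noteq> 0"
        from c(1) show "?d (Suc (Suc i)) c \<subseteq> W"
          by (cases rule: less_cone_N_cases) (use c(2) uL(1) uK(1) in \<open>auto simp: old new supp_in_def u_def\<close>)
      qed
    next
      fix c assume "c < ?N (Suc i)"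
      then show "v c = mv (?N (Suc (Suc i))) (?C (Suc i)) u c"
      proof (cases rule: less_cone_N_cases)
        case 1
        have "mv (N (Suc (Suc i))) (C (Suc i)) u c = mv (N (Suc (Suc i))) (C (Suc i)) uL c"
          by (rule mv_cong) (auto simp: u_def)
        then show ?thesis using 1 uL(2)[OF 1] by (simp add: mv_cone_old vL_def u_def algebra_simps)
      next
        case (2 j e)
        then show ?thesis using uK(2)[of e] by (simp add: mv_cone_new u_def vK_def)
      qed
    qed
  qed
  then show ?thesis by (rule that)
qed

lemma has_gen_cone:
  fixes C C' :: "nat \<Rightarrow> nat \<Rightarrow> nat \<Rightarrow> 'k::field"
  assumes "sres N dg C" "sres N' dg' C'"
  shows "has_gen (cone_N N N') (cone_dg N dg m dg') W \<longleftrightarrow> has_gen N dg W \<or> m \<subseteq> W"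
proof -
  have "cone_N N N' (Suc 0) = Suc (N (Suc 0))" using sresD(1)[OF assms(2)] by (simp add: cone_N_def)
  moreover have "cone_dg N dg m dg' (Suc 0) (N (Suc 0)) = m"
    using sresD(2)[OF assms(2)] by (simp add: cone_dg_def)
  moreover have "cone_dg N dg m dg' (Suc 0) c = dg (Suc 0) c" if "c < N (Suc 0)" for c
    using that by (simp add: cone_dg_def)
  ultimately show ?thesis unfolding has_gen_def by (metis less_Suc_eq)
qed

section \<open>Koszul complexes and iterated cones\<close>

lemma sres_trivial: "sres (\<lambda>i. if i = 0 then 1 else 0) (\<lambda>_ _. {}) (\<lambda>_ _ _. 0 :: 'k::field)"
  by (auto simp: sres_def supp_in_def)

text \<open>Variables are adjoined one at a time. A new variable \<open>x\<close> is a
  nonzerodivisor modulo the old ones, so the colon ideal is the old ideal again and the cone joins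
  two copies of the same complex.\<close>

lemma sres_koszul:
  assumes "finite A"
  shows "\<exists>N dg (C :: _ \<Rightarrow> _ \<Rightarrow> _ \<Rightarrow> 'k::field). sres N dg C \<and> (\<forall>W. has_gen N dg W \<longleftrightarrow> W \<inter> A \<noteq> {}) \<and>
     (\<forall>i. \<forall>c<N i. card (dg i c) = i \<and> finite (dg i c) \<and> dg i c \<subseteq> A)"
  using assms
proof (induction A rule: finite_induct)
  case empty
  show ?case
    by (rule exI, rule exI, rule exI, rule conjI, rule sres_trivial) (auto simp: has_gen_def)
next
  case (insert x A)
  then obtain N dg and C :: "_ \<Rightarrow> _ \<Rightarrow> _ \<Rightarrow> 'k" where K: "sres N dg C" "\<forall>W. has_gen N dg W \<longleftrightarrow> W \<inter> A \<noteq> {}"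
    "\<forall>i. \<forall>c<N i. card (dg i c) = i \<and> finite (dg i c) \<and> dg i c \<subseteq> A" by (elim exE conjE) (rule that)
  obtain C'' :: "_ \<Rightarrow> _ \<Rightarrow> _ \<Rightarrow> 'k" where C'': "sres (cone_N N N) (cone_dg N dg {x} dg) C''"
    by (rule sres_cone[OF K(1) K(1), of "{x}"]) (use K(2) insert(2) in auto)
  show ?case
  proof (intro exI conjI allI impI)
    show "sres (cone_N N N) (cone_dg N dg {x} dg) C''" by fact
    show "has_gen (cone_N N N) (cone_dg N dg {x} dg) W \<longleftrightarrow> W \<inter> insert x A \<noteq> {}" for W
      using K(2) by (auto simp: has_gen_cone[OF K(1) K(1)])
  next
    fix i c assume "c < cone_N N N i"
    then have "card (cone_dg N dg {x} dg i c) = i \<and> finite (cone_dg N dg {x} dg i c) \<and> cone_dg N dg {x} dg i c \<subseteq> insert x A"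
    proof (cases rule: less_cone_N_cases)
      case 1
      then show ?thesis using K(3) 1 by (auto simp: cone_dg_def)
    next
      case (2 j e)
      then have "x \<notin> dg j e" using K(3) 2 insert(2) by auto
      then show ?thesis using 2 K(3) by (auto simp: cone_dg_def)
    qed
    then show "card (cone_dg N dg {x} dg i c) = i" "finite (cone_dg N dg {x} dg i c)"
       "cone_dg N dg {x} dg i c \<subseteq> insert x A" by auto
  qed
qed

text \<open>Each step is a cone over the Koszul complex on \<open>A k\<close>, which resolves the
  colon of the earlier generators by \<open>ms ! k\<close>. As \<open>A k\<close> avoids
  \<open>ms ! k\<close>, a Koszul degree of size j becomes a degree of size d + j in position j +
  1.\<close>

theorem sres_linear_quotients:
  fixes ms :: "'a set list"
  assumes "\<And>m. m \<in> set ms \<Longrightarrow> card m = d \<and> finite m"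
    and "\<And>k. k < length ms \<Longrightarrow> finite (A k) \<and> A k \<inter> ms ! k = {} \<and>
          (\<forall>W. (\<exists>j<k. ms ! j \<subseteq> W \<union> ms ! k) \<longleftrightarrow> W \<inter> A k \<noteq> {})"
  shows "\<exists>N dg (C :: _ \<Rightarrow> _ \<Rightarrow> _ \<Rightarrow> 'k::field). sres N dg C \<and> N (Suc 0) = length ms \<and>
     (\<forall>c<length ms. dg (Suc 0) c = ms ! c) \<and>
     (\<forall>i. \<forall>c<N (Suc i). card (dg (Suc i) c) = d + i \<and> finite (dg (Suc i) c))"
  using assms
proof (induction ms rule: rev_induct)
  case Nil
  show ?case
    by (rule exI, rule exI, rule exI, rule conjI, rule sres_trivial) auto
next
  case (snoc m ms)
  have "\<exists>N dg (C :: _ \<Rightarrow> _ \<Rightarrow> _ \<Rightarrow> 'k::field). sres N dg C \<and> N (Suc 0) = length ms \<and>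
     (\<forall>c<length ms. dg (Suc 0) c = ms ! c) \<and>
     (\<forall>i. \<forall>c<N (Suc i). card (dg (Suc i) c) = d + i \<and> finite (dg (Suc i) c))"
  proof (rule snoc.IH)
    show "card m = d \<and> finite m" if "m \<in> set ms" for m using snoc.prems(1) that by auto
    show "finite (A k) \<and> A k \<inter> ms ! k = {} \<and> (\<forall>W. (\<exists>j<k. ms ! j \<subseteq> W \<union> ms ! k) \<longleftrightarrow> W \<inter> A k \<noteq> {})"
      if "k < length ms" for k
    proof -
      have e: "(ms @ [m]) ! j = ms ! j" if "j \<le> k" for j using that \<open>k < _\<close> by (simp add: nth_append)
      have "(\<exists>j<k. (ms @ [m]) ! j \<subseteq> W \<union> ms ! k) \<longleftrightarrow> (\<exists>j<k. ms ! j \<subseteq> W \<union> ms ! k)" for W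
        using e by (metis less_imp_le)
      then show ?thesis using snoc.prems(2)[of k] that e[of k] by simp
    qed
  qed
  then obtain N dg and C :: "_ \<Rightarrow> _ \<Rightarrow> _ \<Rightarrow> 'k" where L: "sres N dg C" "N (Suc 0) = length ms"
    "\<forall>c<length ms. dg (Suc 0) c = ms ! c"
    "\<forall>i. \<forall>c<N (Suc i). card (dg (Suc i) c) = d + i \<and> finite (dg (Suc i) c)" by (elim exE conjE) (rule that)
  define B where "B = A (length ms)"
  have e: "(\<exists>j<length ms. (ms @ [m]) ! j \<subseteq> W) \<longleftrightarrow> (\<exists>j<length ms. ms ! j \<subseteq> W)" for W
    by (metis nth_append)
  have B: "finite B" "B \<inter> m = {}" "\<And>W. (\<exists>j<length ms. ms ! j \<subseteq> W \<union> m) \<longleftrightarrow> W \<inter> B \<noteq> {}"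
    using snoc.prems(2)[of "length ms"] by (simp_all add: B_def e)
  obtain N' dg' and C' :: "_ \<Rightarrow> _ \<Rightarrow> _ \<Rightarrow> 'k" where K: "sres N' dg' C'" "\<forall>W. has_gen N' dg' W \<longleftrightarrow> W \<inter> B \<noteq> {}"
    "\<forall>i. \<forall>c<N' i. card (dg' i c) = i \<and> finite (dg' i c) \<and> dg' i c \<subseteq> B"
    using sres_koszul[OF B(1)] by (elim exE conjE) (rule that)
  have hg: "has_gen N dg W \<longleftrightarrow> (\<exists>j<length ms. ms ! j \<subseteq> W)" for W
    using L(2,3) by (auto simp: has_gen_def)
  obtain C'' :: "_ \<Rightarrow> _ \<Rightarrow> _ \<Rightarrow> 'k" where C'': "sres (cone_N N N') (cone_dg N dg m dg') C''"
    by (rule sres_cone[OF L(1) K(1), of m]) (use K(2) B(3) in \<open>auto simp: hg\<close>)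
  show ?case
  proof (intro exI conjI allI impI)
    show "sres (cone_N N N') (cone_dg N dg m dg') C''" by fact
    show "cone_N N N' (Suc 0) = length (ms @ [m])" using L(2) sresD(1)[OF K(1)] by (simp add: cone_N_def)
    show "cone_dg N dg m dg' (Suc 0) c = (ms @ [m]) ! c" if "c < length (ms @ [m])" for c
      using that L(2,3) sresD(1,2)[OF K(1)] by (auto simp: cone_dg_def nth_append less_Suc_eq)
  next
    fix i c assume "c < cone_N N N' (Suc i)"
    then have "card (cone_dg N dg m dg' (Suc i) c) = d + i \<and> finite (cone_dg N dg m dg' (Suc i) c)"
    proof (cases rule: less_cone_N_cases)
      case 1
      then show ?thesis using L(4) 1 by (auto simp: cone_dg_def)
    next
      case (2 j e)
      then have "m \<inter> dg' j e = {}" using K(3) 2 B(2) by auto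
      then show ?thesis using 2 K(3) snoc.prems(1)[of m] by (auto simp: cone_dg_def card_Un_disjoint)
    qed
    then show "card (cone_dg N dg m dg' (Suc i) c) = d + i" "finite (cone_dg N dg m dg' (Suc i) c)" by auto
  qed
qed

section \<open>Minimal resolutions in squarefree degrees\<close>

text \<open>Elimination of the last coordinate: the vectors vanishing there are spanned by
  induction, and at most one further vector has to be added. Spanning is meant on the first
  \<open>n\<close> coordinates only, as vectors are functions on all of \<open>nat\<close>.\<close>

lemma finite_spanning_set:
  fixes K :: "(nat \<Rightarrow> 'k::field) set"
  assumes "\<And>v w a. v \<in> K \<Longrightarrow> w \<in> K \<Longrightarrow> (\<lambda>c. v c + a * w c) \<in> K"
  shows "\<exists>B\<subseteq>K. finite B \<and> (\<forall>v\<in>K. \<exists>u. \<forall>c<n. v c = (\<Sum>b\<in>B. u b * b c))"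
  using assms
proof (induction n arbitrary: K)
  case 0
  show ?case by (rule exI[of _ "{}"]) auto
next
  case (Suc n)
  let ?K0 = "{v \<in> K. v n = 0}"
  have "\<exists>B\<subseteq>?K0. finite B \<and> (\<forall>v\<in>?K0. \<exists>u. \<forall>c<n. v c = (\<Sum>b\<in>B. u b * b c))"
  proof (rule Suc.IH)
    fix v w a assume "v \<in> ?K0" "w \<in> ?K0"
    then show "(\<lambda>c. v c + a * w c) \<in> ?K0" using Suc.prems[of v w a] by simp
  qed
  then obtain B where B: "B \<subseteq> ?K0" "finite B" "\<forall>v\<in>?K0. \<exists>u. \<forall>c<n. v c = (\<Sum>b\<in>B. u b * b c)"
    by (elim exE conjE) (rule that)
  have B0: "\<exists>u. \<forall>c<Suc n. v c = (\<Sum>b\<in>B. u b * b c)" if "v \<in> ?K0" for v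
  proof -
    from bspec[OF B(3) that] obtain u where "\<forall>c<n. v c = (\<Sum>b\<in>B. u b * b c)" ..
    moreover have "(\<Sum>b\<in>B. u b * b n) = 0" by (rule sum.neutral) (use B(1) in auto)
    ultimately show ?thesis using that by (intro exI[of _ u]) (auto simp: less_Suc_eq)
  qed
  show ?case
  proof (cases "K \<subseteq> ?K0")
    case True
    show ?thesis
    proof (intro exI[of _ B] conjI ballI)
      show "B \<subseteq> K" "finite B" using B(1,2) by auto
      show "\<exists>u. \<forall>c<Suc n. v c = (\<Sum>b\<in>B. u b * b c)" if "v \<in> K" for v
        by (rule B0) (use True that in blast)
    qed
  next
    case False
    then obtain w where w: "w \<in> K" "w n \<noteq> 0" by auto
    then have wB: "w \<notin> B" using B(1) by auto
    show ?thesis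
    proof (intro exI[of _ "insert w B"] conjI ballI)
      show "insert w B \<subseteq> K" "finite (insert w B)" using w B by auto
      fix v assume v: "v \<in> K"
      define a where "a = v n / w n"
      have "(\<lambda>c. v c + (- a) * w c) \<in> ?K0" using Suc.prems[OF v w(1), of "-a"] w by (simp add: a_def)
      from B0[OF this] obtain u where u: "\<forall>c<Suc n. v c + (- a) * w c = (\<Sum>b\<in>B. u b * b c)" ..
      have "v c = (\<Sum>b\<in>insert w B. (u(w := a)) b * b c)" if "c < Suc n" for c
      proof -
        have "(\<Sum>b\<in>B. (u(w := a)) b * b c) = (\<Sum>b\<in>B. u b * b c)"
          by (rule sum.cong) (use wB in auto)
        then have "(\<Sum>b\<in>insert w B. (u(w := a)) b * b c) = a * w c + (\<Sum>b\<in>B. u b * b c)"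
          using wB B(2) by simp
        also have "(\<Sum>b\<in>B. u b * b c) = v c + (- a) * w c" using u that by simp
        finally show ?thesis by simp
      qed
      then show "\<exists>u. \<forall>c<Suc n. v c = (\<Sum>b\<in>insert w B. u b * b c)" by (intro exI[of _ "u(w := a)"] allI impI)
    qed
  qed
qed

definition strand_kernel ::
    "nat \<Rightarrow> nat \<Rightarrow> (nat \<Rightarrow> 'a set) \<Rightarrow> (nat \<Rightarrow> nat \<Rightarrow> 'k::field) \<Rightarrow> 'a set \<Rightarrow> (nat \<Rightarrow> 'k) set" where
  "strand_kernel N N' d' C W = {v. supp_in N' d' W v \<and> (\<forall>r<N. mv N' C v r = 0)}"

text \<open>The family \<open>K\<close> is a squarefree module: elements of degree W act in all
  larger degrees too. \<open>S\<close> is a finite homogeneous generating set, each generator paired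
  with its degree.\<close>

definition kernel_gens ::
    "nat \<Rightarrow> ('a set \<Rightarrow> (nat \<Rightarrow> 'k::field) set) \<Rightarrow> ('a set \<times> (nat \<Rightarrow> 'k)) set \<Rightarrow> bool" where
  "kernel_gens N K S \<longleftrightarrow> finite S \<and> (\<forall>(W, g)\<in>S. g \<in> K W) \<and>
     (\<forall>W. \<forall>v\<in>K W. \<exists>u. (\<forall>s\<in>S. u s \<noteq> 0 \<longrightarrow> fst s \<subseteq> W) \<and> (\<forall>c<N. v c = (\<Sum>s\<in>S. u s * snd s c)))"

lemma kernel_gensD:
  assumes "kernel_gens N K S"
  shows "finite S" "s \<in> S \<Longrightarrow> snd s \<in> K (fst s)"
    "v \<in> K W \<Longrightarrow> \<exists>u. (\<forall>s\<in>S. u s \<noteq> 0 \<longrightarrow> fst s \<subseteq> W) \<and> (\<forall>c<N. v c = (\<Sum>s\<in>S. u s * snd s c))"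
  using assms by (force simp: kernel_gens_def, force simp: kernel_gens_def, unfold kernel_gens_def, blast)

lemma kernel_gens_exists:
  fixes K :: "'a::finite set \<Rightarrow> (nat \<Rightarrow> 'k::field) set"
  assumes "\<And>W v w a. v \<in> K W \<Longrightarrow> w \<in> K W \<Longrightarrow> (\<lambda>c. v c + a * w c) \<in> K W"
  shows "\<exists>S. kernel_gens N K S"
proof -
  have "\<forall>W. \<exists>B\<subseteq>K W. finite B \<and> (\<forall>v\<in>K W. \<exists>u. \<forall>c<N. v c = (\<Sum>b\<in>B. u b * b c))"
  proof
    fix W show "\<exists>B\<subseteq>K W. finite B \<and> (\<forall>v\<in>K W. \<exists>u. \<forall>c<N. v c = (\<Sum>b\<in>B. u b * b c))"
      by (rule finite_spanning_set) (rule assms)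
  qed
  then obtain B where B: "\<And>W. B W \<subseteq> K W" "\<And>W. finite (B W)"
    "\<And>W v. v \<in> K W \<Longrightarrow> \<exists>u. \<forall>c<N. v c = (\<Sum>b\<in>B W. u b * b c)" by metis
  define S where "S = Sigma UNIV B"
  have "finite S" unfolding S_def using B(2) by auto
  show ?thesis
  proof (intro exI[of _ S], unfold kernel_gens_def, intro conjI ballI allI)
    show "finite S" by fact
    show "case s of (W, g) \<Rightarrow> g \<in> K W" if "s \<in> S" for s using that B(1) by (auto simp: S_def)
    fix W v assume "v \<in> K W"
    from B(3)[OF this] obtain u where u: "\<And>c. c < N \<Longrightarrow> v c = (\<Sum>b\<in>B W. u b * b c)" by blast
    have "(\<Sum>s\<in>S. (if fst s = W then u (snd s) else 0) * snd s c) = (\<Sum>b\<in>B W. u b * b c)" for c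
    proof -
      have "(\<Sum>s\<in>S. (if fst s = W then u (snd s) else 0) * snd s c)
        = (\<Sum>s\<in>Pair W ` B W. (if fst s = W then u (snd s) else 0) * snd s c)"
        by (rule sum.mono_neutral_right) (use \<open>finite S\<close> in \<open>auto simp: S_def\<close>)
      also have "\<dots> = (\<Sum>b\<in>B W. u b * b c)" by (subst sum.reindex) (auto simp: inj_on_def)
      finally show ?thesis .
    qed
    then show "\<exists>u. (\<forall>s\<in>S. u s \<noteq> 0 \<longrightarrow> fst s \<subseteq> W) \<and> (\<forall>c<N. v c = (\<Sum>s\<in>S. u s * snd s c))"
      using u by (intro exI[of _ "\<lambda>s. if fst s = W then u (snd s) else 0"]) auto
  qed
qed

text \<open>The graded Nakayama argument: a relation in degree \<open>W\<close> with nonzero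
  coefficient at a generator of degree \<open>W\<close> itself would express that generator through
  the others, against minimal cardinality.\<close>

lemma kernel_gens_minimal:
  fixes K :: "'a::finite set \<Rightarrow> (nat \<Rightarrow> 'k::field) set"
  assumes S: "kernel_gens N K S" and min: "\<And>T. kernel_gens N K T \<Longrightarrow> card S \<le> card T"
    and z: "\<And>s. s \<in> S \<Longrightarrow> z s \<noteq> 0 \<Longrightarrow> fst s \<subseteq> W" "\<And>c. c < N \<Longrightarrow> (\<Sum>s\<in>S. z s * snd s c) = 0"
    and s0: "s0 \<in> S" "z s0 \<noteq> 0"
  shows "fst s0 \<subset> W"
proof (rule ccontr)
  assume "\<not> fst s0 \<subset> W"
  then have W: "fst s0 = W" using z(1) s0 by blast
  have fin: "finite S" using S by (simp add: kernel_gens_def)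
  have "kernel_gens N K (S - {s0})"
    unfolding kernel_gens_def
  proof (intro conjI ballI allI)
    show "finite (S - {s0})" using fin by simp
    show "case s of (W, g) \<Rightarrow> g \<in> K W" if "s \<in> S - {s0}" for s
      using that S by (auto simp: kernel_gens_def)
    fix W' v assume "v \<in> K W'"
    then obtain u where u: "\<forall>s\<in>S. u s \<noteq> 0 \<longrightarrow> fst s \<subseteq> W'" "\<forall>c<N. v c = (\<Sum>s\<in>S. u s * snd s c)"
      using kernel_gensD(3)[OF S] by blast
    \<comment> \<open>The multiple of \<open>z\<close> that cancels the coefficient at
      \<open>s0\<close>. It is nonzero only if \<open>s0\<close> occurs in the representation; then
      \<open>W\<close> lies in \<open>W'\<close>, so the support stays inside
      \<open>W'\<close>.\<close>
    define u' where "u' = (\<lambda>s. u s - u s0 / z s0 * z s)"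
    have 1: "fst s \<subseteq> W'" if "s \<in> S" "u' s \<noteq> 0" for s
    proof (cases "u s \<noteq> 0")
      case False
      then have "u s0 \<noteq> 0" "z s \<noteq> 0" using that by (auto simp: u'_def)
      then have "fst s \<subseteq> W" "W \<subseteq> W'" using z(1) that u(1) s0 W by auto
      then show ?thesis by blast
    qed (use u that in auto)
    have "v c = (\<Sum>s\<in>S - {s0}. u' s * snd s c)" if c: "c < N" for c
    proof -
      have "(\<Sum>s\<in>S. u' s * snd s c) = (\<Sum>s\<in>S. u s * snd s c) - u s0 / z s0 * (\<Sum>s\<in>S. z s * snd s c)"
        by (simp add: u'_def left_diff_distrib sum_subtractf sum_distrib_left mult.assoc)
      also have "\<dots> = v c" using u(2) z(2) c by simp
      finally have "(\<Sum>s\<in>S. u' s * snd s c) = v c" .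
      moreover have "u' s0 = 0" using s0 by (simp add: u'_def)
      ultimately show ?thesis using fin s0 by (simp add: sum.remove[of S s0])
    qed
    then show "\<exists>u. (\<forall>s\<in>S - {s0}. u s \<noteq> 0 \<longrightarrow> fst s \<subseteq> W') \<and> (\<forall>c<N. v c = (\<Sum>s\<in>S - {s0}. u s * snd s c))"
      using 1 by (intro exI[of _ u']) auto
  qed
  from min[OF this] show False using fin s0(1) by (metis card_Diff1_less not_less)
qed

text \<open>The columns of \<open>C'\<close> are a homogeneous generating set, of least cardinality,
  of the syzygies of \<open>C\<close>. The last clause is minimality one step ahead: it concerns the
  kernel of \<open>C'\<close>, hence the entries of the map still to be chosen.\<close>

lemma next_syzygies:
  fixes d' :: "nat \<Rightarrow> 'a::finite set" and C :: "nat \<Rightarrow> nat \<Rightarrow> 'k::field"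
  shows "\<exists>N'' d'' (C' :: nat \<Rightarrow> nat \<Rightarrow> 'k).
    (\<forall>e<N''. (\<lambda>c. C' c e) \<in> strand_kernel N N' d' C (d'' e)) \<and>
    (\<forall>W. \<forall>v\<in>strand_kernel N N' d' C W. \<exists>u. supp_in N'' d'' W u \<and> (\<forall>c<N'. v c = mv N'' C' u c)) \<and>
    (\<forall>W. \<forall>u\<in>strand_kernel N' N'' d'' C' W. \<forall>e<N''. u e \<noteq> 0 \<longrightarrow> d'' e \<subset> W)"
proof -
  let ?K = "strand_kernel N N' d' C"
  have lin: "(\<lambda>c. v c + a * w c) \<in> ?K W" if "v \<in> ?K W" "w \<in> ?K W" for v w a W
  proof -
    have "mv N' C (\<lambda>c. v c + a * w c) r = mv N' C v r + a * mv N' C w r" for r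
      by (simp add: mv_def algebra_simps sum.distrib sum_distrib_left)
    moreover have "supp_in N' d' W (\<lambda>c. v c + a * w c)"
      unfolding supp_in_def
    proof (intro allI impI)
      fix c assume "c < N'" "v c + a * w c \<noteq> 0"
      then have "v c \<noteq> 0 \<or> w c \<noteq> 0" by auto
      then show "d' c \<subseteq> W" using that \<open>c < N'\<close> by (auto simp: strand_kernel_def supp_in_def)
    qed
    ultimately show ?thesis using that by (simp add: strand_kernel_def)
  qed
  obtain S0 where S0: "kernel_gens N' ?K S0" using kernel_gens_exists[of ?K, OF lin] by blast
  define S where "S = arg_min card (kernel_gens N' ?K)"
  have S: "kernel_gens N' ?K S" "\<And>T. kernel_gens N' ?K T \<Longrightarrow> card S \<le> card T"
    unfolding S_def using S0 by (auto intro: arg_min_natI arg_min_nat_le)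
  have fin: "finite S" using S(1) by (simp add: kernel_gens_def)
  obtain h where h: "bij_betw h {..<card S} S" using ex_bij_betw_nat_finite[OF fin] by (auto simp: atLeast0LessThan)
  define h' where "h' = the_inv_into {..<card S} h"
  have hS: "h e \<in> S" if "e < card S" for e using h that by (auto simp: bij_betw_def)
  have h'h: "h' (h e) = e" if "e < card S" for e
    using h that by (auto simp: bij_betw_def h'_def the_inv_into_f_f)
  have hh': "h (h' s) = s" "h' s < card S" if "s \<in> S" for s
    using h that f_the_inv_into_f_bij_betw[OF h] the_inv_into_into[of h "{..<card S}" s "{..<card S}"]
    by (auto simp: bij_betw_def h'_def)
  let ?d = "\<lambda>e. fst (h e)" and ?C = "\<lambda>c e. snd (h e) c"
  have sumeq: "(\<Sum>s\<in>S. u s * snd s c) = mv (card S) ?C (\<lambda>e. u (h e)) c" for u c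
    unfolding mv_def by (subst sum.reindex_bij_betw[OF h, symmetric]) (simp add: mult.commute)
  show ?thesis
  proof (intro exI[of _ "card S"] exI[of _ ?d] exI[of _ ?C] conjI allI ballI impI)
    show "(\<lambda>c. ?C c e) \<in> ?K (?d e)" if "e < card S" for e
      using kernel_gensD(2)[OF S(1) hS[OF that]] .
  next
    fix W v assume "v \<in> ?K W"
    then obtain u where u: "\<forall>s\<in>S. u s \<noteq> 0 \<longrightarrow> fst s \<subseteq> W" "\<forall>c<N'. v c = (\<Sum>s\<in>S. u s * snd s c)"
      using kernel_gensD(3)[OF S(1)] by blast
    then show "\<exists>u. supp_in (card S) ?d W u \<and> (\<forall>c<N'. v c = mv (card S) ?C u c)"
      using hS by (intro exI[of _ "\<lambda>e. u (h e)"]) (auto simp: supp_in_def sumeq)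
  next
    fix W u e assume u: "u \<in> strand_kernel N' (card S) ?d ?C W" and e: "e < card S" "u e \<noteq> 0"
    define z where "z = (\<lambda>s. u (h' s))"
    have "fst (h e) \<subset> W"
    proof (rule kernel_gens_minimal[OF S(1) S(2), where z = z])
      fix s assume s: "s \<in> S" "z s \<noteq> 0"
      then show "fst s \<subseteq> W" using u hh'[OF s(1)] unfolding strand_kernel_def supp_in_def z_def by force
    next
      fix c assume "c < N'"
      have "mv (card S) ?C (\<lambda>e. z (h e)) c = mv (card S) ?C u c"
        by (rule mv_cong) (auto simp: z_def h'h)
      then show "(\<Sum>s\<in>S. z s * snd s c) = 0" using u \<open>c < N'\<close> by (simp add: sumeq strand_kernel_def)
    qed (use e hS in \<open>auto simp: z_def h'h\<close>)
    then show "?d e \<subset> W" .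
  qed
qed

definition minimal_sres :: "(nat \<Rightarrow> nat) \<Rightarrow> (nat \<Rightarrow> nat \<Rightarrow> 'a set) \<Rightarrow> (nat \<Rightarrow> nat \<Rightarrow> nat \<Rightarrow> 'k::field) \<Rightarrow> bool" where
  "minimal_sres N dg C \<longleftrightarrow> sres N dg C \<and>
     (\<forall>i r c. r < N i \<longrightarrow> c < N (Suc i) \<longrightarrow> C i r c \<noteq> 0 \<longrightarrow> dg i r \<subset> dg (Suc i) c)"

text \<open>Iterates \<open>next_syzygies\<close>. A state of the recursion holds two consecutive
  modules and the map between them, since the next map depends on all three; \<open>Q\<close> makes
  consecutive states overlap.\<close>

theorem minimal_sres_exists:
  fixes ms :: "'a::finite set list"
  assumes ne: "{} \<notin> set ms" and ac: "\<And>i j. i < length ms \<Longrightarrow> j < length ms \<Longrightarrow> ms ! i \<subseteq> ms ! j \<Longrightarrow> i = j"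
  shows "\<exists>N dg (C :: nat \<Rightarrow> nat \<Rightarrow> nat \<Rightarrow> 'k::field). minimal_sres N dg C \<and>
    N (Suc 0) = length ms \<and> (\<forall>c<length ms. dg (Suc 0) c = ms ! c)"
proof -
  define P where "P = (\<lambda>i (N, d :: nat \<Rightarrow> 'a set, N', d' :: nat \<Rightarrow> 'a set, C :: nat \<Rightarrow> nat \<Rightarrow> 'k).
    (\<forall>r<N. \<forall>c<N'. C r c \<noteq> 0 \<longrightarrow> d r \<subset> d' c) \<and>
    (\<forall>W. \<forall>u\<in>strand_kernel N N' d' C W. \<forall>e<N'. u e \<noteq> 0 \<longrightarrow> d' e \<subset> W) \<and>
    (i = (0::nat) \<longrightarrow> N = 1 \<and> d = (\<lambda>_. {}) \<and> N' = length ms \<and> d' = nth ms \<and> C = (\<lambda>_ _. 1)))"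
  define Q where "Q = (\<lambda>(i::nat) (N :: nat, d :: nat \<Rightarrow> 'a set, N', d' :: nat \<Rightarrow> 'a set, C :: nat \<Rightarrow> nat \<Rightarrow> 'k) (N1, d1, N2, d2, C').
    N1 = N' \<and> d1 = d' \<and> (\<forall>e<N2. (\<lambda>c. C' c e) \<in> strand_kernel N N' d' C (d2 e)) \<and>
    (\<forall>W. \<forall>v\<in>strand_kernel N N' d' C W. \<exists>u. supp_in N2 d2 W u \<and> (\<forall>c<N'. v c = mv N2 C' u c)))"
  have "\<exists>f. \<forall>i. P i (f i) \<and> Q i (f i) (f (Suc i))"
  proof (rule dependent_nat_choice)
    \<comment> \<open>Minimality at the start uses the antichain: if \<open>W\<close> equals
      \<open>ms ! e\<close>, no other generator lies in \<open>W\<close>, and the row of ones forces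
      the single remaining coefficient to vanish.\<close>
    have "ms ! e \<subset> W" if u: "u \<in> strand_kernel 1 (length ms) (nth ms) (\<lambda>_ _. 1) W"
      and e: "e < length ms" "u e \<noteq> (0::'k)" for W u e
    proof (rule ccontr)
      assume "\<not> ms ! e \<subset> W"
      then have W: "W = ms ! e" using u e by (auto simp: strand_kernel_def supp_in_def)
      have "u c = 0" if "c < length ms" "c \<noteq> e" for c
        using u ac[OF that(1) e(1)] that by (auto simp: strand_kernel_def supp_in_def W)
      then have "mv (length ms) (\<lambda>_ _. 1) u 0 = mv (length ms) (\<lambda>_ _. 1) (\<lambda>c. if c = e then u e else 0) 0"
        by (intro mv_cong) auto
      then show False using u e by (simp add: mv_unit strand_kernel_def)
    qed
    moreover have "{} \<subset> ms ! c" if "c < length ms" for c using ne nth_mem[OF that] by (metis empty_subsetI psubsetI)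
    ultimately have "P 0 (1, \<lambda>_. {}, length ms, nth ms, \<lambda>_ _. 1)"
      unfolding P_def prod.case by (intro conjI allI ballI impI refl) assumption+
    then show "\<exists>x. P 0 x" by blast
  next
    fix x i assume P: "P i x"
    obtain N d N' d' C where x: "x = (N, d, N', d', C)" by (cases x)
    obtain N'' d'' and C' :: "nat \<Rightarrow> nat \<Rightarrow> 'k" where *:
      "\<forall>e<N''. (\<lambda>c. C' c e) \<in> strand_kernel N N' d' C (d'' e)"
      "\<forall>W. \<forall>v\<in>strand_kernel N N' d' C W. \<exists>u. supp_in N'' d'' W u \<and> (\<forall>c<N'. v c = mv N'' C' u c)"
      "\<forall>W. \<forall>u\<in>strand_kernel N' N'' d'' C' W. \<forall>e<N''. u e \<noteq> 0 \<longrightarrow> d'' e \<subset> W"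
      using next_syzygies[of N N' d' C] by (elim exE conjE) (rule that)
    have P2: "\<forall>W. \<forall>u\<in>strand_kernel N N' d' C W. \<forall>e<N'. u e \<noteq> 0 \<longrightarrow> d' e \<subset> W"
      using P unfolding P_def x prod.case by (elim conjE) assumption
    have "P (Suc i) (N', d', N'', d'', C')"
      unfolding P_def prod.case
    proof (intro conjI allI ballI impI)
      fix r c assume rc: "r < N'" "c < N''" "C' r c \<noteq> 0"
      have "\<forall>u\<in>strand_kernel N N' d' C (d'' c). \<forall>e<N'. u e \<noteq> 0 \<longrightarrow> d' e \<subset> d'' c"
        using P2 by (rule spec)
      moreover have "(\<lambda>c. C' c e) \<in> strand_kernel N N' d' C (d'' e)" if "e < N''" for e
        using *(1) that by (elim allE) (erule mp)
      ultimately show "d' r \<subset> d'' c" using rc by (auto dest!: bspec[of _ _ "\<lambda>r. C' r c"])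
    next
      fix W u e assume "u \<in> strand_kernel N' N'' d'' C' W" "e < N''" "u e \<noteq> 0"
      then show "d'' e \<subset> W" using *(3) by (elim allE[of _ W]) (drule bspec, assumption, elim allE impE, assumption+)
    qed auto
    moreover have "Q i x (N', d', N'', d'', C')"
      unfolding Q_def x prod.case by (intro conjI refl) (rule *)+
    ultimately show "\<exists>y. P (Suc i) y \<and> Q i x y" by blast
  qed
  then obtain f where f: "\<And>i. P i (f i)" "\<And>i. Q i (f i) (f (Suc i))" by blast
  define N where "N = (\<lambda>i. fst (f i))"
  define dg where "dg = (\<lambda>i. fst (snd (f i)))"
  define C where "C = (\<lambda>i. snd (snd (snd (snd (f i)))))"
  have fi: "f i = (N i, dg i, N (Suc i), dg (Suc i), C i)" for i
  proof -
    obtain a b c d e where fi: "f i = (a, b, c, d, e)" by (cases "f i")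
    obtain a' b' c' d' e' where fsi: "f (Suc i) = (a', b', c', d', e')" by (cases "f (Suc i)")
    have "a' = c \<and> b' = d" using f(2)[of i] unfolding Q_def fi fsi prod.case by blast
    then show ?thesis by (simp add: N_def dg_def C_def fi fsi)
  qed
  have f0: "N 0 = 1" "dg 0 = (\<lambda>_. {})" "N (Suc 0) = length ms" "dg (Suc 0) = nth ms" "C 0 = (\<lambda>_ _. 1)"
    using f(1)[of 0] unfolding P_def fi prod.case by (elim conjE, simp)+
  have st: "dg i r \<subset> dg (Suc i) c" if "r < N i" "c < N (Suc i)" "C i r c \<noteq> 0" for i r c
  proof -
    have "\<forall>r<N i. \<forall>c<N (Suc i). C i r c \<noteq> 0 \<longrightarrow> dg i r \<subset> dg (Suc i) c"
      using f(1)[of i] unfolding P_def fi prod.case by (elim conjE) assumption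
    then show ?thesis using that by blast
  qed
  have ker: "(\<lambda>c. C (Suc i) c e) \<in> strand_kernel (N i) (N (Suc i)) (dg (Suc i)) (C i) (dg (Suc (Suc i)) e)"
    if "e < N (Suc (Suc i))" for i e
  proof -
    have "\<forall>e<N (Suc (Suc i)). (\<lambda>c. C (Suc i) c e) \<in> strand_kernel (N i) (N (Suc i)) (dg (Suc i)) (C i) (dg (Suc (Suc i)) e)"
      using f(2)[of i] unfolding fi Q_def prod.case by (elim conjE) assumption
    then show ?thesis using that by blast
  qed
  have ex: "\<exists>u. supp_in (N (Suc (Suc i))) (dg (Suc (Suc i))) W u \<and> (\<forall>c<N (Suc i). v c = mv (N (Suc (Suc i))) (C (Suc i)) u c)"
    if "v \<in> strand_kernel (N i) (N (Suc i)) (dg (Suc i)) (C i) W" for i W v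
  proof -
    have "\<forall>W. \<forall>v\<in>strand_kernel (N i) (N (Suc i)) (dg (Suc i)) (C i) W. \<exists>u. supp_in (N (Suc (Suc i))) (dg (Suc (Suc i))) W u \<and>
        (\<forall>c<N (Suc i). v c = mv (N (Suc (Suc i))) (C (Suc i)) u c)"
      using f(2)[of i] unfolding fi Q_def prod.case by (elim conjE) assumption
    then show ?thesis using that by blast
  qed
  have "minimal_sres N dg C"
    unfolding minimal_sres_def sres_def
  proof (intro conjI allI impI)
    show "mv (N (Suc i)) (C i) (\<lambda>c. C (Suc i) c e) r = 0" if "r < N i" "e < N (Suc (Suc i))" for i r e
      using ker[OF that(2)] that(1) by (simp add: strand_kernel_def)
    show "\<exists>u. supp_in (N (Suc (Suc i))) (dg (Suc (Suc i))) W u \<and> (\<forall>c<N (Suc i). v c = mv (N (Suc (Suc i))) (C (Suc i)) u c)"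
      if "supp_in (N (Suc i)) (dg (Suc i)) W v" "\<forall>r<N i. mv (N (Suc i)) (C i) v r = 0" for i W v
      using ex that by (simp add: strand_kernel_def)
  qed (use f0 st in auto)
  then show ?thesis
    by (intro exI[of _ N] exI[of _ dg] exI[of _ C] conjI) (simp_all add: f0)
qed

section \<open>Monomial ideals\<close>

abbreviation lookup :: "('a \<Rightarrow>\<^sub>0 'b::zero) \<Rightarrow> 'a \<Rightarrow> 'b" where "lookup \<equiv> Poly_Mapping.lookup"
abbreviation keys :: "('a \<Rightarrow>\<^sub>0 'b::zero) \<Rightarrow> 'a set" where "keys \<equiv> Poly_Mapping.keys"
abbreviation single :: "'a \<Rightarrow> 'b \<Rightarrow> ('a \<Rightarrow>\<^sub>0 'b::zero)" where "single \<equiv> Poly_Mapping.single"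

lemma module_times: "Modules.module ((*) :: 'r::comm_ring_1 \<Rightarrow> 'r \<Rightarrow> 'r)"
  by unfold_locales (auto simp: algebra_simps)

lemmas ideal_gen_base = module.span_base[OF module_times, folded ideal_gen_def]
  and ideal_gen_mult = module.span_scale[OF module_times, folded ideal_gen_def]
  and ideal_gen_sum = module.span_sum[OF module_times, folded ideal_gen_def]
  and ideal_gen_minimal = module.span_minimal[OF module_times, folded ideal_gen_def]
  and ideal_gen_empty = module.span_empty[OF module_times, folded ideal_gen_def]

definition divides :: "('a \<Rightarrow>\<^sub>0 nat) \<Rightarrow> ('a \<Rightarrow>\<^sub>0 nat) \<Rightarrow> bool" where
  "divides s t \<longleftrightarrow> (\<forall>x. lookup s x \<le> lookup t x)"

lemma divides_diff_add: "divides s t \<Longrightarrow> (t - s) + s = t"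
  by (rule poly_mapping_eqI) (simp add: divides_def lookup_add lookup_minus)

lemma divides_add [simp]: "divides s (t + s)" "divides s (s + t)"
  by (auto simp: divides_def lookup_add)

lemma divides_refl [simp]: "divides s s"
  by (auto simp: divides_def)

lemma divides_trans: "divides s t \<Longrightarrow> divides t u \<Longrightarrow> divides s u"
  by (auto simp: divides_def intro: order_trans)

lemma divides_antisym: "divides s t \<Longrightarrow> divides t s \<Longrightarrow> s = t"
  by (rule poly_mapping_eqI) (auto simp: divides_def intro: antisym)

lemma divides_add_right: "divides s t \<Longrightarrow> divides s (u + t)"
  by (meson divides_add(1) divides_trans)

lemma exp_degree_altdef: "exp_degree (t :: 'a::finite \<Rightarrow>\<^sub>0 nat) = (\<Sum>v\<in>UNIV. lookup t v)"
  unfolding exp_degree_def by (rule sum.mono_neutral_left) (auto simp: in_keys_iff)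

lemma exp_degree_add: "exp_degree (s + t :: 'a::finite \<Rightarrow>\<^sub>0 nat) = exp_degree s + exp_degree t"
  by (simp add: exp_degree_altdef lookup_add sum.distrib)

lemma poly_mapping_as_sum: "p = (\<Sum>t\<in>keys p. single t (lookup p t))"
proof (rule poly_mapping_eqI)
  fix k
  have "lookup (\<Sum>t\<in>keys p. single t (lookup p t)) k = (\<Sum>t\<in>keys p. if t = k then lookup p k else 0)"
    unfolding lookup_sum by (rule sum.cong) (auto simp: lookup_single when_def)
  also have "\<dots> = lookup p k" by (simp add: in_keys_iff)
  finally show "lookup p k = lookup (\<Sum>t\<in>keys p. single t (lookup p t)) k" by simp
qed

definition pmono :: "('a \<Rightarrow>\<^sub>0 nat) \<Rightarrow> ('a, 'k::field) pring" where
  "pmono t = single t 1"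

lemma pmono_inj [simp]: "pmono s = (pmono t :: ('a, 'k::field) pring) \<longleftrightarrow> s = t"
proof
  assume "pmono s = (pmono t :: ('a, 'k) pring)"
  then have "keys (pmono s :: ('a, 'k) pring) = keys (pmono t :: ('a, 'k) pring)" by simp
  then show "s = t" by (simp add: pmono_def)
qed simp

lemma keys_pmono [simp]: "keys (pmono t :: ('a, 'k::field) pring) = {t}"
  by (simp add: pmono_def)

lemma monomials_altdef: "monomials = range pmono"
  by (simp add: monomials_def pmono_def)

lemma lookup_times_single:
  fixes p :: "('a, 'k::field) pring"
  shows "lookup (p * single s c) (t + s) = lookup p t * c"
proof -
  have "p * single s c = (\<Sum>u\<in>keys p. single u (lookup p u) * single s c)"
    by (subst poly_mapping_as_sum[of p]) (simp add: sum_distrib_right)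
  then have "lookup (p * single s c) (t + s) = (\<Sum>u\<in>keys p. if u = t then lookup p t * c else 0)"
    by (auto simp: lookup_sum mult_single lookup_single when_def intro!: sum.cong)
  also have "\<dots> = lookup p t * c" by (auto simp: in_keys_iff)
  finally show ?thesis .
qed

lemma keys_times_mono: "keys (p * pmono s :: ('a, 'k::field) pring) = (\<lambda>t. t + s) ` keys p"
proof
  show "keys (p * pmono s) \<subseteq> (\<lambda>t. t + s) ` keys p"
    using keys_mult[of p "pmono s :: ('a, 'k) pring"] by auto
  show "(\<lambda>t. t + s) ` keys p \<subseteq> keys (p * pmono s)"
    by (auto simp: in_keys_iff pmono_def lookup_times_single)
qed

theorem mem_monomial_ideal_iff:
  fixes p :: "('a, 'k::field) pring"
  shows "p \<in> ideal_gen (pmono ` T) \<longleftrightarrow> (\<forall>t\<in>keys p. \<exists>s\<in>T. divides s t)"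
proof
  let ?Q = "{p :: ('a, 'k) pring. \<forall>t\<in>keys p. \<exists>s\<in>T. divides s t}"
  have "Modules.module.subspace (*) ?Q"
    unfolding module.subspace_def[OF module_times]
  proof (intro conjI ballI allI)
    fix p q assume "p \<in> ?Q" "q \<in> ?Q"
    then show "p + q \<in> ?Q" using keys_add[of p q] by blast
  next
    fix c p assume p: "p \<in> ?Q"
    have "\<exists>s\<in>T. divides s t" if t: "t \<in> keys (c * p)" for t
    proof -
      obtain a b where "t = a + b" "b \<in> keys p" using keys_mult[of c p] t by blast
      then show ?thesis using p divides_add_right by blast
    qed
    then show "c * p \<in> ?Q" by blast
  qed simp
  moreover have "pmono ` T \<subseteq> ?Q" by (use divides_refl in fastforce)
  ultimately have "ideal_gen (pmono ` T) \<subseteq> ?Q" by (intro ideal_gen_minimal)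
  then show "\<forall>t\<in>keys p. \<exists>s\<in>T. divides s t" if "p \<in> ideal_gen (pmono ` T)" using that by blast
next
  assume *: "\<forall>t\<in>keys p. \<exists>s\<in>T. divides s t"
  have "single t (lookup p t) \<in> ideal_gen (pmono ` T)" if t: "t \<in> keys p" for t
  proof -
    obtain s where s: "s \<in> T" "divides s t" using * t by blast
    have "single t (lookup p t) = single (t - s) (lookup p t) * pmono s"
      by (simp add: pmono_def mult_single divides_diff_add[OF s(2)])
    then show ?thesis using s(1) by (simp add: ideal_gen_base ideal_gen_mult)
  qed
  then have "(\<Sum>t\<in>keys p. single t (lookup p t)) \<in> ideal_gen (pmono ` T)" by (intro ideal_gen_sum)
  then show "p \<in> ideal_gen (pmono ` T)" using poly_mapping_as_sum[of p] by simp
qed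

lemma var_eq_mono: "var v = pmono (single v 1)"
  by (simp add: var_def pmono_def)

lemma divides_single_iff: "divides (single v (Suc 0)) t \<longleftrightarrow> v \<in> keys t"
  by (auto simp: divides_def lookup_single when_def in_keys_iff Suc_le_eq)

lemma mem_maximal_ideal_iff: "p \<in> ideal_gen (range var) \<longleftrightarrow> lookup p 0 = 0"
  for p :: "('a, 'k::field) pring"
proof -
  have e: "range var = (pmono ` range (\<lambda>v. single v (Suc 0)) :: ('a, 'k) pring set)" by (auto simp: var_eq_mono)
  have "p \<in> ideal_gen (range var) \<longleftrightarrow> (\<forall>t\<in>keys p. keys t \<noteq> {})"
    unfolding e by (subst mem_monomial_ideal_iff) (auto simp: divides_single_iff ex_in_conv)
  also have "\<dots> \<longleftrightarrow> lookup p 0 = 0" by (auto simp: in_keys_iff)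
  finally show ?thesis .
qed

text \<open>Removing the constant term from \<open>p\<close> leaves an element of the ideal of the
  variables, whose multiples have no constant term either.\<close>

lemma lookup_zero_times: "lookup (p * q) 0 = lookup p 0 * lookup q 0"
  for p q :: "('a, 'k::field) pring"
proof -
  define p' where "p' = p - single 0 (lookup p 0)"
  have "lookup p' 0 = 0" by (simp add: p'_def lookup_minus)
  then have "p' \<in> ideal_gen (range var)" by (simp add: mem_maximal_ideal_iff)
  then have "q * p' \<in> ideal_gen (range var)" by (rule ideal_gen_mult)
  then have "lookup (q * p') 0 = 0" by (simp add: mem_maximal_ideal_iff)
  moreover have "p * q = q * single 0 (lookup p 0) + q * p'" by (simp add: p'_def algebra_simps)
  moreover have "lookup (q * single 0 (lookup p 0)) 0 = lookup q 0 * lookup p 0"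
    using lookup_times_single[of q 0 "lookup p 0" 0] by simp
  ultimately show ?thesis by (simp add: lookup_add mult.commute)
qed

lemma mem_colon_mono_iff:
  fixes f :: "('a, 'k::field) pring"
  shows "f \<in> colon_ideal (ideal_gen (pmono ` T)) (ideal_gen {pmono s}) \<longleftrightarrow>
    (\<forall>t\<in>keys f. \<exists>u\<in>T. divides u (t + s))"
proof -
  have "f \<in> colon_ideal (ideal_gen (pmono ` T)) (ideal_gen {pmono s}) \<longleftrightarrow> f * pmono s \<in> ideal_gen (pmono ` T)"
  proof
    assume "f \<in> colon_ideal (ideal_gen (pmono ` T)) (ideal_gen {pmono s})"
    then show "f * pmono s \<in> ideal_gen (pmono ` T)" by (auto simp: colon_ideal_def intro: ideal_gen_base)
  next
    assume f: "f * pmono s \<in> ideal_gen (pmono ` T)"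
    have "f * g \<in> ideal_gen (pmono ` T)" if g: "g \<in> ideal_gen {pmono s}" for g
    proof -
      obtain k where k: "g = k * pmono s"
        using g by (auto simp: ideal_gen_def module.span_singleton[OF module_times])
      then have "f * g = k * (f * pmono s)" by (simp add: algebra_simps)
      then show ?thesis using f by (simp add: ideal_gen_mult)
    qed
    then show "f \<in> colon_ideal (ideal_gen (pmono ` T)) (ideal_gen {pmono s})" by (simp add: colon_ideal_def)
  qed
  also have "\<dots> \<longleftrightarrow> (\<forall>t\<in>keys f. \<exists>u\<in>T. divides u (t + s))"
    by (simp add: mem_monomial_ideal_iff keys_times_mono)
  finally show ?thesis .
qed

text \<open>Any monomial generating set contains the antichain: \<open>t\<close> is divisible by
  some \<open>u\<close> of that set, which is divisible by some \<open>s\<close> in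
  \<open>T\<close>, and s = t forces u = t. Minimality and uniqueness both follow from this.\<close>

theorem Mingens_mono_ideal:
  fixes T :: "('a \<Rightarrow>\<^sub>0 nat) set"
  assumes "\<And>s t. s \<in> T \<Longrightarrow> t \<in> T \<Longrightarrow> divides s t \<Longrightarrow> s = t"
  shows "Mingens (ideal_gen (pmono ` T)) = (pmono ` T :: ('a, 'k::field) pring set)"
  unfolding Mingens_def
proof (rule the_equality)
  let ?I = "ideal_gen (pmono ` T) :: ('a, 'k) pring set"
  have sub: "pmono ` T \<subseteq> (monomials :: ('a, 'k) pring set)" by (auto simp: monomials_altdef)
  have *: "pmono ` T \<subseteq> C" if C: "C \<subseteq> monomials" "ideal_gen C = ?I" for C :: "('a, 'k) pring set"
  proof
    fix m :: "('a, 'k) pring" assume "m \<in> pmono ` T"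
    then obtain t where t: "t \<in> T" "m = pmono t" by auto
    obtain U where U: "C = pmono ` U" using C(1) unfolding monomials_altdef by (rule subset_imageE)
    have "pmono t \<in> (ideal_gen (pmono ` U) :: ('a, 'k) pring set)" using C(2) t U by (auto intro: ideal_gen_base)
    then obtain u where u: "u \<in> U" "divides u t" by (auto simp: mem_monomial_ideal_iff)
    have "pmono u \<in> ?I" using C(2) u U by (auto intro: ideal_gen_base)
    then obtain s where s: "s \<in> T" "divides s u" by (auto simp: mem_monomial_ideal_iff)
    then have "s = t" using assms[OF s(1) t(1)] divides_trans u by blast
    then show "m \<in> C" using s u t U by (auto dest: divides_antisym)
  qed
  show "pmono ` T \<subseteq> (monomials :: ('a, 'k) pring set) \<and> ideal_gen (pmono ` T) = ?I \<and> (\<forall>C\<subset>pmono ` T. ideal_gen C \<noteq> ?I)"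
  proof (intro conjI allI impI notI)
    fix C assume C: "C \<subset> pmono ` T" "ideal_gen C = ?I"
    then have "pmono ` T \<subseteq> C" using sub by (intro *) auto
    then show False using C(1) by blast
  qed (use sub in auto)
  show "B = pmono ` T" if "B \<subseteq> monomials \<and> ideal_gen B = ?I \<and> (\<forall>C\<subset>B. ideal_gen C \<noteq> ?I)" for B
  proof (rule ccontr)
    assume "B \<noteq> pmono ` T"
    moreover have "pmono ` T \<subseteq> B" using that by (intro *) auto
    ultimately show False using that by blast
  qed
qed

definition sqf :: "'a::finite set \<Rightarrow> 'a \<Rightarrow>\<^sub>0 nat" where
  "sqf W = (\<Sum>v\<in>W. single v 1)"

lemma lookup_sqf: "lookup (sqf W) v = (if v \<in> W then 1 else 0)"
  by (simp add: sqf_def lookup_sum lookup_single when_def)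

lemma keys_sqf [simp]: "keys (sqf W) = W"
  by (auto simp: in_keys_iff lookup_sqf split: if_splits)

lemma sqf_inj [simp]: "sqf V = sqf W \<longleftrightarrow> V = W"
  by (metis keys_sqf)

lemma divides_sqf_iff: "divides (sqf W) t \<longleftrightarrow> W \<subseteq> keys t"
  by (auto simp: divides_def lookup_sqf in_keys_iff Suc_le_eq)

lemma exp_degree_sqf [simp]: "exp_degree (sqf W) = card W"
  by (simp add: exp_degree_def lookup_sqf)

lemma sqf_empty [simp]: "sqf {} = 0"
  by (simp add: sqf_def)

lemma prod_list_var:
  "distinct vs \<Longrightarrow> prod_list (map var vs) = (pmono (sqf (set vs)) :: ('a::finite, 'k::field) pring)"
proof (induction vs)
  case (Cons v vs)
  then have "single v 1 + sqf (set vs) = sqf (insert v (set vs))" by (simp add: sqf_def)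
  then show ?case using Cons by (simp add: var_def pmono_def mult_single)
qed (simp add: pmono_def)

lemma keys_exp_add: "keys (s + t :: 'a \<Rightarrow>\<^sub>0 nat) = keys s \<union> keys t"
  by (auto simp: in_keys_iff lookup_add)

section \<open>Minimal graded resolutions and their degrees\<close>

text \<open>
  In \<open>gres M E P I\<close> the module in position \<open>i\<close> has \<open>M i\<close> generators of degrees \<open>E i c\<close>, position \<open>0\<close> being
  the polynomial ring; the matrix \<open>P i\<close> represents the map from position \<open>i + 1\<close> to position \<open>i\<close>. The first map
  is exempt from minimality, because its entries generate \<open>I\<close>.
\<close>

definition gres :: "(nat \<Rightarrow> nat) \<Rightarrow> (nat \<Rightarrow> nat \<Rightarrow> nat) \<Rightarrow> (nat \<Rightarrow> nat \<Rightarrow> nat \<Rightarrow> ('a, 'k::field) pring) \<Rightarrow> ('a, 'k) pring set \<Rightarrow> bool" where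
  "gres M E P I \<longleftrightarrow> M 0 = 1 \<and> E 0 0 = 0 \<and>
     (\<forall>i. \<forall>r<M i. \<forall>c<M (Suc i). \<forall>t\<in>keys (P i r c). exp_degree t + E i r = E (Suc i) c) \<and>
     (\<forall>i. \<forall>r<M (Suc i). \<forall>c<M (Suc (Suc i)). lookup (P (Suc i) r c) 0 = 0) \<and>
     (\<forall>p. p \<in> I \<longleftrightarrow> (\<exists>w. p = mv (M (Suc 0)) (P 0) w 0)) \<and>
     (\<forall>i w. (\<forall>r<M i. mv (M (Suc i)) (P i) w r = 0) \<longleftrightarrow>
        (\<exists>y. \<forall>c<M (Suc i). w c = mv (M (Suc (Suc i))) (P (Suc i)) y c))"

lemma gresD:
  assumes "gres M E P I"
  shows "M 0 = 1" "E 0 0 = 0"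
    "\<And>i r c t. r < M i \<Longrightarrow> c < M (Suc i) \<Longrightarrow> t \<in> keys (P i r c) \<Longrightarrow> exp_degree t + E i r = E (Suc i) c"
    "\<And>i r c. r < M (Suc i) \<Longrightarrow> c < M (Suc (Suc i)) \<Longrightarrow> lookup (P (Suc i) r c) 0 = 0"
    "\<And>p. p \<in> I \<longleftrightarrow> (\<exists>w. p = mv (M (Suc 0)) (P 0) w 0)"
    "\<And>i w. (\<forall>r<M i. mv (M (Suc i)) (P i) w r = 0) \<longleftrightarrow>
        (\<exists>y. \<forall>c<M (Suc i). w c = mv (M (Suc (Suc i))) (P (Suc i)) y c)"
  using assms unfolding gres_def by (elim conjE, simp)+

lemma gres_comp:
  assumes "gres M E P I" "r < M i" "e < M (Suc (Suc i))"
  shows "mv (M (Suc i)) (P i) (\<lambda>c. P (Suc i) c e) r = 0"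
proof -
  have "\<exists>y. \<forall>c<M (Suc i). P (Suc i) c e = mv (M (Suc (Suc i))) (P (Suc i)) y c"
    by (intro exI[of _ "\<lambda>f. if f = e then 1 else 0"]) (simp add: mv_unit assms(3))
  then have "\<forall>r<M i. mv (M (Suc i)) (P i) (\<lambda>c. P (Suc i) c e) r = 0"
    using gresD(6)[OF assms(1), of i "\<lambda>c. P (Suc i) c e"] by iprover
  then show ?thesis using assms(2) by simp
qed

text \<open>The homogeneous part that puts a multiple of a basis element of degree \<open>e\<close>
  into total degree \<open>d\<close>, stated additively to avoid the truncated difference d -
  e.\<close>

definition hpart :: "nat \<Rightarrow> nat \<Rightarrow> ('a, 'k::field) pring \<Rightarrow> ('a, 'k) pring" where
  "hpart d e p = Poly_Mapping.mapp (\<lambda>t c. c when exp_degree t + e = d) p"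

lemma lookup_hpart: "lookup (hpart d e p) t = (if exp_degree t + e = d then lookup p t else 0)"
  by (auto simp: hpart_def lookup_mapp when_def in_keys_iff)

lemma keys_hpart: "t \<in> keys (hpart d e p) \<Longrightarrow> exp_degree t + e = d"
  by (auto simp: in_keys_iff lookup_hpart split: if_splits)

lemma hpart_sum: "hpart d e (sum f A) = (\<Sum>x\<in>A. hpart d e (f x))"
  by (rule poly_mapping_eqI) (simp add: lookup_hpart lookup_sum)

lemma hpart_times:
  fixes p y :: "('a::finite, 'k::field) pring"
  assumes "\<And>t. t \<in> keys p \<Longrightarrow> exp_degree t + a = b"
  shows "hpart d a (p * y) = p * hpart d b y"
proof (rule poly_mapping_eqI)
  fix k
  define q where "q = y - hpart d b y"
  have "p * y = p * hpart d b y + p * q" by (simp add: q_def algebra_simps)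
  then have e: "lookup (p * y) k = lookup (p * hpart d b y) k + lookup (p * q) k" by (simp add: lookup_add)
  have 1: "lookup (p * hpart d b y) k = 0" if "exp_degree k + a \<noteq> d"
  proof (rule ccontr)
    assume "lookup (p * hpart d b y) k \<noteq> 0"
    then have "k \<in> keys (p * hpart d b y)" by (simp add: in_keys_iff)
    then obtain s t where st: "k = s + t" "s \<in> keys p" "t \<in> keys (hpart d b y)" using keys_mult by blast
    then show False using assms[OF st(2)] keys_hpart[OF st(3)] \<open>exp_degree k + a \<noteq> d\<close>
      by (simp add: exp_degree_add)
  qed
  have 2: "lookup (p * q) k = 0" if "exp_degree k + a = d"
  proof (rule ccontr)
    assume "lookup (p * q) k \<noteq> 0"
    then have "k \<in> keys (p * q)" by (simp add: in_keys_iff)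
    then obtain s t where st: "k = s + t" "s \<in> keys p" "t \<in> keys q" using keys_mult by blast
    then have "exp_degree t + b \<noteq> d" by (auto simp: q_def in_keys_iff lookup_minus lookup_hpart)
    then show False using assms[OF st(2)] st \<open>exp_degree k + a = d\<close> by (simp add: exp_degree_add)
  qed
  show "lookup (hpart d a (p * y)) k = lookup (p * hpart d b y) k"
    using e 1 2 by (auto simp: lookup_hpart)
qed

lemma hpart_id: "(\<And>t. t \<in> keys p \<Longrightarrow> exp_degree t + e = d) \<Longrightarrow> hpart d e p = p"
  by (rule poly_mapping_eqI) (auto simp: lookup_hpart in_keys_iff)

text \<open>Treats uniformly the augmentation, whose image is \<open>I\<close>, and the later
  positions, where exactness applies.\<close>

lemma gres_lift:
  assumes F: "gres M E P I" and "i = 0 \<Longrightarrow> v 0 \<in> I"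
    and "\<And>j r. i = Suc j \<Longrightarrow> r < M j \<Longrightarrow> mv (M i) (P j) v r = 0"
  obtains y where "\<And>r. r < M i \<Longrightarrow> v r = mv (M (Suc i)) (P i) y r"
proof (cases i)
  case 0
  then have "\<exists>y. v 0 = mv (M (Suc 0)) (P 0) y 0" using assms(2) gresD(5)[OF F, of "v 0"] by simp
  then obtain y where "v 0 = mv (M (Suc 0)) (P 0) y 0" ..
  then show ?thesis using gresD(1)[OF F] 0 by (intro that[of y]) simp
next
  case (Suc j)
  then have "\<forall>r<M j. mv (M (Suc j)) (P j) v r = 0" using assms(3) by simp
  then have "\<exists>y. \<forall>c<M (Suc j). v c = mv (M (Suc (Suc j))) (P (Suc j)) y c"
    using gresD(6)[OF F, of j v] by iprover
  then obtain y where "\<forall>c<M (Suc j). v c = mv (M (Suc (Suc j))) (P (Suc j)) y c" ..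
  then show ?thesis using Suc by (intro that[of y]) simp
qed

text \<open>Any lift may be replaced by its homogeneous part, because the matrix entries are
  homogeneous.\<close>

lemma gres_lift_homogeneous:
  fixes P :: "nat \<Rightarrow> nat \<Rightarrow> nat \<Rightarrow> ('a::finite, 'k::field) pring"
  assumes F: "gres M E P I" and "i = 0 \<Longrightarrow> v 0 \<in> I"
    and "\<And>j r. i = Suc j \<Longrightarrow> r < M j \<Longrightarrow> mv (M i) (P j) v r = 0"
    and hom: "\<And>r t. r < M i \<Longrightarrow> t \<in> keys (v r) \<Longrightarrow> exp_degree t + E i r = d"
  obtains y where "\<And>r. r < M i \<Longrightarrow> v r = mv (M (Suc i)) (P i) y r"
    "\<And>s t. s < M (Suc i) \<Longrightarrow> t \<in> keys (y s) \<Longrightarrow> exp_degree t + E (Suc i) s = d"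
proof -
  obtain y where y: "\<And>r. r < M i \<Longrightarrow> v r = mv (M (Suc i)) (P i) y r"
    using gres_lift[OF F, of i v] assms(2,3) by metis
  show ?thesis
  proof (rule that[of "\<lambda>s. hpart d (E (Suc i) s) (y s)"])
    fix r assume r: "r < M i"
    have "v r = hpart d (E i r) (v r)" using hom[OF r] by (simp add: hpart_id)
    also have "\<dots> = (\<Sum>s<M (Suc i). hpart d (E i r) (P i r s * y s))"
      by (simp add: y[OF r] mv_def hpart_sum)
    also have "\<dots> = (\<Sum>s<M (Suc i). P i r s * hpart d (E (Suc i) s) (y s))"
      by (rule sum.cong) (use gresD(3)[OF F r] in \<open>auto intro: hpart_times\<close>)
    finally show "v r = mv (M (Suc i)) (P i) (\<lambda>s. hpart d (E (Suc i) s) (y s)) r" by (simp add: mv_def)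
  qed (rule keys_hpart)
qed

lemma keys_mvD:
  assumes "t \<in> keys (mv n A v r)"
  obtains s a b where "s < n" "t = a + b" "a \<in> keys (A r s)" "b \<in> keys (v s)"
proof -
  have "t \<in> (\<Union>s\<in>{..<n}. keys (A r s * v s))" using keys_sum[of "\<lambda>s. A r s * v s" "{..<n}"] assms by (auto simp: mv_def)
  then obtain s where s: "s < n" "t \<in> keys (A r s * v s)" by auto
  then obtain a b where "t = a + b" "a \<in> keys (A r s)" "b \<in> keys (v s)" using keys_mult by blast
  with s(1) show ?thesis by (rule that)
qed

text \<open>Lifts the identity of the ring to a degree-preserving map between two resolutions of the
  same ideal. The last clause of the invariant \<open>A\<close> says that the columns to be lifted
  next are cycles of the target.\<close>

lemma gres_chain_map:
  fixes P P' :: "nat \<Rightarrow> nat \<Rightarrow> nat \<Rightarrow> ('a::finite, 'k::field) pring"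
  assumes F: "gres M E P I" and F': "gres M' E' P' I"
  obtains \<Phi> where "\<Phi> 0 0 0 = 1"
    "\<And>i r c t. r < M' i \<Longrightarrow> c < M i \<Longrightarrow> t \<in> keys (\<Phi> i r c) \<Longrightarrow> exp_degree t + E' i r = E i c"
    "\<And>i r c. r < M' i \<Longrightarrow> c < M (Suc i) \<Longrightarrow>
       mv (M' (Suc i)) (P' i) (\<lambda>s. \<Phi> (Suc i) s c) r = mv (M i) (\<Phi> i) (\<lambda>s. P i s c) r"
proof -
  define A where "A = (\<lambda>i \<Phi>. (\<forall>r<M' i. \<forall>c<M i. \<forall>t\<in>keys (\<Phi> r c). exp_degree t + E' i r = E i c) \<and>
    (i = 0 \<longrightarrow> \<Phi> 0 0 = (1 :: ('a, 'k) pring)) \<and>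
    (\<forall>j. i = Suc j \<longrightarrow> (\<forall>r<M' j. \<forall>c<M (Suc i). mv (M' i) (P' j) (\<lambda>s. mv (M i) \<Phi> (\<lambda>f. P i f c) s) r = 0)))"
  define B where "B = (\<lambda>i (\<Phi>::nat \<Rightarrow> nat \<Rightarrow> ('a, 'k) pring) \<Phi>'. \<forall>r<M' i. \<forall>c<M (Suc i).
     mv (M' (Suc i)) (P' i) (\<lambda>s. \<Phi>' s c) r = mv (M i) \<Phi> (\<lambda>s. P i s c) r)"
  have "\<exists>\<Phi>. \<forall>i. A i (\<Phi> i) \<and> B i (\<Phi> i) (\<Phi> (Suc i))"
  proof (rule dependent_nat_choice)
    show "\<exists>\<Phi>. A 0 \<Phi>"
      unfolding A_def by (rule exI[of _ "\<lambda>_ _. 1"])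
        (use gresD(1,2)[OF F] gresD(1,2)[OF F'] in \<open>auto simp: exp_degree_altdef\<close>)
  next
    fix \<Phi> i assume A: "A i \<Phi>"
    have A1: "exp_degree t + E' i r = E i c" if "r < M' i" "c < M i" "t \<in> keys (\<Phi> r c)" for r c t
      using A that unfolding A_def by blast
    have A2: "\<Phi> 0 0 = 1" if "i = 0" using A that by (simp add: A_def)
    have A3: "mv (M' i) (P' j) (\<lambda>s. mv (M i) \<Phi> (\<lambda>f. P i f c) s) r = 0" if "i = Suc j" "r < M' j" "c < M (Suc i)" for j r c
      using A that unfolding A_def by blast
    have "\<exists>y. (\<forall>r<M' i. mv (M' (Suc i)) (P' i) y r = mv (M i) \<Phi> (\<lambda>f. P i f c) r) \<and>
       (\<forall>s<M' (Suc i). \<forall>t\<in>keys (y s). exp_degree t + E' (Suc i) s = E (Suc i) c)" if c: "c < M (Suc i)" for c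
    proof -
      define v where "v = (\<lambda>r. mv (M i) \<Phi> (\<lambda>f. P i f c) r)"
      have "v 0 \<in> I" if "i = 0"
      proof -
        have "v 0 = P 0 0 c" using that gresD(1)[OF F] A2 by (simp add: v_def mv_def)
        also have "\<dots> = mv (M (Suc 0)) (P 0) (\<lambda>f. if f = c then 1 else 0) 0"
          using c that by (simp add: mv_unit)
        finally show ?thesis using gresD(5)[OF F] by blast
      qed
      moreover have "mv (M' i) (P' j) v r = 0" if "i = Suc j" "r < M' j" for j r
        using A3[OF that c] by (simp add: v_def)
      moreover have "exp_degree t + E' i r = E (Suc i) c" if t: "r < M' i" "t \<in> keys (v r)" for r t
      proof -
        obtain s a b where s: "s < M i" "t = a + b" "a \<in> keys (\<Phi> r s)" "b \<in> keys (P i s c)"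
          using t(2) unfolding v_def by (rule keys_mvD)
        then show ?thesis using A1[OF t(1) s(1,3)] gresD(3)[OF F s(1) c s(4)] by (simp add: exp_degree_add)
      qed
      ultimately obtain y where "\<And>r. r < M' i \<Longrightarrow> v r = mv (M' (Suc i)) (P' i) y r"
        "\<And>s t. s < M' (Suc i) \<Longrightarrow> t \<in> keys (y s) \<Longrightarrow> exp_degree t + E' (Suc i) s = E (Suc i) c"
        by (rule gres_lift_homogeneous[OF F', of i v]) blast+
      then show ?thesis by (intro exI[of _ y]) (simp add: v_def)
    qed
    then have "\<forall>c. \<exists>y. c < M (Suc i) \<longrightarrow> (\<forall>r<M' i. mv (M' (Suc i)) (P' i) y r = mv (M i) \<Phi> (\<lambda>f. P i f c) r) \<and>
       (\<forall>s<M' (Suc i). \<forall>t\<in>keys (y s). exp_degree t + E' (Suc i) s = E (Suc i) c)" by simp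
    then obtain V where "\<forall>c. c < M (Suc i) \<longrightarrow> (\<forall>r<M' i. mv (M' (Suc i)) (P' i) (V c) r = mv (M i) \<Phi> (\<lambda>f. P i f c) r) \<and>
       (\<forall>s<M' (Suc i). \<forall>t\<in>keys (V c s). exp_degree t + E' (Suc i) s = E (Suc i) c)" by (rule choice[THEN exE])
    then have V: "\<And>c r. c < M (Suc i) \<Longrightarrow> r < M' i \<Longrightarrow> mv (M' (Suc i)) (P' i) (V c) r = mv (M i) \<Phi> (\<lambda>f. P i f c) r"
      "\<And>c s t. c < M (Suc i) \<Longrightarrow> s < M' (Suc i) \<Longrightarrow> t \<in> keys (V c s) \<Longrightarrow> exp_degree t + E' (Suc i) s = E (Suc i) c"
      by blast+
    define \<Phi>' where "\<Phi>' = (\<lambda>s c. V c s)"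
    have B: "B i \<Phi> \<Phi>'" using V(1) by (simp add: B_def \<Phi>'_def)
    have "mv (M' (Suc i)) (P' i) (\<lambda>s. mv (M (Suc i)) \<Phi>' (\<lambda>f. P (Suc i) f c) s) r = 0"
      if "r < M' i" "c < M (Suc (Suc i))" for r c
    proof -
      have "mv (M' (Suc i)) (P' i) (\<lambda>s. mv (M (Suc i)) \<Phi>' (\<lambda>f. P (Suc i) f c) s) r
        = mv (M (Suc i)) (\<lambda>r e. mv (M' (Suc i)) (P' i) (\<lambda>s. \<Phi>' s e) r) (\<lambda>f. P (Suc i) f c) r" by (rule mv_mv)
      also have "\<dots> = mv (M (Suc i)) (\<lambda>r e. mv (M i) \<Phi> (\<lambda>s. P i s e) r) (\<lambda>f. P (Suc i) f c) r"
        by (rule mv_cong) (use B that in \<open>auto simp: B_def\<close>)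
      also have "\<dots> = mv (M i) \<Phi> (\<lambda>s. mv (M (Suc i)) (P i) (\<lambda>f. P (Suc i) f c) s) r" by (rule mv_mv[symmetric])
      also have "\<dots> = mv (M i) \<Phi> (\<lambda>s. 0) r"
        by (rule mv_cong) (use gres_comp[OF F] that in auto)
      finally show ?thesis by simp
    qed
    then have "A (Suc i) \<Phi>'" using V(2) by (simp add: A_def \<Phi>'_def)
    with B show "\<exists>y. A (Suc i) y \<and> B i \<Phi> y" by blast
  qed
  then obtain \<Phi> where \<Phi>: "\<forall>i. A i (\<Phi> i) \<and> B i (\<Phi> i) (\<Phi> (Suc i))" ..
  show ?thesis
  proof (rule that[of \<Phi>])
    show "\<Phi> 0 0 0 = 1" using \<Phi> by (auto simp: A_def)
    show "r < M' i \<Longrightarrow> c < M i \<Longrightarrow> t \<in> keys (\<Phi> i r c) \<Longrightarrow> exp_degree t + E' i r = E i c" for i r c t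
      using spec[OF \<Phi>, of i] unfolding A_def by blast
    show "r < M' i \<Longrightarrow> c < M (Suc i) \<Longrightarrow>
       mv (M' (Suc i)) (P' i) (\<lambda>s. \<Phi> (Suc i) s c) r = mv (M i) (\<Phi> i) (\<lambda>s. P i s c) r" for i r c
      using spec[OF \<Phi>, of i] unfolding B_def by blast
  qed
qed

text \<open>\<open>Z\<close> stands for the difference of two chain maps over the same map of the
  ring, so it vanishes in position 0. The homotopy starts with zero there, and exactness supplies
  the rest.\<close>

lemma gres_null_homotopic:
  fixes P :: "nat \<Rightarrow> nat \<Rightarrow> nat \<Rightarrow> ('a::finite, 'k::field) pring"
  assumes F: "gres M E P I" and Z0: "Z 0 0 0 = 0"
    and Z: "\<And>i r c. r < M i \<Longrightarrow> c < M (Suc i) \<Longrightarrow>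
       mv (M (Suc i)) (P i) (\<lambda>s. Z (Suc i) s c) r = mv (M i) (Z i) (\<lambda>s. P i s c) r"
  obtains H where "\<And>s. H 0 s 0 = 0"
    "\<And>i r c. r < M (Suc i) \<Longrightarrow> c < M (Suc i) \<Longrightarrow>
       Z (Suc i) r c = mv (M (Suc (Suc i))) (P (Suc i)) (\<lambda>s. H (Suc i) s c) r + mv (M i) (H i) (\<lambda>s. P i s c) r"
proof -
  define A where "A = (\<lambda>i H. (i = 0 \<longrightarrow> (\<forall>s. H s 0 = (0 :: ('a, 'k) pring))) \<and>
    (\<forall>r<M i. \<forall>c<M (Suc i). mv (M i) (Z i) (\<lambda>s. P i s c) r =
       mv (M (Suc i)) (P i) (\<lambda>s. mv (M i) H (\<lambda>f. P i f c) s) r))"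
  define B where "B = (\<lambda>i H H'. \<forall>r<M (Suc i). \<forall>c<M (Suc i).
     Z (Suc i) r c = mv (M (Suc (Suc i))) (P (Suc i)) (\<lambda>s. H' s c) r + mv (M i) H (\<lambda>s. P i s c) r)"
  have "\<exists>H. \<forall>i. A i (H i) \<and> B i (H i) (H (Suc i))"
  proof (rule dependent_nat_choice)
    show "\<exists>H. A 0 H"
      unfolding A_def by (rule exI[of _ "\<lambda>_ _. 0"]) (use Z0 gresD(1)[OF F] in \<open>auto simp: mv_def\<close>)
  next
    fix H i assume A: "A i H"
    have A2: "mv (M i) (Z i) (\<lambda>s. P i s c) r = mv (M (Suc i)) (P i) (\<lambda>s. mv (M i) H (\<lambda>f. P i f c) s) r"
      if "r < M i" "c < M (Suc i)" for r c using A that unfolding A_def by blast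
    have "\<exists>y. \<forall>r<M (Suc i). Z (Suc i) r c - mv (M i) H (\<lambda>s. P i s c) r = mv (M (Suc (Suc i))) (P (Suc i)) y r"
      if c: "c < M (Suc i)" for c
    proof -
      define v where "v = (\<lambda>r. Z (Suc i) r c - mv (M i) H (\<lambda>s. P i s c) r)"
      have k: "mv (M (Suc i)) (P i) v r = 0" if "r < M i" for r
        using Z[OF that c] A2[OF that c] by (simp add: v_def mv_diff)
      obtain y where "\<And>r. r < M (Suc i) \<Longrightarrow> v r = mv (M (Suc (Suc i))) (P (Suc i)) y r"
        using gres_lift[OF F, of "Suc i" v] k by (metis nat.distinct(2) nat.inject)
      then show ?thesis by (intro exI[of _ y]) (simp add: v_def)
    qed
    then have "\<forall>c. \<exists>y. c < M (Suc i) \<longrightarrow> (\<forall>r<M (Suc i). Z (Suc i) r c - mv (M i) H (\<lambda>s. P i s c) r = mv (M (Suc (Suc i))) (P (Suc i)) y r)"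
      by simp
    then obtain V where V: "\<forall>c. c < M (Suc i) \<longrightarrow> (\<forall>r<M (Suc i). Z (Suc i) r c - mv (M i) H (\<lambda>s. P i s c) r = mv (M (Suc (Suc i))) (P (Suc i)) (V c) r)"
      by (rule choice[THEN exE])
    define H' where "H' = (\<lambda>s c. V c s)"
    have B: "Z (Suc i) r c = mv (M (Suc (Suc i))) (P (Suc i)) (\<lambda>s. H' s c) r + mv (M i) H (\<lambda>s. P i s c) r"
      if "r < M (Suc i)" "c < M (Suc i)" for r c
      using V that by (simp add: H'_def diff_eq_eq)
    have "mv (M (Suc i)) (Z (Suc i)) (\<lambda>s. P (Suc i) s c) r =
       mv (M (Suc (Suc i))) (P (Suc i)) (\<lambda>s. mv (M (Suc i)) H' (\<lambda>f. P (Suc i) f c) s) r"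
      if r: "r < M (Suc i)" and c: "c < M (Suc (Suc i))" for r c
    proof -
      have "mv (M (Suc i)) (Z (Suc i)) (\<lambda>s. P (Suc i) s c) r =
        mv (M (Suc i)) (\<lambda>r c. mv (M (Suc (Suc i))) (P (Suc i)) (\<lambda>s. H' s c) r) (\<lambda>s. P (Suc i) s c) r +
        mv (M (Suc i)) (\<lambda>r c. mv (M i) H (\<lambda>s. P i s c) r) (\<lambda>s. P (Suc i) s c) r"
        unfolding mv_def[of "M (Suc i)"] by (simp add: B r sum.distrib algebra_simps)
      also have "mv (M (Suc i)) (\<lambda>r c. mv (M i) H (\<lambda>s. P i s c) r) (\<lambda>s. P (Suc i) s c) r
        = mv (M i) H (\<lambda>s. mv (M (Suc i)) (P i) (\<lambda>f. P (Suc i) f c) s) r" by (rule mv_mv[symmetric])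
      also have "\<dots> = mv (M i) H (\<lambda>s. 0) r"
        by (rule mv_cong) (use gres_comp[OF F] c in auto)
      also have "mv (M (Suc i)) (\<lambda>r c. mv (M (Suc (Suc i))) (P (Suc i)) (\<lambda>s. H' s c) r) (\<lambda>s. P (Suc i) s c) r
        = mv (M (Suc (Suc i))) (P (Suc i)) (\<lambda>s. mv (M (Suc i)) H' (\<lambda>f. P (Suc i) f c) s) r" by (rule mv_mv[symmetric])
      finally show ?thesis by simp
    qed
    then have "A (Suc i) H'" by (simp add: A_def)
    moreover have "B i H H'" using B by (simp add: B_def)
    ultimately show "\<exists>y. A (Suc i) y \<and> B i H y" by blast
  qed
  then obtain H where H: "\<forall>i. A i (H i) \<and> B i (H i) (H (Suc i))" ..
  show ?thesis
  proof (rule that[of H])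
    show "H 0 s 0 = 0" for s using spec[OF H, of 0] unfolding A_def by simp
    show "r < M (Suc i) \<Longrightarrow> c < M (Suc i) \<Longrightarrow>
       Z (Suc i) r c = mv (M (Suc (Suc i))) (P (Suc i)) (\<lambda>s. H (Suc i) s c) r + mv (M i) (H i) (\<lambda>s. P i s c) r" for i r c
      using spec[OF H, of i] unfolding B_def by blast
  qed
qed

lemma lookup_zero_mv:
  fixes A :: "nat \<Rightarrow> nat \<Rightarrow> ('a, 'k::field) pring"
  shows "lookup (mv n A v r) 0 = (\<Sum>s<n. lookup (A r s) 0 * lookup (v s) 0)"
  by (simp add: mv_def lookup_sum lookup_zero_times)

text \<open>
  The composite of the comparison maps back and forth is homotopic to the identity, hence has constant
  term the identity; so a generator of degree \<open>E (i + 1) e\<close> cannot be mapped into the maximal ideal.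
\<close>

theorem gres_degrees_unique:
  fixes P P' :: "nat \<Rightarrow> nat \<Rightarrow> nat \<Rightarrow> ('a::finite, 'k::field) pring"
  assumes F: "gres M E P I" and F': "gres M' E' P' I" and e: "e < M (Suc i)"
  shows "\<exists>f<M' (Suc i). E' (Suc i) f = E (Suc i) e"
proof -
  obtain \<Phi> where \<Phi>: "\<Phi> 0 0 0 = 1"
    "\<And>i r c t. r < M' i \<Longrightarrow> c < M i \<Longrightarrow> t \<in> keys (\<Phi> i r c) \<Longrightarrow> exp_degree t + E' i r = E i c"
    "\<And>i r c. r < M' i \<Longrightarrow> c < M (Suc i) \<Longrightarrow>
       mv (M' (Suc i)) (P' i) (\<lambda>s. \<Phi> (Suc i) s c) r = mv (M i) (\<Phi> i) (\<lambda>s. P i s c) r"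
    using gres_chain_map[OF F F'] by metis
  obtain \<Psi> where \<Psi>: "\<Psi> 0 0 0 = 1"
    "\<And>i r c. r < M i \<Longrightarrow> c < M' (Suc i) \<Longrightarrow>
       mv (M (Suc i)) (P i) (\<lambda>s. \<Psi> (Suc i) s c) r = mv (M' i) (\<Psi> i) (\<lambda>s. P' i s c) r"
    using gres_chain_map[OF F' F] by metis
  define Z where "Z = (\<lambda>i r c. mv (M' i) (\<Psi> i) (\<lambda>s. \<Phi> i s c) r - (if r = c then 1 else 0))"
  have Z0: "Z 0 0 0 = 0" using gresD(1)[OF F'] \<Phi>(1) \<Psi>(1) by (simp add: Z_def mv_def)
  have Z1: "mv (M (Suc i)) (P i) (\<lambda>s. Z (Suc i) s c) r = mv (M i) (Z i) (\<lambda>s. P i s c) r"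
    if r: "r < M i" and c: "c < M (Suc i)" for i r c
  proof -
    have "mv (M (Suc i)) (P i) (\<lambda>s. mv (M' (Suc i)) (\<Psi> (Suc i)) (\<lambda>s. \<Phi> (Suc i) s c) s) r
      = mv (M' (Suc i)) (\<lambda>r e. mv (M (Suc i)) (P i) (\<lambda>s. \<Psi> (Suc i) s e) r) (\<lambda>s. \<Phi> (Suc i) s c) r" by (rule mv_mv)
    also have "\<dots> = mv (M' (Suc i)) (\<lambda>r e. mv (M' i) (\<Psi> i) (\<lambda>s. P' i s e) r) (\<lambda>s. \<Phi> (Suc i) s c) r"
      by (rule mv_cong) (use \<Psi>(2) r in auto)
    also have "\<dots> = mv (M' i) (\<Psi> i) (\<lambda>s. mv (M' (Suc i)) (P' i) (\<lambda>s. \<Phi> (Suc i) s c) s) r" by (rule mv_mv[symmetric])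
    also have "\<dots> = mv (M' i) (\<Psi> i) (\<lambda>s. mv (M i) (\<Phi> i) (\<lambda>s. P i s c) s) r"
      by (rule mv_cong) (use \<Phi>(3) c in auto)
    also have "\<dots> = mv (M i) (\<lambda>r c. mv (M' i) (\<Psi> i) (\<lambda>s. \<Phi> i s c) r) (\<lambda>s. P i s c) r" by (rule mv_mv)
    finally have 1: "mv (M (Suc i)) (P i) (\<lambda>s. mv (M' (Suc i)) (\<Psi> (Suc i)) (\<lambda>s. \<Phi> (Suc i) s c) s) r
      = mv (M i) (\<lambda>r c. mv (M' i) (\<Psi> i) (\<lambda>s. \<Phi> i s c) r) (\<lambda>s. P i s c) r" .
    have 2: "mv (M (Suc i)) (P i) (\<lambda>s. if s = c then 1 else 0) r = P i r c" using c by (simp add: mv_unit)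
    have 3: "mv (M i) (\<lambda>r s. if r = s then 1 else 0) (\<lambda>s. P i s c) r = P i r c"
      using r by (simp add: mv_def if_distrib[of "\<lambda>x. x * _"] cong: if_cong)
    have "mv (M i) (Z i) (\<lambda>s. P i s c) r = mv (M i) (\<lambda>r c. mv (M' i) (\<Psi> i) (\<lambda>s. \<Phi> i s c) r) (\<lambda>s. P i s c) r
       - mv (M i) (\<lambda>r s. if r = s then 1 else 0) (\<lambda>s. P i s c) r"
      unfolding mv_def[of "M i"] Z_def left_diff_distrib sum_subtractf ..
    moreover have "mv (M (Suc i)) (P i) (\<lambda>s. Z (Suc i) s c) r =
       mv (M (Suc i)) (P i) (\<lambda>s. mv (M' (Suc i)) (\<Psi> (Suc i)) (\<lambda>s. \<Phi> (Suc i) s c) s) r - mv (M (Suc i)) (P i) (\<lambda>s. if s = c then 1 else 0) r"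
      unfolding Z_def by (rule mv_diff)
    ultimately show ?thesis using 1 2 3 by simp
  qed
  obtain H where H: "\<And>s. H 0 s 0 = 0"
    "\<And>i r c. r < M (Suc i) \<Longrightarrow> c < M (Suc i) \<Longrightarrow>
       Z (Suc i) r c = mv (M (Suc (Suc i))) (P (Suc i)) (\<lambda>s. H (Suc i) s c) r + mv (M i) (H i) (\<lambda>s. P i s c) r"
    using gres_null_homotopic[of M E P I Z, OF F Z0 Z1] by metis
  have "lookup (mv (M (Suc (Suc i))) (P (Suc i)) (\<lambda>s. H (Suc i) s e) e) 0 = 0"
    using gresD(4)[OF F e] by (simp add: lookup_zero_mv)
  \<comment> \<open>The augmentation \<open>P 0\<close> is exempt from minimality; at that position
    \<open>H 0\<close> vanishes instead.\<close>
  moreover have "lookup (mv (M i) (H i) (\<lambda>s. P i s e) e) 0 = 0"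
  proof (cases i)
    case 0
    then show ?thesis using H(1) gresD(1)[OF F] by (simp add: mv_def)
  next
    case (Suc j)
    then show ?thesis using gresD(4)[OF F] e by (simp add: lookup_zero_mv)
  qed
  ultimately have "lookup (Z (Suc i) e e) 0 = 0" using H(2)[OF e e] by (simp add: lookup_add)
  then have "lookup (mv (M' (Suc i)) (\<Psi> (Suc i)) (\<lambda>s. \<Phi> (Suc i) s e) e) 0 = 1"
    by (simp add: Z_def lookup_minus)
  then have "(\<Sum>s<M' (Suc i). lookup (\<Psi> (Suc i) e s) 0 * lookup (\<Phi> (Suc i) s e) 0) \<noteq> 0"
    by (simp add: lookup_zero_mv)
  then obtain f where f: "f < M' (Suc i)" "lookup (\<Psi> (Suc i) e f) 0 * lookup (\<Phi> (Suc i) f e) 0 \<noteq> 0"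
    by (meson lessThan_iff sum.not_neutral_contains_not_neutral)
  \<comment> \<open>A nonzero constant term in a degree-preserving entry forces the two generators
    to have the same degree.\<close>
  then have "0 \<in> keys (\<Phi> (Suc i) f e)" by (simp add: in_keys_iff)
  from \<Phi>(2)[OF f(1) e this] f(1) show ?thesis by (auto simp: exp_degree_altdef)
qed

section \<open>From squarefree strands to graded resolutions\<close>

text \<open>The component of \<open>w\<close> in multidegree \<open>t\<close>: a generator of degree
  \<open>d c\<close> contributes the coefficient of the cofactor \<open>t - sqf (d c)\<close>. Which
  generators contribute depends only on the support of \<open>t\<close>, which is why exactness in
  squarefree degrees suffices.\<close>

definition strand_part :: "(nat \<Rightarrow> 'a::finite set) \<Rightarrow> ('a \<Rightarrow>\<^sub>0 nat) \<Rightarrow> (nat \<Rightarrow> ('a, 'k::field) pring) \<Rightarrow> nat \<Rightarrow> 'k" where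
  "strand_part d t w c = (if d c \<subseteq> keys t then lookup (w c) (t - sqf (d c)) else 0)"

definition strand_vec :: "(nat \<Rightarrow> 'a::finite set) \<Rightarrow> ('a \<Rightarrow>\<^sub>0 nat) \<Rightarrow> (nat \<Rightarrow> 'k::field) \<Rightarrow> nat \<Rightarrow> ('a, 'k) pring" where
  "strand_vec d t v c = (if d c \<subseteq> keys t then single (t - sqf (d c)) (v c) else 0)"

lemma diff_sqf_eq_iff: "W \<subseteq> keys t \<Longrightarrow> t - sqf W = s \<longleftrightarrow> t = s + sqf W"
proof
  assume "W \<subseteq> keys t" "t - sqf W = s"
  then show "t = s + sqf W" using divides_diff_add[of "sqf W" t] by (simp add: divides_sqf_iff)
qed simp

lemma strand_decomposition:
  fixes w :: "nat \<Rightarrow> ('a::finite, 'k::field) pring"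
  assumes "finite T" and T: "\<And>s. s \<in> keys (w c) \<Longrightarrow> s + sqf (d c) \<in> T"
  shows "w c = (\<Sum>t\<in>T. strand_vec d t (strand_part d t w) c)"
proof (rule poly_mapping_eqI)
  fix s
  have "lookup (strand_vec d t (strand_part d t w) c) s = (if t = s + sqf (d c) then lookup (w c) s else 0)" for t
  proof (cases "d c \<subseteq> keys t")
    case True
    then show ?thesis
      by (auto simp: strand_vec_def strand_part_def lookup_single when_def diff_sqf_eq_iff)
  next
    case False
    moreover have "d c \<subseteq> keys (s + sqf (d c))" by (simp add: keys_exp_add)
    ultimately show ?thesis by (auto simp: strand_vec_def)
  qed
  then have "lookup (\<Sum>t\<in>T. strand_vec d t (strand_part d t w) c) s = (if s + sqf (d c) \<in> T then lookup (w c) s else 0)"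
    using assms(1) by (simp add: lookup_sum)
  also have "\<dots> = lookup (w c) s" using T by (auto simp: in_keys_iff)
  finally show "lookup (w c) s = lookup (\<Sum>t\<in>T. strand_vec d t (strand_part d t w) c) s" by simp
qed

text \<open>Distinct multidegrees contribute distinct monomials to a component, so strands cannot
  cancel each other.\<close>

lemma strand_part_sum_strand_vec:
  assumes "finite T" "t \<in> T" "d c \<subseteq> keys t"
  shows "lookup (\<Sum>t\<in>T. strand_vec d t (v t) c) (t - sqf (d c)) = v t c"
proof -
  have "lookup (strand_vec d t' (v t') c) (t - sqf (d c)) = (if t' = t then v t c else 0)" for t'
  proof (cases "d c \<subseteq> keys t'")
    case True
    then have "t' - sqf (d c) = t - sqf (d c) \<longleftrightarrow> t' = t"
      using assms(3) divides_diff_add[of "sqf (d c)" t] diff_sqf_eq_iff[of "d c" t'] by (auto simp: divides_sqf_iff)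
    then show ?thesis using True by (auto simp: strand_vec_def lookup_single when_def)
  qed (use assms(3) in \<open>auto simp: strand_vec_def\<close>)
  then show ?thesis using assms(1,2) by (simp add: lookup_sum)
qed

definition sqf_map :: "(nat \<Rightarrow> nat \<Rightarrow> 'a::finite set) \<Rightarrow> (nat \<Rightarrow> nat \<Rightarrow> nat \<Rightarrow> 'k::field) \<Rightarrow> nat \<Rightarrow> nat \<Rightarrow> nat \<Rightarrow> ('a, 'k) pring" where
  "sqf_map dg C i r c = single (sqf (dg (Suc i) c - dg i r)) (C i r c)"

lemma sqf_diff: "V \<subseteq> W \<Longrightarrow> sqf W - sqf V = sqf (W - V)"
  by (rule poly_mapping_eqI) (auto simp: lookup_minus lookup_sqf)

text \<open>In a fixed multidegree every exponent is determined, so the matrix of monomials acts as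
  the scalar matrix \<open>C i\<close>.\<close>

lemma sqf_map_strand_vec:
  fixes C :: "nat \<Rightarrow> nat \<Rightarrow> nat \<Rightarrow> 'k::field"
  assumes C: "\<And>c. c < n \<Longrightarrow> C i r c \<noteq> 0 \<Longrightarrow> dg i r \<subseteq> dg (Suc i) c"
    and supp: "supp_in n (dg (Suc i)) (keys t) v"
  shows "mv n (sqf_map dg C i) (strand_vec (dg (Suc i)) t v) r = strand_vec (dg i) t (mv n (C i) v) r"
proof -
  have "sqf_map dg C i r c * strand_vec (dg (Suc i)) t v c =
      (if dg i r \<subseteq> keys t then single (t - sqf (dg i r)) (C i r c * v c) else 0)" if c: "c < n" for c
  proof (cases "C i r c = 0 \<or> v c = 0")
    case False
    then have 1: "dg i r \<subseteq> dg (Suc i) c" "dg (Suc i) c \<subseteq> keys t"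
      using C supp c by (auto simp: supp_in_def)
    have "sqf (dg (Suc i) c - dg i r) + (t - sqf (dg (Suc i) c)) = t - sqf (dg i r)"
    proof (rule poly_mapping_eqI)
      fix x
      have "0 < lookup t x" if "x \<in> dg (Suc i) c" using 1(2) that by (metis in_keys_iff gr0I subsetD)
      then show "lookup (sqf (dg (Suc i) c - dg i r) + (t - sqf (dg (Suc i) c))) x = lookup (t - sqf (dg i r)) x"
        using 1(1) by (auto simp: lookup_add lookup_minus lookup_sqf)
    qed
    then show ?thesis using 1 by (auto simp: sqf_map_def strand_vec_def mult_single)
  qed (auto simp: sqf_map_def strand_vec_def)
  then have "mv n (sqf_map dg C i) (strand_vec (dg (Suc i)) t v) r
     = (\<Sum>c<n. if dg i r \<subseteq> keys t then single (t - sqf (dg i r)) (C i r c * v c) else 0)"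
    by (simp add: mv_def)
  also have "\<dots> = strand_vec (dg i) t (mv n (C i) v) r"
  proof (rule poly_mapping_eqI)
    fix k
    show "lookup (\<Sum>c<n. if dg i r \<subseteq> keys t then single (t - sqf (dg i r)) (C i r c * v c) else 0) k =
      lookup (strand_vec (dg i) t (mv n (C i) v) r) k"
      by (simp add: strand_vec_def mv_def lookup_sum lookup_single when_def)
  qed
  finally show ?thesis .
qed

lemma mv_sum: "mv n A (\<lambda>c. \<Sum>t\<in>T. f t c) r = (\<Sum>t\<in>T. mv n A (f t) r)"
  unfolding mv_def by (simp add: sum_distrib_left) (rule sum.swap)

lemma supp_in_strand_part: "supp_in n d (keys t) (strand_part d t w)"
  by (auto simp: supp_in_def strand_part_def)

text \<open>A column of the next matrix is its vector of scalars placed in the strand of its own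
  degree, so the scalar relation carries over.\<close>

lemma sqf_map_comp:
  assumes "sres N dg C" "r < N i" "e < N (Suc (Suc i))"
  shows "mv (N (Suc i)) (sqf_map dg C i) (\<lambda>c. sqf_map dg C (Suc i) c e) r = 0"
proof -
  let ?D = "dg (Suc (Suc i)) e"
  have s: "supp_in (N (Suc i)) (dg (Suc i)) (keys (sqf ?D)) (\<lambda>c. C (Suc i) c e)"
    using sresD(4)[OF assms(1) _ assms(3)] by (auto simp: supp_in_def)
  have "sqf_map dg C (Suc i) c e = strand_vec (dg (Suc i)) (sqf ?D) (\<lambda>c. C (Suc i) c e) c" if "c < N (Suc i)" for c
    using sresD(4)[OF assms(1) that assms(3)]
    by (cases "C (Suc i) c e = 0") (auto simp: sqf_map_def strand_vec_def sqf_diff)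
  then have "mv (N (Suc i)) (sqf_map dg C i) (\<lambda>c. sqf_map dg C (Suc i) c e) r =
     mv (N (Suc i)) (sqf_map dg C i) (strand_vec (dg (Suc i)) (sqf ?D) (\<lambda>c. C (Suc i) c e)) r"
    by (intro mv_cong) auto
  also have "\<dots> = strand_vec (dg i) (sqf ?D) (mv (N (Suc i)) (C i) (\<lambda>c. C (Suc i) c e)) r"
    by (rule sqf_map_strand_vec) (use sresD(4)[OF assms(1,2)] s in auto)
  also have "\<dots> = 0" using sresD(5)[OF assms] by (simp add: strand_vec_def)
  finally show ?thesis .
qed

text \<open>A cycle is split into its finitely many multidegrees; each piece is a scalar cycle over
  the support of that multidegree and is lifted there.\<close>

lemma sqf_map_exact:
  fixes w :: "nat \<Rightarrow> ('a::finite, 'k::field) pring"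
  assumes F: "sres N dg C" and w: "\<And>r. r < N i \<Longrightarrow> mv (N (Suc i)) (sqf_map dg C i) w r = 0"
  obtains y where "\<And>c. c < N (Suc i) \<Longrightarrow> w c = mv (N (Suc (Suc i))) (sqf_map dg C (Suc i)) y c"
proof -
  define T where "T = (\<Union>c\<in>{..<N (Suc i)}. (\<lambda>s. s + sqf (dg (Suc i) c)) ` keys (w c))"
  have fin: "finite T" by (simp add: T_def)
  define v where "v = (\<lambda>t. strand_part (dg (Suc i)) t w)"
  have wc: "w c = (\<Sum>t\<in>T. strand_vec (dg (Suc i)) t (v t) c)" if "c < N (Suc i)" for c
    unfolding v_def by (rule strand_decomposition[OF fin]) (use that in \<open>auto simp: T_def\<close>)
  have vsupp: "supp_in (N (Suc i)) (dg (Suc i)) (keys t) (v t)" for t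
    unfolding v_def by (rule supp_in_strand_part)
  have ker: "mv (N (Suc i)) (C i) (v t) r = 0" if t: "t \<in> T" and r: "r < N i" for t r
  proof (cases "dg i r \<subseteq> keys t")
    case True
    have "0 = mv (N (Suc i)) (sqf_map dg C i) w r" using w[OF r] by simp
    also have "\<dots> = mv (N (Suc i)) (sqf_map dg C i) (\<lambda>c. \<Sum>t\<in>T. strand_vec (dg (Suc i)) t (v t) c) r"
      by (rule mv_cong) (use wc in auto)
    also have "\<dots> = (\<Sum>t\<in>T. strand_vec (dg i) t (mv (N (Suc i)) (C i) (v t)) r)"
      unfolding mv_sum by (rule sum.cong[OF refl], rule sqf_map_strand_vec) (use sresD(4)[OF F r] vsupp in auto)
    finally have "lookup (\<Sum>t\<in>T. strand_vec (dg i) t (mv (N (Suc i)) (C i) (v t)) r) (t - sqf (dg i r)) = 0" by simp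
    then show ?thesis
      using strand_part_sum_strand_vec[of T t "dg i" r "\<lambda>t. mv (N (Suc i)) (C i) (v t)", OF fin t True] by simp
  next
    case False
    show ?thesis
    proof (rule ccontr)
      assume "mv (N (Suc i)) (C i) (v t) r \<noteq> 0"
      then obtain c where "c < N (Suc i)" "C i r c \<noteq> 0" "v t c \<noteq> 0" using mv_nonzero by blast
      then show False using False sresD(4)[OF F r] vsupp[of t] unfolding supp_in_def by blast
    qed
  qed
  have "\<exists>u. supp_in (N (Suc (Suc i))) (dg (Suc (Suc i))) (keys t) u \<and>
      (\<forall>c<N (Suc i). v t c = mv (N (Suc (Suc i))) (C (Suc i)) u c)" if "t \<in> T" for t
    using sres_exact[OF F vsupp ker[OF that]] by metis
  then have "\<forall>t. \<exists>u. t \<in> T \<longrightarrow> supp_in (N (Suc (Suc i))) (dg (Suc (Suc i))) (keys t) u \<and>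
      (\<forall>c<N (Suc i). v t c = mv (N (Suc (Suc i))) (C (Suc i)) u c)" by simp
  then obtain u where u: "\<forall>t. t \<in> T \<longrightarrow> supp_in (N (Suc (Suc i))) (dg (Suc (Suc i))) (keys t) (u t) \<and>
      (\<forall>c<N (Suc i). v t c = mv (N (Suc (Suc i))) (C (Suc i)) (u t) c)" by (rule choice[THEN exE])
  show ?thesis
  proof (rule that[of "\<lambda>e. \<Sum>t\<in>T. strand_vec (dg (Suc (Suc i))) t (u t) e"])
    fix c assume c: "c < N (Suc i)"
    have "mv (N (Suc (Suc i))) (sqf_map dg C (Suc i)) (\<lambda>e. \<Sum>t\<in>T. strand_vec (dg (Suc (Suc i))) t (u t) e) c
      = (\<Sum>t\<in>T. strand_vec (dg (Suc i)) t (mv (N (Suc (Suc i))) (C (Suc i)) (u t)) c)"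
      unfolding mv_sum by (rule sum.cong[OF refl], rule sqf_map_strand_vec) (use sresD(4)[OF F c] u in auto)
    also have "\<dots> = w c" unfolding wc[OF c] by (rule sum.cong[OF refl]) (use u c in \<open>auto simp: strand_vec_def\<close>)
    finally show "w c = mv (N (Suc (Suc i))) (sqf_map dg C (Suc i)) (\<lambda>e. \<Sum>t\<in>T. strand_vec (dg (Suc (Suc i))) t (u t) e) c" by simp
  qed
qed

lemma ideal_gen_image_lessThan:
  fixes g :: "nat \<Rightarrow> 'r::comm_ring_1"
  shows "p \<in> ideal_gen (g ` {..<n}) \<longleftrightarrow> (\<exists>w. p = (\<Sum>c<n. g c * w c))"
proof
  let ?Q = "{p. \<exists>w. p = (\<Sum>c<n. g c * w c)}"
  have "Modules.module.subspace (*) ?Q"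
    unfolding module.subspace_def[OF module_times]
  proof (intro conjI ballI allI)
    show "0 \<in> ?Q" by (rule CollectI, rule exI[of _ "\<lambda>_. 0"]) simp
    fix p q assume "p \<in> ?Q" "q \<in> ?Q"
    then obtain w z where "p = (\<Sum>c<n. g c * w c)" "q = (\<Sum>c<n. g c * z c)" by blast
    then show "p + q \<in> ?Q"
      by (intro CollectI exI[of _ "\<lambda>c. w c + z c"]) (simp add: sum.distrib distrib_left)
  next
    fix a p assume "p \<in> ?Q"
    then obtain w where "p = (\<Sum>c<n. g c * w c)" by blast
    then show "a * p \<in> ?Q"
      by (intro CollectI exI[of _ "\<lambda>c. a * w c"]) (simp add: sum_distrib_left ac_simps)
  qed
  moreover have "g ` {..<n} \<subseteq> ?Q"
  proof (rule image_subsetI)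
    fix c assume "c \<in> {..<n}"
    then show "g c \<in> ?Q"
      by (intro CollectI exI[of _ "\<lambda>e. if e = c then 1 else 0"]) (simp add: if_distrib cong: if_cong)
  qed
  ultimately have "ideal_gen (g ` {..<n}) \<subseteq> ?Q" by (intro ideal_gen_minimal)
  then show "p \<in> ideal_gen (g ` {..<n}) \<Longrightarrow> \<exists>w. p = (\<Sum>c<n. g c * w c)" by blast
next
  assume "\<exists>w. p = (\<Sum>c<n. g c * w c)"
  then obtain w where w: "p = (\<Sum>c<n. w c * g c)" by (auto simp: mult.commute)
  show "p \<in> ideal_gen (g ` {..<n})"
    unfolding w by (intro ideal_gen_sum ideal_gen_mult ideal_gen_base) auto
qed

theorem gres_of_minimal_sres:
  fixes C :: "nat \<Rightarrow> nat \<Rightarrow> nat \<Rightarrow> 'k::field" and dg :: "nat \<Rightarrow> nat \<Rightarrow> 'a::finite set"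
  assumes "minimal_sres N dg C"
  shows "gres N (\<lambda>i c. card (dg i c)) (sqf_map dg C) (ideal_gen (pmono ` sqf ` dg (Suc 0) ` {..<N (Suc 0)}))"
proof -
  have F: "sres N dg C" using assms by (simp add: minimal_sres_def)
  have st: "dg i r \<subset> dg (Suc i) c" if "r < N i" "c < N (Suc i)" "C i r c \<noteq> 0" for i r c
    using assms that by (simp add: minimal_sres_def)
  show ?thesis
    unfolding gres_def
  proof (intro conjI allI ballI impI)
    show "N 0 = 1" "card (dg 0 0) = 0" using sresD(1,2)[OF F] by auto
  next
    fix i r c t assume r: "r < N i" and c: "c < N (Suc i)" and t: "t \<in> keys (sqf_map dg C i r c)"
    then have "C i r c \<noteq> 0" "t = sqf (dg (Suc i) c - dg i r)" by (auto simp: sqf_map_def split: if_splits)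
    moreover from this have "dg i r \<subseteq> dg (Suc i) c" using st r c by blast
    ultimately show "exp_degree t + card (dg i r) = card (dg (Suc i) c)"
      by (simp add: card_Diff_subset card_mono)
  next
    fix i r c assume "r < N (Suc i)" "c < N (Suc (Suc i))"
    then have "C (Suc i) r c = 0 \<or> sqf (dg (Suc (Suc i)) c - dg (Suc i) r) \<noteq> sqf {}"
      using st[of r "Suc i" c] unfolding sqf_inj by blast
    then show "lookup (sqf_map dg C (Suc i) r c) 0 = 0"
      by (auto simp: sqf_map_def lookup_single when_def)
  next
    fix p
    have e: "pmono ` sqf ` dg (Suc 0) ` {..<N (Suc 0)} = (\<lambda>c. pmono (sqf (dg (Suc 0) c)) :: ('a, 'k) pring) ` {..<N (Suc 0)}"
      by auto
    have "sqf_map dg C 0 0 c = pmono (sqf (dg (Suc 0) c))" if "c < N (Suc 0)" for c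
      using sresD(2)[OF F] sresD(3)[OF F that] by (simp add: sqf_map_def pmono_def)
    then have "mv (N (Suc 0)) (sqf_map dg C 0) w 0 = (\<Sum>c<N (Suc 0). pmono (sqf (dg (Suc 0) c)) * w c)" for w
      by (simp add: mv_def)
    then show "p \<in> ideal_gen (pmono ` sqf ` dg (Suc 0) ` {..<N (Suc 0)}) \<longleftrightarrow> (\<exists>w. p = mv (N (Suc 0)) (sqf_map dg C 0) w 0)"
      unfolding e ideal_gen_image_lessThan by simp
  next
    fix i and w :: "nat \<Rightarrow> ('a, 'k) pring"
    show "(\<forall>r<N i. mv (N (Suc i)) (sqf_map dg C i) w r = 0) \<longleftrightarrow>
        (\<exists>y. \<forall>c<N (Suc i). w c = mv (N (Suc (Suc i))) (sqf_map dg C (Suc i)) y c)"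
    proof
      assume "\<forall>r<N i. mv (N (Suc i)) (sqf_map dg C i) w r = 0"
      then show "\<exists>y. \<forall>c<N (Suc i). w c = mv (N (Suc (Suc i))) (sqf_map dg C (Suc i)) y c"
        using sqf_map_exact[OF F, of i w] by metis
    next
      assume "\<exists>y. \<forall>c<N (Suc i). w c = mv (N (Suc (Suc i))) (sqf_map dg C (Suc i)) y c"
      then obtain y where y: "\<forall>c<N (Suc i). w c = mv (N (Suc (Suc i))) (sqf_map dg C (Suc i)) y c" ..
      show "\<forall>r<N i. mv (N (Suc i)) (sqf_map dg C i) w r = 0"
      proof (intro allI impI)
        fix r assume r: "r < N i"
        have "mv (N (Suc i)) (sqf_map dg C i) w r = mv (N (Suc i)) (sqf_map dg C i) (mv (N (Suc (Suc i))) (sqf_map dg C (Suc i)) y) r"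
          by (rule mv_cong) (use y in auto)
        also have "\<dots> = mv (N (Suc (Suc i))) (\<lambda>r e. 0) y r"
          unfolding mv_mv by (rule mv_cong) (use sqf_map_comp[OF F r] in auto)
        also have "\<dots> = 0" by (simp add: mv_def)
        finally show "mv (N (Suc i)) (sqf_map dg C i) w r = 0" .
      qed
    qed
  qed
qed

section \<open>Translation to matrices, and Betti numbers\<close>

lemma mult_mat_vec_mv:
  assumes "A \<in> carrier_mat m n" "w \<in> carrier_vec n"
  shows "A *\<^sub>v w = vec m (mv n (\<lambda>r c. A $$ (r, c)) (($) w))"
  using assms by (intro eq_vecI) (auto simp: scalar_prod_def mv_def atLeast0LessThan)

lemma image_mult_mat_vec:
  assumes "A \<in> carrier_mat m n"
  shows "v \<in> {A *\<^sub>v w | w. w \<in> carrier_vec n} \<longleftrightarrow>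
     v \<in> carrier_vec m \<and> (\<exists>y. \<forall>c<m. v $ c = mv n (\<lambda>r c. A $$ (r, c)) y c)"
proof
  assume "v \<in> {A *\<^sub>v w | w. w \<in> carrier_vec n}"
  then obtain w where "w \<in> carrier_vec n" "v = A *\<^sub>v w" by auto
  then show "v \<in> carrier_vec m \<and> (\<exists>y. \<forall>c<m. v $ c = mv n (\<lambda>r c. A $$ (r, c)) y c)"
    using assms by (auto simp: mult_mat_vec_mv[OF assms])
next
  assume *: "v \<in> carrier_vec m \<and> (\<exists>y. \<forall>c<m. v $ c = mv n (\<lambda>r c. A $$ (r, c)) y c)"
  then obtain y where y: "\<forall>c<m. v $ c = mv n (\<lambda>r c. A $$ (r, c)) y c" by blast
  have "v = A *\<^sub>v vec n y"
  proof (rule eq_vecI)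
    show "dim_vec v = dim_vec (A *\<^sub>v vec n y)" using * assms by auto
    fix c assume "c < dim_vec (A *\<^sub>v vec n y)"
    then have c: "c < m" using assms by auto
    have "mv n (\<lambda>r c. A $$ (r, c)) y c = mv n (\<lambda>r c. A $$ (r, c)) (($) (vec n y)) c" by (rule mv_cong) auto
    then show "v $ c = (A *\<^sub>v vec n y) $ c" using y c by (simp add: mult_mat_vec_mv[OF assms])
  qed
  then show "v \<in> {A *\<^sub>v w | w. w \<in> carrier_vec n}" by auto
qed

text \<open>\<open>gres\<close> counts positions from the polynomial ring,
  \<open>min_graded_free_resolution\<close> from the generators of the ideal; hence the shift by
  one.\<close>

lemma gres_of_resolution:
  fixes I :: "('a, 'k::field) pring set"
  assumes "min_graded_free_resolution I (D, \<delta>)"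
  shows "gres (\<lambda>i. case i of 0 \<Rightarrow> 1 | Suc j \<Rightarrow> length (D j)) (\<lambda>i c. case i of 0 \<Rightarrow> 0 | Suc j \<Rightarrow> D j ! c)
     (\<lambda>i r c. \<delta> i $$ (r, c)) I"
proof -
  let ?M = "\<lambda>i. case i of 0 \<Rightarrow> 1 | Suc j \<Rightarrow> length (D j)"
  have d0: "\<delta> 0 \<in> carrier_mat 1 (length (D 0))"
    and dS: "\<And>i. \<delta> (Suc i) \<in> carrier_mat (length (D i)) (length (D (Suc i)))"
    and h0: "\<And>c. c < length (D 0) \<Longrightarrow> homogeneous (D 0 ! c) (\<delta> 0 $$ (0, c))"
    and hS: "\<And>i r c t. r < length (D i) \<Longrightarrow> c < length (D (Suc i)) \<Longrightarrow> t \<in> keys (\<delta> (Suc i) $$ (r, c)) \<Longrightarrow>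
       exp_degree t + D i ! r = D (Suc i) ! c"
    and I: "I = {(\<delta> 0 *\<^sub>v w) $ 0 | w. w \<in> carrier_vec (length (D 0))}"
    and ex: "\<And>i. mat_kernel (\<delta> i) = {\<delta> (Suc i) *\<^sub>v w | w. w \<in> carrier_vec (length (D (Suc i)))}"
    and mn: "\<And>i r c. r < length (D i) \<Longrightarrow> c < length (D (Suc i)) \<Longrightarrow> \<delta> (Suc i) $$ (r, c) \<in> ideal_gen (range var)"
    using assms by auto
  have cm: "\<delta> i \<in> carrier_mat (?M i) (?M (Suc i))" for i using d0 dS by (cases i) auto
  show ?thesis
    unfolding gres_def
  proof (intro conjI allI ballI impI)
    fix i r c t assume "r < ?M i" "c < ?M (Suc i)" "t \<in> keys (\<delta> i $$ (r, c))"
    then show "exp_degree t + (case i of 0 \<Rightarrow> 0 | Suc j \<Rightarrow> D j ! r) = (case Suc i of 0 \<Rightarrow> 0 | Suc j \<Rightarrow> D j ! c)"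
      using h0 hS by (cases i) (auto simp: homogeneous_def)
  next
    fix i r c assume "r < ?M (Suc i)" "c < ?M (Suc (Suc i))"
    then show "lookup (\<delta> (Suc i) $$ (r, c)) 0 = 0" using mn by (simp add: mem_maximal_ideal_iff)
  next
    fix p
    have "p \<in> I \<longleftrightarrow> (\<exists>w\<in>carrier_vec (length (D 0)). p = mv (length (D 0)) (\<lambda>r c. \<delta> 0 $$ (r, c)) (($) w) 0)"
    proof -
      have "p \<in> I \<longleftrightarrow> (\<exists>w\<in>carrier_vec (length (D 0)). p = (\<delta> 0 *\<^sub>v w) $ 0)" unfolding I by blast
      then show ?thesis by (simp add: mult_mat_vec_mv[OF d0] cong: bex_cong)
    qed
    also have "\<dots> \<longleftrightarrow> (\<exists>w. p = mv (length (D 0)) (\<lambda>r c. \<delta> 0 $$ (r, c)) w 0)"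
    proof
      assume "\<exists>w. p = mv (length (D 0)) (\<lambda>r c. \<delta> 0 $$ (r, c)) w 0"
      then obtain w where w: "p = mv (length (D 0)) (\<lambda>r c. \<delta> 0 $$ (r, c)) w 0" ..
      have "mv (length (D 0)) (\<lambda>r c. \<delta> 0 $$ (r, c)) w 0 = mv (length (D 0)) (\<lambda>r c. \<delta> 0 $$ (r, c)) (($) (vec (length (D 0)) w)) 0"
        by (rule mv_cong) auto
      then show "\<exists>w\<in>carrier_vec (length (D 0)). p = mv (length (D 0)) (\<lambda>r c. \<delta> 0 $$ (r, c)) (($) w) 0"
        using w by (intro bexI[of _ "vec (length (D 0)) w"]) auto
    qed blast
    finally show "p \<in> I \<longleftrightarrow> (\<exists>w. p = mv (?M (Suc 0)) (\<lambda>r c. \<delta> 0 $$ (r, c)) w 0)" by simp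
  next
    fix i and w :: "nat \<Rightarrow> ('a, 'k) pring"
    let ?w = "vec (?M (Suc i)) w"
    have "(\<forall>r<?M i. mv (?M (Suc i)) (\<lambda>r c. \<delta> i $$ (r, c)) w r = 0) \<longleftrightarrow> ?w \<in> mat_kernel (\<delta> i)"
    proof -
      have "mv (?M (Suc i)) (\<lambda>r c. \<delta> i $$ (r, c)) w r = mv (?M (Suc i)) (\<lambda>r c. \<delta> i $$ (r, c)) (($) ?w) r" for r
        by (rule mv_cong) auto
      then have "(\<forall>r<?M i. mv (?M (Suc i)) (\<lambda>r c. \<delta> i $$ (r, c)) w r = 0) \<longleftrightarrow> \<delta> i *\<^sub>v ?w = 0\<^sub>v (?M i)"
        by (subst mult_mat_vec_mv[OF cm]) (auto simp: vec_eq_iff)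
      then show ?thesis by (simp add: mat_kernel[OF cm])
    qed
    also have "\<dots> \<longleftrightarrow> (\<exists>y. \<forall>c<?M (Suc i). ?w $ c = mv (?M (Suc (Suc i))) (\<lambda>r c. \<delta> (Suc i) $$ (r, c)) y c)"
      unfolding ex using image_mult_mat_vec[OF cm[of "Suc i"], of ?w] by simp
    also have "\<dots> \<longleftrightarrow> (\<exists>y. \<forall>c<?M (Suc i). w c = mv (?M (Suc (Suc i))) (\<lambda>r c. \<delta> (Suc i) $$ (r, c)) y c)" by simp
    finally show "(\<forall>r<?M i. mv (?M (Suc i)) (\<lambda>r c. \<delta> i $$ (r, c)) w r = 0) \<longleftrightarrow>
        (\<exists>y. \<forall>c<?M (Suc i). w c = mv (?M (Suc (Suc i))) (\<lambda>r c. \<delta> (Suc i) $$ (r, c)) y c)" .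
  qed auto
qed

lemma resolution_of_gres:
  fixes I :: "('a, 'k::field) pring set"
  assumes F: "gres M E P I"
  shows "min_graded_free_resolution I
     (\<lambda>i. map (E (Suc i)) [0..<M (Suc i)], \<lambda>i. mat (M i) (M (Suc i)) (\<lambda>(r, c). P i r c))"
proof -
  let ?A = "\<lambda>i. mat (M i) (M (Suc i)) (\<lambda>(r, c). P i r c)"
  have mvA: "mv (M (Suc i)) (\<lambda>r c. ?A i $$ (r, c)) w r = mv (M (Suc i)) (P i) w r" if "r < M i" for i w r
    by (rule mv_cong) (use that in auto)
  have cA: "?A i \<in> carrier_mat (M i) (M (Suc i))" for i by simp
  note F1 = gresD(1)[OF F]
  show ?thesis
    unfolding min_graded_free_resolution.simps
  proof (intro conjI allI impI ballI)
    show "?A 0 \<in> carrier_mat 1 (length (map (E (Suc 0)) [0..<M (Suc 0)]))" using F1 by simp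
    show "homogeneous (map (E (Suc 0)) [0..<M (Suc 0)] ! c) (?A 0 $$ (0, c))"
      if "c < length (map (E (Suc 0)) [0..<M (Suc 0)])" for c
      using that gresD(3)[OF F, of 0 0 c] F1 gresD(2)[OF F] by (auto simp: homogeneous_def)
    show "exp_degree t + map (E (Suc i)) [0..<M (Suc i)] ! r = map (E (Suc (Suc i))) [0..<M (Suc (Suc i))] ! c"
      if "r < length (map (E (Suc i)) [0..<M (Suc i)])" "c < length (map (E (Suc (Suc i))) [0..<M (Suc (Suc i))])"
         "t \<in> keys (?A (Suc i) $$ (r, c))" for i r c t
      using that gresD(3)[OF F, of r "Suc i" c t] by simp
    show "?A (Suc i) $$ (r, c) \<in> ideal_gen (range var)"
      if "r < length (map (E (Suc i)) [0..<M (Suc i)])" "c < length (map (E (Suc (Suc i))) [0..<M (Suc (Suc i))])" for i r c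
      using that gresD(4)[OF F, of r i c] by (simp add: mem_maximal_ideal_iff)
    show "I = {(?A 0 *\<^sub>v w) $ 0 |w. w \<in> carrier_vec (length (map (E (Suc 0)) [0..<M (Suc 0)]))}"
    proof (rule Set.set_eqI)
      fix p
      have "p \<in> I \<longleftrightarrow> (\<exists>w. p = mv (M (Suc 0)) (P 0) w 0)" by (rule gresD(5)[OF F])
      also have "\<dots> \<longleftrightarrow> (\<exists>w\<in>carrier_vec (M (Suc 0)). p = mv (M (Suc 0)) (P 0) (($) w) 0)"
      proof
        assume "\<exists>w. p = mv (M (Suc 0)) (P 0) w 0"
        then obtain w where "p = mv (M (Suc 0)) (P 0) w 0" ..
        moreover have "mv (M (Suc 0)) (P 0) w 0 = mv (M (Suc 0)) (P 0) (($) (vec (M (Suc 0)) w)) 0"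
          by (rule mv_cong) auto
        ultimately show "\<exists>w\<in>carrier_vec (M (Suc 0)). p = mv (M (Suc 0)) (P 0) (($) w) 0"
          by (intro bexI[of _ "vec (M (Suc 0)) w"]) auto
      qed blast
      also have "\<dots> \<longleftrightarrow> p \<in> {(?A 0 *\<^sub>v w) $ 0 |w. w \<in> carrier_vec (length (map (E (Suc 0)) [0..<M (Suc 0)]))}"
      proof -
        have "(?A 0 *\<^sub>v w) $ 0 = mv (M (Suc 0)) (P 0) (($) w) 0" if "w \<in> carrier_vec (M (Suc 0))" for w
          using F1 that by (simp add: scalar_prod_def mv_def atLeast0LessThan)
        then have "(\<exists>w\<in>carrier_vec (M (Suc 0)). p = mv (M (Suc 0)) (P 0) (($) w) 0) \<longleftrightarrow>
          (\<exists>w\<in>carrier_vec (M (Suc 0)). p = (?A 0 *\<^sub>v w) $ 0)" by (simp cong: bex_cong)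
        moreover have "length (map (E (Suc 0)) [0..<M (Suc 0)]) = M (Suc 0)" by simp
        ultimately show ?thesis by (simp only: mem_Collect_eq Bex_def) blast
      qed
      finally show "p \<in> I \<longleftrightarrow> p \<in> {(?A 0 *\<^sub>v w) $ 0 |w. w \<in> carrier_vec (length (map (E (Suc 0)) [0..<M (Suc 0)]))}" .
    qed
    show "mat_kernel (?A i) = {?A (Suc i) *\<^sub>v w |w. w \<in> carrier_vec (length (map (E (Suc (Suc i))) [0..<M (Suc (Suc i))]))}" for i
    proof (rule Set.set_eqI)
      fix v
      have l: "length (map (E (Suc (Suc i))) [0..<M (Suc (Suc i))]) = M (Suc (Suc i))" by simp
      have "v \<in> mat_kernel (?A i) \<longleftrightarrow> v \<in> carrier_vec (M (Suc i)) \<and> (\<forall>r<M i. mv (M (Suc i)) (P i) (($) v) r = 0)"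
      proof (cases "v \<in> carrier_vec (M (Suc i))")
        case True
        then show ?thesis
          by (auto simp: mat_kernel[OF cA] vec_eq_iff scalar_prod_def mv_def atLeast0LessThan)
      qed (simp add: mat_kernel[OF cA])
      also have "\<dots> \<longleftrightarrow> v \<in> carrier_vec (M (Suc i)) \<and> (\<exists>y. \<forall>c<M (Suc i). v $ c = mv (M (Suc (Suc i))) (P (Suc i)) y c)"
        unfolding gresD(6)[OF F] ..
      also have "\<dots> \<longleftrightarrow> v \<in> {?A (Suc i) *\<^sub>v w |w. w \<in> carrier_vec (M (Suc (Suc i)))}"
        unfolding image_mult_mat_vec[OF cA] by (simp add: mvA cong: conj_cong)
      finally show "v \<in> mat_kernel (?A i) \<longleftrightarrow> v \<in> {?A (Suc i) *\<^sub>v w |w. w \<in> carrier_vec (length (map (E (Suc (Suc i))) [0..<M (Suc (Suc i))]))}"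
        unfolding l .
    qed
  qed simp
qed

text \<open>Nothing is known about the resolution picked by \<open>SOME\<close>.
  \<open>resolution_of_gres\<close> shows that the choice is not void, and uniqueness of degrees,
  applied in both directions, compares the choice with the given resolution.\<close>

theorem betti_nonzero_iff:
  fixes C :: "nat \<Rightarrow> nat \<Rightarrow> nat \<Rightarrow> 'k::field" and dg :: "nat \<Rightarrow> nat \<Rightarrow> 'a::finite set"
  assumes F: "minimal_sres N dg C"
    and I: "I = (ideal_gen (pmono ` sqf ` dg (Suc 0) ` {..<N (Suc 0)}) :: ('a, 'k) pring set)"
  shows "betti I i j \<noteq> 0 \<longleftrightarrow> (\<exists>c<N (Suc i). card (dg (Suc i) c) = j)"
proof -
  have G: "gres N (\<lambda>i c. card (dg i c)) (sqf_map dg C) I"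
    using gres_of_minimal_sres[OF F] by (simp add: I)
  define S where "S = (SOME F. min_graded_free_resolution I F)"
  have "min_graded_free_resolution I S"
    unfolding S_def by (rule someI) (rule resolution_of_gres[OF G])
  then obtain D \<delta> where S: "S = (D, \<delta>)" "min_graded_free_resolution I (D, \<delta>)" by (cases S) auto
  note G' = gres_of_resolution[OF S(2)]
  have "betti I i j \<noteq> 0 \<longleftrightarrow> j \<in> set (D i)"
    by (simp add: betti_def S(1) count_list_0_iff flip: S_def)
  also have "\<dots> \<longleftrightarrow> (\<exists>c<N (Suc i). card (dg (Suc i) c) = j)"
  proof
    assume "j \<in> set (D i)"
    then obtain e where "e < length (D i)" "D i ! e = j" by (auto simp: in_set_conv_nth)
    then show "\<exists>c<N (Suc i). card (dg (Suc i) c) = j" using gres_degrees_unique[OF G' G, of e i] by simp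
  next
    assume "\<exists>c<N (Suc i). card (dg (Suc i) c) = j"
    then obtain c where "c < N (Suc i)" "card (dg (Suc i) c) = j" by blast
    then obtain f where "f < length (D i)" "D i ! f = j" using gres_degrees_unique[OF G G', of c i] by auto
    then show "j \<in> set (D i)" by (auto simp: in_set_conv_nth)
  qed
  finally show ?thesis .
qed

section \<open>Linear quotients and linear resolutions\<close>

definition sqf_ideal :: "'a::finite set set \<Rightarrow> ('a, 'k::field) pring set" where
  "sqf_ideal \<G> = ideal_gen (pmono ` sqf ` \<G>)"

text \<open>Membership in either ideal depends only on the supports of the monomials of a
  polynomial, so it is enough to test the squarefree monomials \<open>sqf W\<close>.\<close>

lemma colon_sqf_ideal_eq_iff:
  "colon_ideal (sqf_ideal U) (ideal_gen {pmono (sqf m)}) = (ideal_gen (var ` A) :: ('a::finite, 'k::field) pring set) \<longleftrightarrow>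
     (\<forall>W. (\<exists>u\<in>U. u \<subseteq> W \<union> m) \<longleftrightarrow> W \<inter> A \<noteq> {})"
proof -
  have 1: "f \<in> colon_ideal (sqf_ideal U) (ideal_gen {pmono (sqf m)}) \<longleftrightarrow> (\<forall>t\<in>keys f. \<exists>u\<in>U. u \<subseteq> keys t \<union> m)"
    for f :: "('a, 'k) pring"
    unfolding sqf_ideal_def mem_colon_mono_iff by (simp add: divides_sqf_iff keys_exp_add)
  have e: "var ` A = (pmono ` (\<lambda>v. single v (Suc 0)) ` A :: ('a, 'k) pring set)" by (auto simp: var_eq_mono)
  have 2: "f \<in> ideal_gen (var ` A) \<longleftrightarrow> (\<forall>t\<in>keys f. keys t \<inter> A \<noteq> {})" for f :: "('a, 'k) pring"
    unfolding e mem_monomial_ideal_iff by (auto simp: divides_single_iff)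
  show ?thesis
  proof
    assume eq: "colon_ideal (sqf_ideal U) (ideal_gen {pmono (sqf m)}) = (ideal_gen (var ` A) :: ('a, 'k) pring set)"
    show "\<forall>W. (\<exists>u\<in>U. u \<subseteq> W \<union> m) \<longleftrightarrow> W \<inter> A \<noteq> {}"
    proof
      fix W show "(\<exists>u\<in>U. u \<subseteq> W \<union> m) \<longleftrightarrow> W \<inter> A \<noteq> {}"
        using 1[of "pmono (sqf W)"] 2[of "pmono (sqf W)"] eq by simp
    qed
  next
    assume "\<forall>W. (\<exists>u\<in>U. u \<subseteq> W \<union> m) \<longleftrightarrow> W \<inter> A \<noteq> {}"
    then show "colon_ideal (sqf_ideal U) (ideal_gen {pmono (sqf m)}) = (ideal_gen (var ` A) :: ('a, 'k) pring set)"
      by (intro Set.set_eqI) (simp add: 1 2)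
  qed
qed

lemma monomial_ideal_sqf_ideal: "monomial_ideal (sqf_ideal \<G>)"
  unfolding monomial_ideal_def sqf_ideal_def monomials_altdef
  by (rule exI[of _ "pmono ` sqf ` \<G>"]) auto

lemma uniform_antichain:
  fixes \<G> :: "'a::finite set set"
  assumes "\<forall>u\<in>\<G>. card u = d" "u \<in> \<G>" "v \<in> \<G>" "u \<subseteq> v"
  shows "u = v"
  using assms by (simp add: card_subset_eq)

lemma Mingens_sqf_ideal:
  assumes d: "\<forall>u\<in>\<G>. card u = d"
  shows "Mingens (sqf_ideal \<G>) = (pmono ` sqf ` \<G> :: ('a::finite, 'k::field) pring set)"
  unfolding sqf_ideal_def
proof (rule Mingens_mono_ideal)
  fix s t assume "s \<in> sqf ` \<G>" "t \<in> sqf ` \<G>" "divides s t"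
  then show "s = t" using uniform_antichain[OF d] by (auto simp: divides_sqf_iff)
qed

theorem linear_quotients_iff:
  fixes \<G> :: "'a::finite set set"
  assumes d: "\<forall>u\<in>\<G>. card u = d"
  shows "linear_quotients (sqf_ideal \<G> :: ('a, 'k::field) pring set) \<longleftrightarrow>
    (\<exists>ms. distinct ms \<and> set ms = \<G> \<and>
      (\<forall>k<length ms. \<exists>A. \<forall>W. (\<exists>j<k. ms ! j \<subseteq> W \<union> ms ! k) \<longleftrightarrow> W \<inter> A \<noteq> {}))"
proof -
  let ?f = "\<lambda>u. pmono (sqf u) :: ('a, 'k) pring"
  have inj: "inj ?f" by (auto simp: inj_def)
  have M: "Mingens (sqf_ideal \<G>) = (?f ` \<G>)"
    using Mingens_sqf_ideal[OF d] by (simp add: image_image)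
  have step: "colon_ideal (ideal_gen (set (take k (map ?f ms)))) (ideal_gen {map ?f ms ! k}) = ideal_gen (var ` A) \<longleftrightarrow>
      (\<forall>W. (\<exists>j<k. ms ! j \<subseteq> W \<union> ms ! k) \<longleftrightarrow> W \<inter> A \<noteq> {})" if "k < length ms" for k ms A
  proof -
    have "set (take k (map ?f ms)) = pmono ` sqf ` set (take k ms)" by (simp add: take_map image_image)
    then have "colon_ideal (ideal_gen (set (take k (map ?f ms)))) (ideal_gen {map ?f ms ! k}) = ideal_gen (var ` A) \<longleftrightarrow>
      (\<forall>W. (\<exists>u\<in>set (take k ms). u \<subseteq> W \<union> ms ! k) \<longleftrightarrow> W \<inter> A \<noteq> {})"
      using that by (simp flip: colon_sqf_ideal_eq_iff[where 'k = 'k] sqf_ideal_def)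
    also have "(\<forall>W. (\<exists>u\<in>set (take k ms). u \<subseteq> W \<union> ms ! k) \<longleftrightarrow> W \<inter> A \<noteq> {}) \<longleftrightarrow>
        (\<forall>W. (\<exists>j<k. ms ! j \<subseteq> W \<union> ms ! k) \<longleftrightarrow> W \<inter> A \<noteq> {})"
    proof -
      have "set (take k ms) = (!) ms ` {..<k}" using nth_image[of k ms] that by (simp add: atLeast0LessThan)
      then have "(\<exists>u\<in>set (take k ms). Q u) \<longleftrightarrow> (\<exists>j<k. Q (ms ! j))" for Q by auto
      then show ?thesis by simp
    qed
    finally show ?thesis .
  qed
  show ?thesis
  proof
    assume "linear_quotients (sqf_ideal \<G> :: ('a, 'k) pring set)"
    then obtain ps where ps: "distinct ps" "set ps = ?f ` \<G>"
      "\<forall>k. 1 \<le> k \<and> k < length ps \<longrightarrow> (\<exists>A. colon_ideal (ideal_gen (set (take k ps))) (ideal_gen {ps ! k}) = ideal_gen (var ` A))"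
      unfolding linear_quotients_def M by (elim exE conjE) (rule that)
    define ms where "ms = map (inv_into UNIV ?f) ps"
    have "?f (inv_into UNIV ?f p) = p" if "p \<in> set ps" for p
    proof (rule f_inv_into_f)
      show "p \<in> range ?f" using that ps(2) by blast
    qed
    then have psms: "ps = map ?f ms" unfolding ms_def by (simp add: map_idI)
    then have "distinct ms" using ps(1) by (simp add: distinct_map)
    moreover have "set ms = \<G>" using ps(2) psms inj by (simp add: inj_image_eq_iff)
    \<comment> \<open>For the first generator, which \<open>linear_quotients\<close> does not
      mention, the empty set of variables serves.\<close>
    moreover have "\<exists>A. \<forall>W. (\<exists>j<k. ms ! j \<subseteq> W \<union> ms ! k) \<longleftrightarrow> W \<inter> A \<noteq> {}" if k: "k < length ms" for k
    proof (cases "k = 0")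
      case False
      then have "1 \<le> k \<and> k < length ps" using k psms by simp
      then obtain A where "colon_ideal (ideal_gen (set (take k ps))) (ideal_gen {ps ! k}) = ideal_gen (var ` A)"
        using ps(3) by iprover
      then have "\<forall>W. (\<exists>j<k. ms ! j \<subseteq> W \<union> ms ! k) \<longleftrightarrow> W \<inter> A \<noteq> {}" using step[OF k] psms by simp
      then show ?thesis ..
    qed (auto intro: exI[of _ "{}"])
    ultimately show "\<exists>ms. distinct ms \<and> set ms = \<G> \<and>
      (\<forall>k<length ms. \<exists>A. \<forall>W. (\<exists>j<k. ms ! j \<subseteq> W \<union> ms ! k) \<longleftrightarrow> W \<inter> A \<noteq> {})"
      by (intro exI[of _ ms]) simp
  next
    assume "\<exists>ms. distinct ms \<and> set ms = \<G> \<and>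
      (\<forall>k<length ms. \<exists>A. \<forall>W. (\<exists>j<k. ms ! j \<subseteq> W \<union> ms ! k) \<longleftrightarrow> W \<inter> A \<noteq> {})"
    then obtain ms where ms: "distinct ms" "set ms = \<G>"
      "\<forall>k<length ms. \<exists>A. \<forall>W. (\<exists>j<k. ms ! j \<subseteq> W \<union> ms ! k) \<longleftrightarrow> W \<inter> A \<noteq> {}"
      by (elim exE conjE) (rule that)
    show "linear_quotients (sqf_ideal \<G> :: ('a, 'k) pring set)"
      unfolding linear_quotients_def M
    proof (intro conjI exI[of _ "map ?f ms"] allI impI)
      show "distinct (map ?f ms)" using ms(1) inj by (auto simp: distinct_map inj_on_def)
      show "set (map ?f ms) = ?f ` \<G>" using ms(2) by simp
      fix k assume "1 \<le> k \<and> k < length (map ?f ms)"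
      then have k: "k < length ms" by simp
      then obtain A where "\<forall>W. (\<exists>j<k. ms ! j \<subseteq> W \<union> ms ! k) \<longleftrightarrow> W \<inter> A \<noteq> {}" using ms(3) by iprover
      then have "colon_ideal (ideal_gen (set (take k (map ?f ms)))) (ideal_gen {map ?f ms ! k}) = ideal_gen (var ` A)"
        using step[OF k] by iprover
      then show "\<exists>A. colon_ideal (ideal_gen (set (take k (map ?f ms)))) (ideal_gen {map ?f ms ! k}) = ideal_gen (var ` A)" ..
    qed (rule monomial_ideal_sqf_ideal)
  qed
qed

lemma sqf_ideal_nonzero: "u \<in> \<G> \<Longrightarrow> (sqf_ideal \<G> :: ('a::finite, 'k::field) pring set) \<noteq> {0}"
proof
  assume "u \<in> \<G>" "(sqf_ideal \<G> :: ('a, 'k) pring set) = {0}"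
  moreover have "pmono (sqf u) \<in> (sqf_ideal \<G> :: ('a, 'k) pring set)"
    unfolding sqf_ideal_def by (rule ideal_gen_base) (use \<open>u \<in> \<G>\<close> in blast)
  ultimately have "(pmono (sqf u) :: ('a, 'k) pring) = 0" by simp
  then have "keys (pmono (sqf u) :: ('a, 'k) pring) = {}" by simp
  then show False by simp
qed

theorem linear_quotients_imp_linear_resolution:
  fixes \<G> :: "'a::finite set set"
  assumes d: "\<forall>u\<in>\<G>. card u = d" "d > 0"
    and lq: "linear_quotients (sqf_ideal \<G> :: ('a, 'k::field) pring set)"
  shows "linear_resolution (sqf_ideal \<G> :: ('a, 'k) pring set)"
proof (cases "\<G> = {}")
  case True
  then show ?thesis by (simp add: linear_resolution_def sqf_ideal_def ideal_gen_empty)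
next
  case ne: False
  let ?I = "sqf_ideal \<G> :: ('a, 'k) pring set"
  obtain ms where ms: "distinct ms" "set ms = \<G>"
    "\<forall>k<length ms. \<exists>A. \<forall>W. (\<exists>j<k. ms ! j \<subseteq> W \<union> ms ! k) \<longleftrightarrow> W \<inter> A \<noteq> {}"
    using linear_quotients_iff[OF d(1), THEN iffD1, OF lq] by (elim exE conjE) (rule that)
  have "\<forall>k. \<exists>A. k < length ms \<longrightarrow> (\<forall>W. (\<exists>j<k. ms ! j \<subseteq> W \<union> ms ! k) \<longleftrightarrow> W \<inter> A \<noteq> {})"
    using ms(3) by simp
  then obtain A where A: "\<forall>k. k < length ms \<longrightarrow> (\<forall>W. (\<exists>j<k. ms ! j \<subseteq> W \<union> ms ! k) \<longleftrightarrow> W \<inter> A k \<noteq> {})"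
    by (rule choice[THEN exE])
  have Ak: "finite (A k) \<and> A k \<inter> ms ! k = {} \<and> (\<forall>W. (\<exists>j<k. ms ! j \<subseteq> W \<union> ms ! k) \<longleftrightarrow> W \<inter> A k \<noteq> {})"
    if k: "k < length ms" for k
  proof (intro conjI)
    show "\<forall>W. (\<exists>j<k. ms ! j \<subseteq> W \<union> ms ! k) \<longleftrightarrow> W \<inter> A k \<noteq> {}" using A k by blast
    \<comment> \<open>A variable of \<open>A k\<close> inside \<open>ms ! k\<close> would, with W =
      \<open>ms ! k\<close>, put an earlier generator inside \<open>ms ! k\<close>, which the
      antichain excludes.\<close>
    show "A k \<inter> ms ! k = {}"
    proof (rule ccontr)
      assume ne: "A k \<inter> ms ! k \<noteq> {}"
      have "(\<exists>j<k. ms ! j \<subseteq> ms ! k \<union> ms ! k) \<longleftrightarrow> ms ! k \<inter> A k \<noteq> {}" using A k by blast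
      then obtain j where j: "j < k" "ms ! j \<subseteq> ms ! k" using ne by (auto simp: Int_commute)
      then have "ms ! j = ms ! k" using uniform_antichain[OF d(1), of "ms ! j" "ms ! k"] ms(2) k by auto
      then show False using ms(1) j k by (auto simp: nth_eq_iff_index_eq)
    qed
  qed simp
  have "\<exists>N dg (C :: _ \<Rightarrow> _ \<Rightarrow> _ \<Rightarrow> 'k). sres N dg C \<and> N (Suc 0) = length ms \<and>
     (\<forall>c<length ms. dg (Suc 0) c = ms ! c) \<and>
     (\<forall>i. \<forall>c<N (Suc i). card (dg (Suc i) c) = d + i \<and> finite (dg (Suc i) c))"
  proof (rule sres_linear_quotients)
    show "card m = d \<and> finite m" if "m \<in> set ms" for m using that d ms(2) by simp
  qed (rule Ak)
  then obtain N dg and C :: "_ \<Rightarrow> _ \<Rightarrow> _ \<Rightarrow> 'k" where F: "sres N dg C" "N (Suc 0) = length ms"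
     "\<forall>c<length ms. dg (Suc 0) c = ms ! c"
     "\<forall>i. \<forall>c<N (Suc i). card (dg (Suc i) c) = d + i \<and> finite (dg (Suc i) c)"
    by (elim exE conjE) (rule that)
  \<comment> \<open>Minimality comes from linearity: degrees grow by exactly one from each position
    to the next, and from 0 to \<open>d\<close> at the start, where \<open>d > 0\<close>
    enters.\<close>
  have "dg i r \<subset> dg (Suc i) c" if "r < N i" "c < N (Suc i)" "C i r c \<noteq> 0" for i r c
  proof -
    have "dg i r \<subseteq> dg (Suc i) c" using sresD(4)[OF F(1) that] .
    moreover have "card (dg i r) \<noteq> card (dg (Suc i) c)"
      using F(4) that sresD(1,2)[OF F(1)] d(2) by (cases i) auto
    ultimately show ?thesis by (intro psubsetI) auto
  qed
  then have mF: "minimal_sres N dg C" using F(1) by (simp add: minimal_sres_def)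
  have gens: "dg (Suc 0) ` {..<N (Suc 0)} = \<G>"
  proof -
    have "dg (Suc 0) ` {..<N (Suc 0)} = (!) ms ` {..<length ms}" using F(2,3) by (intro image_cong) auto
    also have "\<dots> = set ms" by (auto simp: set_conv_nth)
    finally show ?thesis using ms(2) by simp
  qed
  have betti: "betti ?I i j \<noteq> 0 \<longleftrightarrow> (\<exists>c<N (Suc i). card (dg (Suc i) c) = j)" for i j
    by (rule betti_nonzero_iff[OF mF]) (simp add: gens sqf_ideal_def)
  have "{ereal (real j - real i) | i j. betti ?I i j \<noteq> 0} = {ereal (real d)}"
  proof
    show "{ereal (real j - real i) | i j. betti ?I i j \<noteq> 0} \<subseteq> {ereal (real d)}"
    proof
      fix x assume "x \<in> {ereal (real j - real i) | i j. betti ?I i j \<noteq> 0}"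
      then obtain i j where ij: "x = ereal (real j - real i)" "betti ?I i j \<noteq> 0" by blast
      from ij(2) have "\<exists>c<N (Suc i). card (dg (Suc i) c) = j" by (simp only: betti)
      then have "j = d + i" using F(4) by auto
      then show "x \<in> {ereal (real d)}" using ij(1) by simp
    qed
    have "length ms > 0" using ne ms(2) by auto
    then have "\<exists>c<N (Suc 0). card (dg (Suc 0) c) = d" using F(2,4) by auto
    then have "betti ?I 0 d \<noteq> 0" by (simp only: betti)
    then have "\<exists>i j. ereal (real d) = ereal (real j - real i) \<and> betti ?I i j \<noteq> 0"
      by (intro exI[of _ 0] exI[of _ d]) simp
    then show "{ereal (real d)} \<subseteq> {ereal (real j - real i) | i j. betti ?I i j \<noteq> 0}" by blast
  qed
  then have "regularity ?I = ereal (real d)" by (simp add: regularity_def)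
  moreover have "homogeneous d m" if "m \<in> Mingens ?I" for m
    using that d(1) unfolding Mingens_sqf_ideal[OF d(1)] by (auto simp: homogeneous_def)
  ultimately show ?thesis unfolding linear_resolution_def using monomial_ideal_sqf_ideal by blast
qed

text \<open>The degree in \<open>linear_resolution\<close> is existentially quantified; any
  generator identifies it with \<open>d\<close>. The supremum then bounds every degree that occurs,
  and these bounds are all that the forbidden subgraphs will violate.\<close>

theorem linear_resolution_sres:
  fixes \<G> :: "'a::finite set set"
  assumes d: "\<forall>u\<in>\<G>. card u = d" "d > 0" and ne: "\<G> \<noteq> {}"
    and lr: "linear_resolution (sqf_ideal \<G> :: ('a, 'k::field) pring set)"
  shows "\<exists>N dg (C :: nat \<Rightarrow> nat \<Rightarrow> nat \<Rightarrow> 'k). sres N dg C \<and>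
    bij_betw (dg (Suc 0)) {..<N (Suc 0)} \<G> \<and> (\<forall>i. \<forall>c<N (Suc i). card (dg (Suc i) c) \<le> d + i)"
proof -
  let ?I = "sqf_ideal \<G> :: ('a, 'k) pring set"
  obtain ms where ms: "set ms = \<G>" "distinct ms" using finite_distinct_list[OF finite[of \<G>]] by (elim exE conjE) (rule that)
  have "\<exists>N dg (C :: nat \<Rightarrow> nat \<Rightarrow> nat \<Rightarrow> 'k). minimal_sres N dg C \<and>
    N (Suc 0) = length ms \<and> (\<forall>c<length ms. dg (Suc 0) c = ms ! c)"
  proof (rule minimal_sres_exists)
    show "{} \<notin> set ms" using d ms(1) by force
    show "i = j" if "i < length ms" "j < length ms" "ms ! i \<subseteq> ms ! j" for i j
    proof -
      have "ms ! i = ms ! j" using uniform_antichain[OF d(1), of "ms ! i" "ms ! j"] that ms(1) by auto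
      then show ?thesis using that ms(2) by (simp add: nth_eq_iff_index_eq)
    qed
  qed
  then obtain N dg and C :: "nat \<Rightarrow> nat \<Rightarrow> nat \<Rightarrow> 'k" where F: "minimal_sres N dg C"
    "N (Suc 0) = length ms" "\<forall>c<length ms. dg (Suc 0) c = ms ! c"
    by (elim exE conjE) (rule that)
  have gens: "dg (Suc 0) ` {..<N (Suc 0)} = \<G>"
  proof -
    have "dg (Suc 0) ` {..<N (Suc 0)} = (!) ms ` {..<length ms}" using F(2,3) by (intro image_cong) auto
    also have "\<dots> = set ms" by (auto simp: set_conv_nth)
    finally show ?thesis using ms(1) by simp
  qed
  have betti: "betti ?I i j \<noteq> 0 \<longleftrightarrow> (\<exists>c<N (Suc i). card (dg (Suc i) c) = j)" for i j
    by (rule betti_nonzero_iff[OF F(1)]) (simp add: gens sqf_ideal_def)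
  obtain u where u: "u \<in> \<G>" using ne by blast
  then have "?I \<noteq> {0}" by (rule sqf_ideal_nonzero)
  then obtain d' where d': "\<forall>m\<in>Mingens ?I. homogeneous d' m" "regularity ?I = ereal (real d')"
    using lr by (auto simp: linear_resolution_def)
  have "pmono (sqf u) \<in> Mingens ?I" unfolding Mingens_sqf_ideal[OF d(1)] using u by blast
  then have "homogeneous d' (pmono (sqf u) :: ('a, 'k) pring)" using d'(1) by blast
  then have "d' = d" using d(1) u by (simp add: homogeneous_def)
  show ?thesis
  proof (intro exI[of _ N] exI[of _ dg] exI[of _ C] conjI allI impI)
    show "sres N dg C" using F(1) by (simp add: minimal_sres_def)
    show "bij_betw (dg (Suc 0)) {..<N (Suc 0)} \<G>"
      unfolding bij_betw_def using gens F(2,3) ms(2) by (auto simp: inj_on_def nth_eq_iff_index_eq)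
    fix i c assume c: "c < N (Suc i)"
    then have "betti ?I i (card (dg (Suc i) c)) \<noteq> 0" using betti by blast
    then have "ereal (real (card (dg (Suc i) c)) - real i) \<le> regularity ?I"
      unfolding regularity_def by (intro Sup_upper) blast
    then show "card (dg (Suc i) c) \<le> d + i" unfolding d'(2) \<open>d' = d\<close> by simp
  qed
qed

text \<open>The first row consists of ones, so the entries in a column of first syzygies sum to
  zero.\<close>

lemma gen_column_other_row:
  fixes C :: "nat \<Rightarrow> nat \<Rightarrow> nat \<Rightarrow> 'k::field"
  assumes F: "sres N dg C" and e: "e < N (Suc (Suc 0))" and r: "r < N (Suc 0)" "C (Suc 0) r e \<noteq> 0"
  shows "\<exists>s<N (Suc 0). s \<noteq> r \<and> C (Suc 0) s e \<noteq> 0"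
proof (rule ccontr)
  assume "\<not> ?thesis"
  then have z: "C (Suc 0) s e = 0" if "s < N (Suc 0)" "s \<noteq> r" for s using that by blast
  have "mv (N (Suc 0)) (C 0) (\<lambda>c. C (Suc 0) c e) 0 = mv (N (Suc 0)) (C 0) (\<lambda>c. if c = r then C (Suc 0) r e else 0) 0"
    by (rule mv_cong) (use z in auto)
  also have "\<dots> = C (Suc 0) r e" using r sresD(3)[OF F] by (simp add: mv_unit)
  finally show False using sresD(5)[OF F _ e, of 0] sresD(1)[OF F] r by simp
qed

text \<open>The difference of two generators is killed by the row of ones, so exactness in degree
  \<open>W\<close> applies.\<close>

lemma unit_difference_cycle:
  fixes C :: "nat \<Rightarrow> nat \<Rightarrow> nat \<Rightarrow> 'k::field"
  assumes F: "sres N dg C" and r: "r < N (Suc 0)" "s < N (Suc 0)" and "dg (Suc 0) r \<subseteq> W" "dg (Suc 0) s \<subseteq> W"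
  shows "\<exists>y. supp_in (N (Suc (Suc 0))) (dg (Suc (Suc 0))) W y \<and> (\<forall>c<N (Suc 0).
    (if c = r then 1 else 0) - (if c = s then 1 else 0) = mv (N (Suc (Suc 0))) (C (Suc 0)) y c)"
proof -
  let ?v = "\<lambda>c. (if c = r then 1 else 0) - (if c = s then 1 else 0) :: 'k"
  have 1: "supp_in (N (Suc 0)) (dg (Suc 0)) W ?v" using assms by (auto simp: supp_in_def)
  have 2: "mv (N (Suc 0)) (C 0) ?v q = 0" if "q < N 0" for q
    using that sresD(1)[OF F] r sresD(3)[OF F] by (simp add: mv_diff mv_unit)
  obtain u where "supp_in (N (Suc (Suc 0))) (dg (Suc (Suc 0))) W u"
    "\<And>c. c < N (Suc 0) \<Longrightarrow> ?v c = mv (N (Suc (Suc 0))) (C (Suc 0)) u c"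
    using sres_exact[OF F 1 2] by blast
  then show ?thesis by (intro exI[of _ u]) simp
qed

text \<open>The difference of \<open>u\<close> and \<open>v\<close> is a combination of syzygies of
  degree inside \<open>u \<union> v\<close>. One of them involves \<open>u\<close>, hence also
  another generator \<open>u'\<close>; its degree contains \<open>u \<union> u'\<close> and has at
  most d + 1 elements.\<close>

theorem linear_first_syzygies:
  fixes \<G> :: "'a::finite set set"
  assumes d: "\<forall>u\<in>\<G>. card u = d" "d > 0"
    and lr: "linear_resolution (sqf_ideal \<G> :: ('a, 'k::field) pring set)"
    and uv: "u \<in> \<G>" "v \<in> \<G>" "u \<noteq> v"
  shows "\<exists>u'\<in>\<G>. card (u' - u) = 1 \<and> u' \<subseteq> u \<union> v"
proof -
  have ne: "\<G> \<noteq> {}" using uv(1) by blast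
  obtain N dg and C :: "nat \<Rightarrow> nat \<Rightarrow> nat \<Rightarrow> 'k" where F: "sres N dg C"
    "bij_betw (dg (Suc 0)) {..<N (Suc 0)} \<G>"
    "\<forall>i. \<forall>c<N (Suc i). card (dg (Suc i) c) \<le> d + i"
    using linear_resolution_sres[OF d ne lr] by (elim exE conjE) (rule that)
  obtain r where r: "r < N (Suc 0)" "dg (Suc 0) r = u" using F(2) uv(1) by (auto simp: bij_betw_def)
  obtain s where s: "s < N (Suc 0)" "dg (Suc 0) s = v" using F(2) uv(2) by (auto simp: bij_betw_def)
  have "r \<noteq> s" using r s uv(3) by auto
  have rs: "dg (Suc 0) r \<subseteq> u \<union> v" "dg (Suc 0) s \<subseteq> u \<union> v" using r s by auto
  obtain y where y: "supp_in (N (Suc (Suc 0))) (dg (Suc (Suc 0))) (u \<union> v) y"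
    "\<forall>c<N (Suc 0). (if c = r then 1 else 0) - (if c = s then 1 else 0) = mv (N (Suc (Suc 0))) (C (Suc 0)) y c"
    using unit_difference_cycle[OF F(1) r(1) s(1) rs] by (elim exE conjE) (rule that)
  have "mv (N (Suc (Suc 0))) (C (Suc 0)) y r \<noteq> 0" using y(2)[rule_format, OF r(1)] \<open>r \<noteq> s\<close> by simp
  then obtain e where e: "e < N (Suc (Suc 0))" "C (Suc 0) r e \<noteq> 0" "y e \<noteq> 0" using mv_nonzero by blast
  obtain q where q: "q < N (Suc 0)" "q \<noteq> r" "C (Suc 0) q e \<noteq> 0"
    using gen_column_other_row[OF F(1) e(1) r(1) e(2)] by blast
  let ?u' = "dg (Suc 0) q" and ?D = "dg (Suc (Suc 0)) e"
  have u': "?u' \<in> \<G>" "?u' \<noteq> u" using F(2) q r by (auto simp: bij_betw_def inj_on_def)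
  have sub: "u \<subseteq> ?D" "?u' \<subseteq> ?D" "?D \<subseteq> u \<union> v"
    using sresD(4)[OF F(1) r(1) e(1,2)] sresD(4)[OF F(1) q(1) e(1) q(3)] r y(1) e by (auto simp: supp_in_def)
  have "card (u \<union> ?u') \<le> d + 1" using F(3)[rule_format, OF e(1)] card_mono[of ?D "u \<union> ?u'"] sub by simp
  moreover have "card (u \<union> ?u') = d + card (?u' - u)"
    using card_Un_disjoint[of u "?u' - u"] d(1) uv(1) by (simp add: Un_Diff_cancel)
  moreover have "?u' - u \<noteq> {}" using u' uniform_antichain[OF d(1) u'(1) uv(1)] by blast
  then have "card (?u' - u) \<noteq> 0" by simp
  ultimately have "card (?u' - u) = 1" by linarith
  then show ?thesis using u'(1) sub by blast
qed

definition hex_succ :: "nat \<Rightarrow> nat" where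
  "hex_succ i = (if i = 5 then 0 else Suc i)"

lemma hex_succ_less: "i < 6 \<Longrightarrow> hex_succ i < 6"
  and hex_succ_neq: "hex_succ i \<noteq> i"
  and hex_succ_inj: "i < 6 \<Longrightarrow> j < 6 \<Longrightarrow> hex_succ i = hex_succ j \<Longrightarrow> i = j"
  by (auto simp: hex_succ_def split: if_splits)

text \<open>
  The functional \<open>\<phi> i\<close> measures how often a second syzygy runs through edge \<open>i\<close> of the hexagon. On a
  generator of degree inside \<open>W\<close> all \<open>\<phi> i\<close> agree; by linearity this degree has at most \<open>d + 2\<close> elements,
  so it misses some edge and they all vanish. But the sum of the six edges is a second syzygy with value \<open>1\<close>.
\<close>

theorem hexagon_not_linear:
  fixes \<G> :: "'a::finite set set"
  assumes d: "\<forall>u\<in>\<G>. card u = d" "d > 0"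
    and g: "\<And>i. i < 6 \<Longrightarrow> g i \<in> \<G>" "\<And>i. i < 6 \<Longrightarrow> g i \<subseteq> W"
    and inj: "\<And>i j. i < 6 \<Longrightarrow> j < 6 \<Longrightarrow> g i = g j \<Longrightarrow> i = j"
    and all: "\<And>u. u \<in> \<G> \<Longrightarrow> u \<subseteq> W \<Longrightarrow> \<exists>i<6. u = g i"
    and adj: "\<And>i. i < 6 \<Longrightarrow> card (g i \<union> g (hex_succ i)) = d + 1"
    and nadj: "\<And>i j. i < 6 \<Longrightarrow> j < 6 \<Longrightarrow> i \<noteq> j \<Longrightarrow> j \<noteq> hex_succ i \<Longrightarrow> i \<noteq> hex_succ j \<Longrightarrow> card (g i \<union> g j) > d + 1"
    and Einj: "\<And>i j. i < 6 \<Longrightarrow> j < 6 \<Longrightarrow> g i \<union> g (hex_succ i) = g j \<union> g (hex_succ j) \<Longrightarrow> i = j"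
    and cover: "\<And>w. w \<in> W \<Longrightarrow> \<exists>i<6. w \<in> g i \<union> g (hex_succ i)"
    and big: "card W > d + 2"
  shows "\<not> linear_resolution (sqf_ideal \<G> :: ('a, 'k::field) pring set)"
proof
  assume lr: "linear_resolution (sqf_ideal \<G> :: ('a, 'k) pring set)"
  have ne: "\<G> \<noteq> {}" using g(1)[of 0] by auto
  obtain N dg and C :: "nat \<Rightarrow> nat \<Rightarrow> nat \<Rightarrow> 'k" where F: "sres N dg C"
    "bij_betw (dg (Suc 0)) {..<N (Suc 0)} \<G>"
    "\<forall>i. \<forall>c<N (Suc i). card (dg (Suc i) c) \<le> d + i"
    using linear_resolution_sres[OF d ne lr] by (elim exE conjE) (rule that)
  let ?N1 = "N (Suc 0)" and ?N2 = "N (Suc (Suc 0))" and ?N3 = "N (Suc (Suc (Suc 0)))"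
  let ?d1 = "dg (Suc 0)" and ?d2 = "dg (Suc (Suc 0))" and ?d3 = "dg (Suc (Suc (Suc 0)))"
  let ?C1 = "C (Suc 0)" and ?C2 = "C (Suc (Suc 0))"
  define E where "E = (\<lambda>i. g i \<union> g (hex_succ i))"
  have EW: "E i \<subseteq> W" if "i < 6" for i using g(2) that hex_succ_less by (auto simp: E_def)
  have Esub: "i = j" if "i < 6" "j < 6" "E i \<subseteq> E j" for i j
  proof -
    have "E i = E j" by (rule card_subset_eq) (use that adj in \<open>auto simp: E_def\<close>)
    then show ?thesis using Einj that by (simp add: E_def)
  qed
  have "\<exists>k. k < ?N1 \<and> ?d1 k = g i" if "i < 6" for i
    using F(2) g(1)[OF that] by (auto simp: bij_betw_def)
  then have "\<forall>i. \<exists>k. i < 6 \<longrightarrow> k < ?N1 \<and> ?d1 k = g i" by auto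
  then obtain k where k0: "\<forall>i. i < 6 \<longrightarrow> k i < ?N1 \<and> ?d1 (k i) = g i" by (rule choice[THEN exE])
  then have k: "k i < ?N1" "?d1 (k i) = g i" if "i < 6" for i using that by auto
  have row: "\<exists>j<6. q = k j" if q: "q < ?N1" "?d1 q \<subseteq> W" for q
  proof -
    have "?d1 q \<in> \<G>" using F(2) q by (auto simp: bij_betw_def)
    then obtain j where j: "j < 6" "?d1 q = g j" using all q(2) by blast
    then have "q = k j" using F(2) k[OF j(1)] q by (auto simp: bij_betw_def inj_on_def)
    then show ?thesis using j by blast
  qed
  have kinj: "i = j" if "i < 6" "j < 6" "k i = k j" for i j
    using inj[OF that(1,2)] k that by metis
  \<comment> \<open>By linearity a first syzygy degree has at most d + 1 elements, so it contains
    two of the generators only if it is the union along an edge of the hexagon.\<close>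
  have two: "(j = hex_succ i \<and> ?d2 e = E i) \<or> (i = hex_succ j \<and> ?d2 e = E j)"
    if "e < ?N2" "i < 6" "j < 6" "i \<noteq> j" "g i \<subseteq> ?d2 e" "g j \<subseteq> ?d2 e" for e i j
  proof -
    have c: "card (?d2 e) \<le> d + 1" using F(3)[rule_format, OF that(1)] by simp
    have sub: "g i \<union> g j \<subseteq> ?d2 e" using that by blast
    then have "card (g i \<union> g j) \<le> d + 1" using c card_mono[OF finite sub] by linarith
    then have a: "j = hex_succ i \<or> i = hex_succ j" using nadj[OF that(2,3,4)] by force
    then have "card (g i \<union> g j) = d + 1" using adj[OF that(2)] adj[OF that(3)] by (auto simp: Un_commute)
    then have "g i \<union> g j = ?d2 e" using sub c card_seteq[OF finite sub] by simp
    then show ?thesis using a by (auto simp: E_def Un_commute)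
  qed
  have L1: "?d2 e = E i \<or> (\<exists>j<6. i = hex_succ j \<and> ?d2 e = E j)"
    if e: "e < ?N2" "i < 6" "?C1 (k i) e \<noteq> 0" "?d2 e \<subseteq> W" for e i
  proof -
    obtain q where q: "q < ?N1" "q \<noteq> k i" "?C1 q e \<noteq> 0"
      using gen_column_other_row[OF F(1) e(1) k(1)[OF e(2)] e(3)] by blast
    have s1: "?d1 q \<subseteq> ?d2 e" using sresD(4)[OF F(1) q(1) e(1) q(3)] .
    have s2: "g i \<subseteq> ?d2 e" using sresD(4)[OF F(1) k(1)[OF e(2)] e(1,3)] k(2)[OF e(2)] by simp
    obtain j where j: "j < 6" "q = k j" using row[OF q(1)] s1 e(4) by blast
    then have "i \<noteq> j" "g j \<subseteq> ?d2 e" using q(2) s1 k(2) by auto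
    then show ?thesis using two[OF e(1,2) j(1) _ s2] j(1) by blast
  qed
  \<comment> \<open>Inside \<open>E i\<close> lie only the two ends of edge \<open>i\<close>, so a
    column of this degree has no other nonzero entries, and its entries sum to zero.\<close>
  have opp: "?C1 (k (hex_succ i)) e = - ?C1 (k i) e" if e: "e < ?N2" "?d2 e = E i" and i: "i < 6" for e i
  proof -
    have ne: "k (hex_succ i) \<noteq> k i" using kinj[of "hex_succ i" i] i hex_succ_less hex_succ_neq by blast
    have z: "?C1 q e = 0" if q: "q < ?N1" "q \<noteq> k i" "q \<noteq> k (hex_succ i)" for q
    proof (rule ccontr)
      assume nz: "?C1 q e \<noteq> 0"
      have s1: "?d1 q \<subseteq> ?d2 e" using sresD(4)[OF F(1) q(1) e(1) nz] .
      then obtain j where j: "j < 6" "q = k j" using row[OF q(1)] e(2) EW[OF i] by blast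
      then have "g j \<subseteq> ?d2 e" "i \<noteq> j" using s1 k(2) q(2) by auto
      moreover have "g i \<subseteq> ?d2 e" using e(2) by (auto simp: E_def)
      ultimately have "j = hex_succ i \<or> (i = hex_succ j \<and> E i = E j)" using two[OF e(1) i j(1)] e(2) by auto
      then have "j = hex_succ i" using Esub[OF i j(1)] \<open>i \<noteq> j\<close> by auto
      then show False using q(3) j(2) by blast
    qed
    have "0 = mv ?N1 (C 0) (\<lambda>q. ?C1 q e) 0" using sresD(5)[OF F(1) _ e(1), of 0] sresD(1)[OF F(1)] by simp
    also have "\<dots> = (\<Sum>q<?N1. ?C1 q e)" unfolding mv_def by (rule sum.cong) (use sresD(3)[OF F(1)] in auto)
    also have "\<dots> = (\<Sum>q\<in>{k i, k (hex_succ i)}. ?C1 q e)"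
      by (rule sum.mono_neutral_right) (use k(1)[OF i] k(1)[OF hex_succ_less[OF i]] z in auto)
    also have "\<dots> = ?C1 (k i) e + ?C1 (k (hex_succ i)) e" using ne by simp
    finally show ?thesis by (simp add: eq_neg_iff_add_eq_0 add.commute)
  qed
  define \<phi> where "\<phi> = (\<lambda>i v. \<Sum>e | e < ?N2 \<and> ?d2 e = E i. ?C1 (k i) e * v e)"
  have "\<exists>y. supp_in ?N2 ?d2 (E i) y \<and> (\<forall>c<?N1. (if c = k i then 1 else 0) - (if c = k (hex_succ i) then 1 else 0) = mv ?N2 ?C1 y c)"
    if i: "i < 6" for i
    by (rule unit_difference_cycle[OF F(1)]) (use k i hex_succ_less in \<open>auto simp: E_def\<close>)
  then have "\<forall>i. \<exists>y. i < 6 \<longrightarrow> supp_in ?N2 ?d2 (E i) y \<and>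
     (\<forall>c<?N1. (if c = k i then 1 else 0) - (if c = k (hex_succ i) then 1 else 0) = mv ?N2 ?C1 y c)" by simp
  then obtain y where y: "\<forall>i. i < 6 \<longrightarrow> supp_in ?N2 ?d2 (E i) (y i) \<and>
     (\<forall>c<?N1. (if c = k i then 1 else 0) - (if c = k (hex_succ i) then 1 else 0) = mv ?N2 ?C1 (y i) c)"
    by (rule choice[THEN exE])
  have y1: "?d2 e \<subseteq> E i" if "i < 6" "e < ?N2" "y i e \<noteq> 0" for i e
    using y that by (simp add: supp_in_def)
  have y2: "mv ?N2 ?C1 (y i) c = (if c = k i then 1 else 0) - (if c = k (hex_succ i) then 1 else 0)" if "i < 6" "c < ?N1" for i c
    using y that by simp
  \<comment> \<open>\<open>y 0\<close> passes edge 0 once. For other j the support of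
    \<open>y j\<close> lies inside \<open>E j\<close>, which does not contain
    \<open>E 0\<close>.\<close>
  have phi_y: "\<phi> 0 (y j) = (if j = 0 then 1 else 0)" if j: "j < 6" for j
  proof (cases "j = 0")
    case True
    have "\<phi> 0 (y 0) = (\<Sum>e<?N2. ?C1 (k 0) e * y 0 e)"
      unfolding \<phi>_def
    proof (rule sum.mono_neutral_left)
      show "\<forall>e\<in>{..<?N2} - {e. e < ?N2 \<and> ?d2 e = E 0}. ?C1 (k 0) e * y 0 e = 0"
      proof
        fix e assume e: "e \<in> {..<?N2} - {e. e < ?N2 \<and> ?d2 e = E 0}"
        show "?C1 (k 0) e * y 0 e = 0"
        proof (rule ccontr)
          assume "?C1 (k 0) e * y 0 e \<noteq> 0"
          then have nz: "?C1 (k 0) e \<noteq> 0" "y 0 e \<noteq> 0" by auto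
          have s: "?d2 e \<subseteq> E 0" using y1[of 0 e] e nz by auto
          then have "?d2 e \<subseteq> W" using EW[of 0] by auto
          then obtain j where j: "j < 6" "?d2 e = E j" using L1[of e 0] e nz by auto
          then show False using Esub[of j 0] s e by auto
        qed
      qed
    qed auto
    also have "\<dots> = mv ?N2 ?C1 (y 0) (k 0)" by (simp add: mv_def)
    also have "\<dots> = 1" using y2[of 0 "k 0"] k(1)[of 0] kinj[of 0 "hex_succ 0"] by (auto simp: hex_succ_def)
    finally show ?thesis using True by simp
  next
    case False
    have "\<phi> 0 (y j) = 0"
      unfolding \<phi>_def
    proof (rule sum.neutral, rule ballI)
      fix e assume e: "e \<in> {e. e < ?N2 \<and> ?d2 e = E 0}"
      show "?C1 (k 0) e * y j e = 0"
        using y1[OF j, of e] e Esub[of 0 j] j False by auto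
    qed
    then show ?thesis using False by simp
  qed
  define a where "a = (\<lambda>e. \<Sum>j<6. y j e)"
  have a0: "\<phi> 0 a = 1"
  proof -
    have "\<phi> 0 a = (\<Sum>j<6. \<phi> 0 (y j))"
      unfolding \<phi>_def a_def by (simp add: sum_distrib_left) (rule sum.swap)
    also have "\<dots> = 1" using phi_y by simp
    finally show ?thesis .
  qed
  have asupp: "supp_in ?N2 ?d2 W a"
    unfolding supp_in_def
  proof (intro allI impI)
    fix e assume e: "e < ?N2" "a e \<noteq> 0"
    then obtain j where "j < 6" "y j e \<noteq> 0" unfolding a_def by (meson lessThan_iff sum.not_neutral_contains_not_neutral)
    then show "?d2 e \<subseteq> W" using y1 e EW by blast
  qed
  have aker: "mv ?N2 ?C1 a c = 0" if c: "c < ?N1" for c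
  proof -
    have "mv ?N2 ?C1 a c = (\<Sum>j<6. mv ?N2 ?C1 (y j) c)" unfolding a_def by (rule mv_sum)
    also have "\<dots> = (\<Sum>j<6. (if c = k j then 1 else 0) - (if c = k (hex_succ j) then 1 else 0))"
      by (rule sum.cong) (use y2 c in auto)
    also have "\<dots> = 0" by (simp add: eval_nat_numeral hex_succ_def)
    finally show ?thesis .
  qed
  obtain b where b: "supp_in ?N3 ?d3 W b" "\<And>e. e < ?N2 \<Longrightarrow> a e = mv ?N3 ?C2 b e"
    using sres_exact[OF F(1) asupp aker] by blast
  have zero: "\<phi> 0 (\<lambda>e. ?C2 e f) = 0" if f: "f < ?N3" "?d3 f \<subseteq> W" for f
  proof -
    let ?v = "\<lambda>e. ?C2 e f"
    have vs: "?d2 e \<subseteq> ?d3 f" if "e < ?N2" "?v e \<noteq> 0" for e using sresD(4)[OF F(1) that(1) f(1) that(2)] .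
    have "card (?d3 f) \<le> d + 2" using F(3)[rule_format, OF f(1)] by simp
    then have "?d3 f \<noteq> W" using big by auto
    then obtain w where w: "w \<in> W" "w \<notin> ?d3 f" using f(2) by blast
    then obtain i0 where i0: "i0 < 6" "w \<in> E i0" using cover by (auto simp: E_def)
    have z0: "\<phi> i0 ?v = 0"
      unfolding \<phi>_def
    proof (rule sum.neutral, rule ballI)
      fix e assume "e \<in> {e. e < ?N2 \<and> ?d2 e = E i0}"
      then show "?C1 (k i0) e * ?v e = 0" using vs[of e] i0 w by auto
    qed
    \<comment> \<open>Row \<open>hex_succ i\<close> of the vanishing product meets only columns of
      the two edges at that vertex, and by \<open>opp\<close> their sums are
      \<open>\<phi> (hex_succ i)\<close> and minus \<open>\<phi> i\<close>.\<close>
    have step: "\<phi> (hex_succ i) ?v = \<phi> i ?v" if i: "i < 6" for i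
    proof -
      note si = hex_succ_less[OF i]
      let ?A = "\<lambda>i. {e. e < ?N2 \<and> ?d2 e = E i}"
      have "0 = (\<Sum>e<?N2. ?C1 (k (hex_succ i)) e * ?v e)"
        using sresD(5)[OF F(1) k(1)[OF si] f(1)] by (simp add: mv_def)
      also have "\<dots> = (\<Sum>e\<in>?A (hex_succ i) \<union> ?A i. ?C1 (k (hex_succ i)) e * ?v e)"
      proof (rule sum.mono_neutral_right)
        show "\<forall>e\<in>{..<?N2} - (?A (hex_succ i) \<union> ?A i). ?C1 (k (hex_succ i)) e * ?v e = 0"
        proof
          fix e assume e: "e \<in> {..<?N2} - (?A (hex_succ i) \<union> ?A i)"
          show "?C1 (k (hex_succ i)) e * ?v e = 0"
          proof (rule ccontr)
            assume "?C1 (k (hex_succ i)) e * ?v e \<noteq> 0"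
            then have nz: "?C1 (k (hex_succ i)) e \<noteq> 0" "?v e \<noteq> 0" by auto
            then have "?d2 e \<subseteq> W" using vs[of e] e f(2) by auto
            then obtain j where "j < 6" "hex_succ i = hex_succ j" "?d2 e = E j"
              using L1[OF _ si nz(1)] e by auto
            then show False using hex_succ_inj[OF i] e by auto
          qed
        qed
      qed auto
      also have "\<dots> = (\<Sum>e\<in>?A (hex_succ i). ?C1 (k (hex_succ i)) e * ?v e) + (\<Sum>e\<in>?A i. ?C1 (k (hex_succ i)) e * ?v e)"
        by (rule sum.union_disjoint) (use Esub[OF i si] hex_succ_neq[of i] in auto)
      also have "(\<Sum>e\<in>?A i. ?C1 (k (hex_succ i)) e * ?v e) = (\<Sum>e\<in>?A i. - (?C1 (k i) e * ?v e))"
        by (rule sum.cong) (use opp i in auto)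
      finally show ?thesis by (simp add: \<phi>_def sum_negf)
    qed
    have "\<phi> i ?v = \<phi> 0 ?v" if "i < 6" for i
      using step[of 0] step[of 1] step[of 2] step[of 3] step[of 4] that
      by (auto simp: hex_succ_def eval_nat_numeral less_Suc_eq)
    then show ?thesis using z0 i0 by metis
  qed
  have "\<phi> 0 a = (\<Sum>e | e < ?N2 \<and> ?d2 e = E 0. \<Sum>f<?N3. b f * (?C1 (k 0) e * ?C2 e f))"
    unfolding \<phi>_def by (rule sum.cong) (auto simp: b(2) mv_def sum_distrib_left ac_simps)
  also have "\<dots> = (\<Sum>f<?N3. b f * \<phi> 0 (\<lambda>e. ?C2 e f))"
    unfolding \<phi>_def by (subst sum.swap) (simp add: sum_distrib_left)
  also have "\<dots> = 0"
  proof (rule sum.neutral, rule ballI)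
    fix f assume "f \<in> {..<?N3}"
    then show "b f * \<phi> 0 (\<lambda>e. ?C2 e f) = 0" using zero[of f] b(1) by (auto simp: supp_in_def)
  qed
  finally show False using a0 by simp
qed

section \<open>Paths in trees\<close>

text \<open>A tree on the whole vertex type. \<open>acyclic\<close> asks for three vertices because
  the two ends of a single edge are adjacent without forming a cycle.\<close>

locale utree =
  fixes E :: "'a \<Rightarrow> 'a \<Rightarrow> bool"
  assumes sym: "E u v \<Longrightarrow> E v u"
    and irrefl: "\<not> E v v"
    and conn: "E\<^sup>*\<^sup>* u v"
    and acyclic: "distinct p \<Longrightarrow> successively E p \<Longrightarrow> 3 \<le> length p \<Longrightarrow> \<not> E (last p) (hd p)"
begin

definition gp :: "'a list \<Rightarrow> bool" where
  "gp p \<longleftrightarrow> p \<noteq> [] \<and> distinct p \<and> successively E p"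

lemma gp_single [simp]: "gp [v]"
  by (simp add: gp_def)

lemma gp_edge: "E u v \<Longrightarrow> gp [u, v]"
  using irrefl by (auto simp: gp_def)

lemma gp_rev: "gp (rev p) \<longleftrightarrow> gp p"
proof -
  have eq: "(\<lambda>x y. E y x) = E" using sym by (auto simp: fun_eq_iff)
  have "successively E (rev p) \<longleftrightarrow> successively E p" unfolding successively_rev by (subst eq) rule
  then show ?thesis by (simp add: gp_def)
qed

lemma gp_appendD1: "gp (p @ q) \<Longrightarrow> p \<noteq> [] \<Longrightarrow> gp p"
  and gp_appendD2: "gp (p @ q) \<Longrightarrow> q \<noteq> [] \<Longrightarrow> gp q"
  by (auto simp: gp_def successively_append_iff)

lemma gp_take: "gp p \<Longrightarrow> 0 < k \<Longrightarrow> gp (take k p)"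
  using gp_appendD1[of "take k p" "drop k p"] by (auto simp: gp_def)

lemma gp_drop: "gp p \<Longrightarrow> k < length p \<Longrightarrow> gp (drop k p)"
  using gp_appendD2[of "take k p" "drop k p"] by (auto simp: gp_def)

lemma gp_nth_edge: "gp p \<Longrightarrow> Suc i < length p \<Longrightarrow> E (p ! i) (p ! Suc i)"
  by (auto simp: gp_def successively_conv_nth)

lemma gp_nth_eq: "gp p \<Longrightarrow> i < length p \<Longrightarrow> j < length p \<Longrightarrow> p ! i = p ! j \<longleftrightarrow> i = j"
  by (auto simp: gp_def nth_eq_iff_index_eq)

text \<open>A local test for extending a path: if \<open>u\<close> occurred beyond the second vertex
  of \<open>q\<close>, the edge from \<open>u\<close> to \<open>hd q\<close> would close a
  cycle.\<close>

lemma gp_Cons: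
  assumes q: "gp q" and u: "E u (hd q)" "1 < length q \<Longrightarrow> u \<noteq> q ! 1"
  shows "gp (u # q)"
proof -
  have "u \<notin> set q"
  proof
    assume "u \<in> set q"
    then obtain m where m: "m < length q" "u = q ! m" by (auto simp: in_set_conv_nth)
    have "q \<noteq> []" using q by (simp add: gp_def)
    have "m \<noteq> 0"
    proof
      assume "m = 0"
      then have "u = hd q" using m(2) \<open>q \<noteq> []\<close> by (simp add: hd_conv_nth)
      then show False using u(1) irrefl by simp
    qed
    moreover have "m \<noteq> 1" using u(2) m by auto
    ultimately have "3 \<le> length (take (Suc m) q)" using m by simp
    moreover have "distinct (take (Suc m) q)" "successively E (take (Suc m) q)"
      using gp_take[OF q, of "Suc m"] by (auto simp: gp_def)
    moreover have "last (take (Suc m) q) = u" "hd (take (Suc m) q) = hd q"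
      using m by (auto simp: take_Suc_conv_app_nth hd_append hd_conv_nth)
    ultimately show False using acyclic u(1) by metis
  qed
  then show ?thesis using q u(1) by (cases q) (auto simp: gp_def)
qed

lemma gp_snoc:
  assumes "gp q" "E u (last q)" "1 < length q \<Longrightarrow> u \<noteq> q ! (length q - 2)"
  shows "gp (q @ [u])"
proof -
  have "gp (u # rev q)"
  proof (rule gp_Cons)
    show "gp (rev q)" using assms(1) by (simp add: gp_rev)
    show "E u (hd (rev q))" using assms(1,2) by (simp add: hd_rev gp_def)
    show "u \<noteq> rev q ! 1" if "1 < length (rev q)" using assms(3) that by (simp add: rev_nth numeral_2_eq_2)
  qed
  then have "gp (rev (u # rev q))" by (simp only: gp_rev)
  then show ?thesis by simp
qed

text \<open>In a tree a walk without backtracking is a path.\<close>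

lemma gp_join:
  assumes "gp (c # p)" "gp (c # q)" "p \<noteq> [] \<Longrightarrow> q \<noteq> [] \<Longrightarrow> hd p \<noteq> hd q"
  shows "gp (rev p @ c # q)"
  using assms
proof (induction p rule: rev_induct)
  case (snoc x p)
  have p: "gp (c # p)" using snoc.prems(1) gp_appendD1[of "c # p" "[x]"] by simp
  have IH: "gp (rev p @ c # q)"
  proof (rule snoc.IH[OF p snoc.prems(2)])
    assume "p \<noteq> []" "q \<noteq> []"
    then show "hd p \<noteq> hd q" using snoc.prems(3) by (cases p) auto
  qed
  have "gp ((c # p) @ [x])" using snoc.prems(1) by simp
  then have "E (last (c # p)) x" by (simp add: gp_def successively_append_iff del: append_Cons last.simps)
  then have e: "E x (hd (rev p @ c # q))" by (cases p rule: rev_cases) (auto intro: sym)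
  have "x \<noteq> (rev p @ c # q) ! 1" if "1 < length (rev p @ c # q)"
  proof (cases p rule: rev_cases)
    case Nil
    then show ?thesis using that snoc.prems(3) by (cases q) auto
  next
    case (snoc p' y)
    have "(rev p @ c # q) ! 1 = (rev p' @ c # q) ! 0" using snoc by simp
    also have "\<dots> = hd (rev p' @ [c])" by (cases p' rule: rev_cases) auto
    finally show ?thesis using \<open>gp (c # p @ [x])\<close> snoc by (cases p' rule: rev_cases) (auto simp: gp_def)
  qed
  then have "gp (x # rev p @ c # q)" by (intro gp_Cons IH e)
  then show ?case by simp
qed simp

text \<open>Common initial vertices are removed. Where the paths part, joining the two remainders at
  the last common vertex would give a path that visits the common end twice.\<close>

lemma gp_unique:
  "gp p \<Longrightarrow> gp q \<Longrightarrow> hd p = hd q \<Longrightarrow> last p = last q \<Longrightarrow> p = q"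
proof (induction p arbitrary: q)
  case (Cons u p)
  then obtain q' where q: "q = u # q'" by (cases q) (auto simp: gp_def)
  show ?case
  proof (cases "p = [] \<or> q' = []")
    case True
    then show ?thesis using Cons.prems q by (auto simp: gp_def split: if_splits)
  next
    case False
    show ?thesis
    proof (cases "hd p = hd q'")
      case True
      have "gp p" "gp q'" using Cons.prems q False gp_appendD2[of "[u]"] by auto
      then have "p = q'" using Cons.IH[of q'] Cons.prems False True q by auto
      then show ?thesis using q by simp
    next
      case ne: False
      then have "gp (rev p @ u # q')" using gp_join[of u p q'] Cons.prems q by auto
      moreover have "last p \<in> set p" "last p \<in> set q'" using False Cons.prems q by (auto) (metis last_in_set)
      ultimately show ?thesis by (auto simp: gp_def)
    qed
  qed
qed (simp add: gp_def)

lemma gp_exists: "\<exists>p. gp p \<and> hd p = u \<and> last p = v"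
  using conn[of u v]
proof (induction rule: rtranclp_induct)
  case base
  show ?case by (rule exI[of _ "[u]"]) simp
next
  case (step v w)
  then obtain p where p: "gp p" "hd p = u" "last p = v" by auto
  have ne: "p \<noteq> []" using p(1) by (simp add: gp_def)
  show ?case
  proof (cases "w \<in> set p")
    case True
    then obtain p1 p2 where s: "p = p1 @ w # p2" by (auto simp: in_set_conv_decomp)
    have "gp (p1 @ [w])" using p(1) s gp_appendD1[of "p1 @ [w]" p2] by simp
    moreover have "hd (p1 @ [w]) = u" using p(2) s by (cases p1) auto
    ultimately show ?thesis by (intro exI[of _ "p1 @ [w]"]) simp
  next
    case False
    then have "gp (p @ [w])" using p step(2) by (auto simp: gp_def successively_append_iff)
    then show ?thesis using p ne by (intro exI[of _ "p @ [w]"]) simp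
  qed
qed

text \<open>A chord and the piece of the path between its ends are two paths with the same ends,
  hence equal.\<close>

lemma gp_no_chord:
  assumes "gp p" "i < length p" "j < length p" "E (p ! i) (p ! j)" "i < j"
  shows "j = Suc i"
proof -
  let ?q = "drop i (take (Suc j) p)"
  have l: "length ?q = Suc j - i" using assms by simp
  have q: "gp ?q" using assms by (intro gp_drop gp_take) auto
  have "hd ?q = p ! i" using assms by (simp add: hd_drop_conv_nth)
  moreover have "last ?q = p ! j" using assms l by (simp add: last_conv_nth)
  ultimately have "?q = [p ! i, p ! j]" using gp_unique[OF q gp_edge[OF assms(4)]] by simp
  then have "length ?q = 2" by simp
  then show ?thesis using l by simp
qed

lemma gp_adjacent_iff:
  assumes "gp p" "i < length p" "j < length p"
  shows "E (p ! i) (p ! j) \<longleftrightarrow> j = Suc i \<or> i = Suc j"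
proof
  assume e: "E (p ! i) (p ! j)"
  consider "i < j" | "j < i" | "i = j" by linarith
  then show "j = Suc i \<or> i = Suc j"
    by cases (use gp_no_chord[OF assms e] gp_no_chord[OF assms(1,3,2) sym[OF e]] e irrefl in auto)
next
  assume "j = Suc i \<or> i = Suc j"
  then show "E (p ! i) (p ! j)"
    using gp_nth_edge[OF assms(1), of i] gp_nth_edge[OF assms(1), of j] assms by (auto intro: sym)
qed

lemma not_adjacent_far:
  assumes "gp p" "3 \<le> length p"
  shows "hd p \<noteq> last p" "\<not> E (hd p) (last p)"
  using assms gp_nth_eq[OF assms(1), of 0 "length p - 1"] gp_adjacent_iff[OF assms(1), of 0 "length p - 1"]
  by (auto simp: hd_conv_nth last_conv_nth gp_def)

lemma gp_degree_le_2:
  assumes p: "gp p" and v: "c \<in> set p" "x \<in> set p" "y \<in> set p" "z \<in> set p"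
    and e: "E c x" "E c y" "E c z" and d: "x \<noteq> y" "y \<noteq> z" "x \<noteq> z"
  shows False
proof -
  obtain i j k l where i: "i < length p" "c = p ! i" "j < length p" "x = p ! j"
    "k < length p" "y = p ! k" "l < length p" "z = p ! l"
    using v by (auto simp: in_set_conv_nth)
  have "j = Suc i \<or> i = Suc j" "k = Suc i \<or> i = Suc k" "l = Suc i \<or> i = Suc l"
    using e i gp_adjacent_iff[OF p] by auto
  moreover have "j \<noteq> k" "k \<noteq> l" "j \<noteq> l" using d i by auto
  ultimately show False by linarith
qed

lemma gp_crossing_edge:
  assumes "gp p" "x \<in> set p" "x \<in> A" "y \<in> set p" "y \<notin> A"
  shows "\<exists>u\<in>set p. \<exists>v\<in>set p. u \<in> A \<and> v \<notin> A \<and> E u v"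
proof (rule ccontr)
  assume n: "\<not> ?thesis"
  have step: "p ! Suc i \<in> A \<longleftrightarrow> p ! i \<in> A" if "Suc i < length p" for i
    using n gp_nth_edge[OF assms(1) that] that sym by (meson Suc_lessD nth_mem)
  have "p ! i \<in> A \<longleftrightarrow> p ! 0 \<in> A" if "i < length p" for i
    using that by (induction i) (auto simp: step)
  then show False using assms by (metis in_set_conv_nth)
qed

text \<open>Three paths leaving \<open>c\<close> by different edges; by \<open>gp_join\<close> any
  two of them form one path through \<open>c\<close>.\<close>

definition arms :: "'a \<Rightarrow> 'a list \<Rightarrow> 'a list \<Rightarrow> 'a list \<Rightarrow> bool" where
  "arms c p q r \<longleftrightarrow> gp (c # p) \<and> gp (c # q) \<and> gp (c # r) \<and> p \<noteq> [] \<and> q \<noteq> [] \<and> r \<noteq> [] \<and>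
     hd p \<noteq> hd q \<and> hd q \<noteq> hd r \<and> hd p \<noteq> hd r"

lemma arms_take:
  assumes "arms c p q r" "0 < i" "0 < j" "0 < k"
  shows "arms c (take i p) (take j q) (take k r)"
proof -
  have "gp (c # take l s)" if "gp (c # s)" for l s
    using gp_take[OF that, of "Suc l"] by simp
  then show ?thesis using assms by (auto simp: arms_def)
qed

end

section \<open>Ordering the paths along a longest path\<close>

text \<open>Sorting by \<open>\<kappa>\<close> gives linear quotients: an earlier \<open>m'\<close>
  can be traded for some earlier \<open>m''\<close> that adds to \<open>m\<close> a single vertex of
  \<open>m'\<close>. Equal keys are included in the hypothesis because sorting may put either of two
  such sets first.\<close>

lemma linear_order_of_key:
  fixes \<kappa> :: "'a::finite set \<Rightarrow> nat" and \<G> :: "'a::finite set set"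
  assumes exch: "\<And>m m'. m \<in> \<G> \<Longrightarrow> m' \<in> \<G> \<Longrightarrow> m \<noteq> m' \<Longrightarrow> \<kappa> m' \<le> \<kappa> m \<Longrightarrow>
     \<exists>m''\<in>\<G>. \<kappa> m'' < \<kappa> m \<and> (\<exists>x\<in>m'. m'' - m = {x})"
  shows "\<exists>ms. distinct ms \<and> set ms = \<G> \<and>
      (\<forall>k<length ms. \<exists>A. \<forall>W. (\<exists>j<k. ms ! j \<subseteq> W \<union> ms ! k) \<longleftrightarrow> W \<inter> A \<noteq> {})"
proof -
  obtain ls where ls: "set ls = \<G>" "distinct ls"
    using finite_distinct_list[OF finite[of \<G>]] by (elim exE conjE) (rule that)
  define ms where "ms = sort_key \<kappa> ls"
  have ms: "set ms = \<G>" "distinct ms" "sorted (map \<kappa> ms)" using ls by (auto simp: ms_def)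
  have mono: "\<kappa> (ms ! j) \<le> \<kappa> (ms ! k)" if "j \<le> k" "k < length ms" for j k
    using sorted_nth_mono[OF ms(3), of j k] that by simp
  \<comment> \<open>The colon is generated by those vertices that some earlier set adds as its only
    new vertex.\<close>
  have "\<exists>A. \<forall>W. (\<exists>j<k. ms ! j \<subseteq> W \<union> ms ! k) \<longleftrightarrow> W \<inter> A \<noteq> {}" if k: "k < length ms" for k
  proof (rule exI[of _ "{x. \<exists>j<k. ms ! j - ms ! k = {x}}"], intro allI iffI)
    fix W
    assume "\<exists>j<k. ms ! j \<subseteq> W \<union> ms ! k"
    then obtain j where j: "j < k" "ms ! j \<subseteq> W \<union> ms ! k" by blast
    have "ms ! k \<in> \<G>" "ms ! j \<in> \<G>" "ms ! k \<noteq> ms ! j" "\<kappa> (ms ! j) \<le> \<kappa> (ms ! k)"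
      using ms(1,2) j(1) k mono by (auto simp: nth_eq_iff_index_eq)
    from exch[OF this] obtain m x where m: "m \<in> \<G>" "\<kappa> m < \<kappa> (ms ! k)" "x \<in> ms ! j" "m - ms ! k = {x}" by blast
    obtain l where l: "l < length ms" "m = ms ! l" using m(1) ms(1) by (metis in_set_conv_nth)
    have "l < k" using mono[of k l] l m(2) by force
    then have "x \<in> W \<inter> {x. \<exists>j<k. ms ! j - ms ! k = {x}}" using m j l by auto
    then show "W \<inter> {x. \<exists>j<k. ms ! j - ms ! k = {x}} \<noteq> {}" by blast
  next
    fix W assume "W \<inter> {x. \<exists>j<k. ms ! j - ms ! k = {x}} \<noteq> {}"
    then obtain x j where x: "x \<in> W" "j < k" "ms ! j - ms ! k = {x}" by blast
    then have "ms ! j \<subseteq> W \<union> ms ! k" by auto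
    then show "\<exists>j<k. ms ! j \<subseteq> W \<union> ms ! k" using x(2) by blast
  qed
  then show ?thesis using ms by blast
qed

locale longest_path_tree = utree E for E :: "'a::finite \<Rightarrow> 'a \<Rightarrow> bool" +
  fixes n :: nat and D :: "'a list"
  assumes n4: "4 \<le> n"
    and D: "gp D"
    and longest: "gp p \<Longrightarrow> length p \<le> length D"
    and no_spider: "arms c p q r \<Longrightarrow> 2 \<le> length p \<Longrightarrow> 2 \<le> length q \<Longrightarrow> 2 \<le> length r \<Longrightarrow>
       length p \<le> length q \<Longrightarrow> n - 1 \<le> length p + length r \<Longrightarrow> False"
    and no_two_paths: "gp p \<Longrightarrow> gp q \<Longrightarrow> length p = n \<Longrightarrow> length q = n \<Longrightarrow> \<exists>u\<in>set p. \<exists>v\<in>set q. u = v \<or> E u v"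
begin

lemma left_arm: "s < length D \<Longrightarrow> gp (D ! s # rev (take s D))"
  using gp_take[OF D, of "Suc s"] gp_rev[of "take (Suc s) D"] by (simp add: take_Suc_conv_app_nth)

lemma right_arm: "s < length D \<Longrightarrow> gp (D ! s # drop (Suc s) D)"
  using gp_drop[OF D, of s] by (simp add: Cons_nth_drop_Suc)

lemma hd_left_arm: "0 < s \<Longrightarrow> s < length D \<Longrightarrow> hd (rev (take s D)) = D ! (s - 1)"
  by (subst hd_rev, subst last_conv_nth) auto

lemma hd_right_arm: "Suc s < length D \<Longrightarrow> hd (drop (Suc s) D) = D ! Suc s"
  by (simp add: hd_drop_conv_nth)

text \<open>A branch longer than one side of \<open>D\<close> at \<open>D ! s\<close> could replace
  that side and make a path longer than \<open>D\<close>.\<close>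

lemma off_arm_bound:
  assumes s: "s < length D" and A: "gp (D ! s # A)" "A \<noteq> []" "hd A \<notin> set D"
  shows "length A \<le> s" "s + length A < length D"
proof -
  have "gp (rev A @ D ! s # rev (take s D))"
  proof (rule gp_join[OF A(1) left_arm[OF s]])
    assume "rev (take s D) \<noteq> []"
    then have "hd (rev (take s D)) \<in> set (rev (take s D))" by (rule hd_in_set)
    then show "hd A \<noteq> hd (rev (take s D))" using A(3) by (auto dest: in_set_takeD)
  qed
  from longest[OF this] show "s + length A < length D" using s by simp
  have "gp (rev A @ D ! s # drop (Suc s) D)"
  proof (rule gp_join[OF A(1) right_arm[OF s]])
    assume "drop (Suc s) D \<noteq> []"
    then have "hd (drop (Suc s) D) \<in> set (drop (Suc s) D)" by (rule hd_in_set)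
    then show "hd A \<noteq> hd (drop (Suc s) D)" using A(3) by (auto dest: in_set_dropD)
  qed
  from longest[OF this] show "length A \<le> s" using s by simp
qed

lemma off_arm_arms:
  assumes s: "s < length D" and A: "gp (D ! s # A)" "A \<noteq> []" "hd A \<notin> set D"
  shows "arms (D ! s) A (rev (take s D)) (drop (Suc s) D)"
proof -
  note b = off_arm_bound[OF assms]
  have l: "0 < length A" using A(2) by simp
  have 1: "0 < s" "Suc s < length D" using b l by linarith+
  then have "D ! (s - 1) \<noteq> D ! Suc s" using gp_nth_eq[OF D, of "s - 1" "Suc s"] by auto
  moreover have "D ! (s - 1) \<in> set D" "D ! Suc s \<in> set D" using 1 by auto
  ultimately show ?thesis
    unfolding arms_def using left_arm[OF s] right_arm[OF s] A 1 by (auto simp: hd_left_arm hd_right_arm)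
qed

text \<open>A branch \<open>A\<close> of length at least 2 forms three arms with the two sides of
  \<open>D\<close>, both at least as long as \<open>A\<close>. Maximality of \<open>D\<close> bounds
  \<open>R\<close> by one of the sides; this side and \<open>A\<close> together have length at least
  n - 1, which \<open>no_spider\<close> forbids.\<close>

lemma off_arm_short:
  assumes s: "s < length D" and P: "gp (rev A @ D ! s # R)" "length A + Suc (length R) = n"
    and A: "A \<noteq> [] \<Longrightarrow> hd A \<notin> set D"
  shows "length A \<le> 1"
proof (rule ccontr)
  assume "\<not> length A \<le> 1"
  then have A2: "2 \<le> length A" "A \<noteq> []" by auto
  let ?l = "rev (take s D)" and ?r = "drop (Suc s) D"
  have gR: "gp (D ! s # R)" using gp_appendD2[OF P(1)] by simp
  have gA: "gp (D ! s # A)"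
  proof -
    have "gp (rev A @ [D ! s])" using gp_appendD1[of "rev A @ [D ! s]" R] P(1) by simp
    then have "gp (rev (rev A @ [D ! s]))" by (simp only: gp_rev)
    then show ?thesis by simp
  qed
  note b = off_arm_bound[OF s gA A2(2) A[OF A2(2)]]
  have ar: "arms (D ! s) A ?l ?r" using off_arm_arms[OF s gA A2(2) A[OF A2(2)]] .
  have len: "length ?l = s" "length ?r = length D - Suc s" using s by auto
  \<comment> \<open>\<open>R\<close> leaves \<open>D ! s\<close> along at most one side of
    \<open>D\<close>, so it can be joined to the other side, and the joined path is no longer than
    \<open>D\<close>.\<close>
  have "length R \<le> s \<or> length R \<le> length D - Suc s"
  proof (cases "R = []")
    case False
    show ?thesis
    proof (cases "hd R = D ! (s - 1)")
      case False
      have "gp (rev R @ D ! s # ?l)"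
        by (rule gp_join[OF gR left_arm[OF s]]) (use False b A2 s hd_left_arm[of s] in auto)
      from longest[OF this] have "length R + s < length D" using s by simp
      then show ?thesis by linarith
    next
      case True
      have "gp (rev R @ D ! s # ?r)"
      proof (rule gp_join[OF gR right_arm[OF s]])
        show "hd R \<noteq> hd ?r" using True b A2 gp_nth_eq[OF D, of "s - 1" "Suc s"] by (simp add: hd_right_arm)
      qed
      from longest[OF this] have "length R \<le> s" using s by simp
      then show ?thesis ..
    qed
  qed simp
  then show False
  proof
    assume R: "length R \<le> s"
    have ar': "arms (D ! s) A ?r ?l" using ar by (auto simp: arms_def)
    show False
      by (rule no_spider[OF ar']) (unfold len, insert R A2 b P(2), linarith+)
  next
    assume R: "length R \<le> length D - Suc s"
    show False
      by (rule no_spider[OF ar]) (unfold len, insert R A2 b P(2), linarith+)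
  qed
qed

text \<open>If \<open>P\<close> missed \<open>D\<close>, a connection from \<open>D\<close> to
  \<open>P\<close> followed by the longer part of \<open>P\<close> would be a branch of length at
  least half of n - 1. Both sides of \<open>D\<close> are at least as long, so the three are arms
  excluded by \<open>no_spider\<close>.\<close>

lemma path_meets_longest:
  assumes P: "gp P" "length P = n"
  shows "set P \<inter> set D \<noteq> {}"
proof
  assume dis: "set P \<inter> set D = {}"
  have ne: "P \<noteq> []" "D \<noteq> []" using P D by (auto simp: gp_def)
  obtain Z where Z: "gp Z" "hd Z = hd D" "last Z = hd P" using gp_exists by blast
  have Zne: "Z \<noteq> []" using Z(1) by (simp add: gp_def)
  have "\<exists>x\<in>set Z. x \<in> set D" using Z(2) Zne ne by (metis hd_in_set)
  \<comment> \<open>\<open>c\<close> is the last vertex of the connection on \<open>D\<close>, and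
    \<open>w\<close> below is the first one after it on \<open>P\<close>, so the piece between them
    avoids both paths.\<close>
  then obtain Z1 c Z2 where z: "Z = Z1 @ c # Z2" "c \<in> set D" "\<forall>x\<in>set Z2. x \<notin> set D"
    by (rule split_list_last_propE)
  have "Z2 \<noteq> []" using z Z(3) dis ne by (metis disjoint_iff hd_in_set last_snoc)
  then have "\<exists>x\<in>set Z2. x \<in> set P" using z Z(3) ne by (metis last_ConsR last_appendR last_in_set hd_in_set list.distinct(1))
  then obtain Q w Z3 where q: "Z2 = Q @ w # Z3" "w \<in> set P" "\<forall>x\<in>set Q. x \<notin> set P"
    by (rule split_list_first_propE)
  obtain P1 P2 where p: "P = P1 @ w # P2" using q(2) by (auto simp: in_set_conv_decomp)
  define B where "B = (if length P1 \<le> length P2 then P2 else rev P1)"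
  have Blen: "n - 1 \<le> 2 * length B" using P(2) p by (auto simp: B_def)
  have gB: "gp (w # B)"
  proof -
    have "gp (w # P2)" using gp_appendD2[of P1 "w # P2"] P(1) p by simp
    moreover have "gp (rev (P1 @ [w]))" using gp_appendD1[of "P1 @ [w]" P2] P(1) p by (simp only: gp_rev) simp
    ultimately show ?thesis by (simp add: B_def)
  qed
  have BP: "set B \<subseteq> set P" using p by (auto simp: B_def)
  have "gp (c # Q @ [w])"
  proof -
    have "gp ((c # Q @ [w]) @ Z3)" using gp_appendD2[of Z1 "c # Z2"] Z(1) z q by simp
    then show ?thesis by (rule gp_appendD1) simp
  qed
  then have "gp (rev (c # Q @ [w]))" by (simp only: gp_rev)
  then have "gp (w # rev Q @ [c])" by simp
  then have "gp (rev (rev Q @ [c]) @ w # B)"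
  proof (rule gp_join[OF _ gB])
    assume "B \<noteq> []"
    then have "hd B \<in> set P" using BP by auto
    moreover have "hd (rev Q @ [c]) \<notin> set P" using q(3) z(2) dis by (cases Q rule: rev_cases) auto
    ultimately show "hd (rev Q @ [c]) \<noteq> hd B" by auto
  qed
  then have gA: "gp (c # Q @ w # B)" by simp
  obtain s where s: "s < length D" "c = D ! s" using z(2) by (auto simp: in_set_conv_nth)
  let ?A = "Q @ w # B"
  have hA: "hd ?A \<notin> set D" using z(3) q(1) by (cases Q) auto
  note b = off_arm_bound[OF s(1), of ?A] and ar = off_arm_arms[OF s(1), of ?A]
  have b': "length ?A \<le> s" "s + length ?A < length D" using b gA hA s(2) by auto
  have A: "3 \<le> length ?A" "n - 1 \<le> length ?A + length ?A" using Blen n4 by auto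
  have ar': "arms (D ! s) ?A (rev (take s D)) (drop (Suc s) D)" using ar gA hA s(2) by simp
  have len: "length (rev (take s D)) = s" "length (drop (Suc s) D) = length D - Suc s" using s(1) by auto
  show False
    by (rule no_spider[OF ar']) (unfold len, insert A b', linarith+)
qed

text \<open>Encodes the path a, D ! i, ..., D ! (i + n - 3), b. The inequations exclude
  backtracking; either end may still be the adjacent vertex of \<open>D\<close> outside this range,
  which exists by the bounds on \<open>i\<close>.\<close>

definition valid :: "nat \<Rightarrow> 'a \<Rightarrow> 'a \<Rightarrow> bool" where
  "valid i a b \<longleftrightarrow> 1 \<le> i \<and> i + n - 2 < length D \<and> E a (D ! i) \<and> a \<noteq> D ! Suc i \<and>
     E b (D ! (i + n - 3)) \<and> b \<noteq> D ! (i + n - 4)"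

definition tset :: "nat \<Rightarrow> 'a \<Rightarrow> 'a \<Rightarrow> 'a set" where
  "tset i a b = {a, b} \<union> (!) D ` {i..i + n - 3}"

definition seg :: "nat \<Rightarrow> nat \<Rightarrow> 'a list" where
  "seg j k = take (Suc k - j) (drop j D)"

lemma seg:
  assumes "j \<le> k" "k < length D"
  shows "gp (seg j k)" "length (seg j k) = Suc k - j" "set (seg j k) = (!) D ` {j..k}"
    "hd (seg j k) = D ! j" "last (seg j k) = D ! k" "\<And>l. l \<le> k - j \<Longrightarrow> seg j k ! l = D ! (j + l)"
proof -
  show g: "gp (seg j k)" unfolding seg_def by (intro gp_take gp_drop D) (use assms in auto)
  show l: "length (seg j k) = Suc k - j" using assms by (simp add: seg_def)
  show n: "seg j k ! l = D ! (j + l)" if "l \<le> k - j" for l using assms that by (simp add: seg_def)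
  show "hd (seg j k) = D ! j" using n[of 0] l assms g by (simp add: hd_conv_nth gp_def)
  show "last (seg j k) = D ! k" using n[of "k - j"] l assms g by (simp add: last_conv_nth gp_def Suc_diff_le)
  show "set (seg j k) = (!) D ` {j..k}"
  proof -
    have "set (seg j k) = (\<lambda>l. seg j k ! l) ` {..<Suc k - j}" by (simp add: set_conv_nth l image_def lessThan_def) blast
    also have "\<dots> = (\<lambda>l. D ! (j + l)) ` {..<Suc k - j}" by (rule image_cong) (use n assms in auto)
    also have "\<dots> = (!) D ` ((+) j ` {..<Suc k - j})" by (simp add: image_image)
    also have "(+) j ` {..<Suc k - j} = {j..k}"
    proof -
      have "x \<in> (+) j ` {..<Suc k - j}" if "x \<in> {j..k}" for x
        by (rule image_eqI[of _ _ "x - j"]) (use that in auto)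
      then show ?thesis by auto
    qed
    finally show ?thesis .
  qed
qed

lemma gp_extend_seg:
  assumes jk: "j < k" "k < length D" and a: "E a (D ! j)" "a \<noteq> D ! Suc j" and b: "E b (D ! k)" "b \<noteq> D ! (k - 1)"
  shows "gp (a # seg j k @ [b])"
proof -
  note s = seg[OF less_imp_le[OF jk(1)] jk(2)]
  have ne: "seg j k \<noteq> []" using s(1) by (simp add: gp_def)
  have "gp (seg j k @ [b])"
  proof (rule gp_snoc[OF s(1)])
    show "E b (last (seg j k))" using b s(5) by simp
    show "b \<noteq> seg j k ! (length (seg j k) - 2)" using s(6)[of "k - j - 1"] s(2) b jk by (simp add: Suc_diff_le)
  qed
  then show ?thesis
  proof (rule gp_Cons)
    show "E a (hd (seg j k @ [b]))" using a s(4) ne by simp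
    have "1 < length (seg j k)" using s(2) jk by simp
    then show "a \<noteq> (seg j k @ [b]) ! 1" using s(6)[of 1] a jk by (simp add: nth_append)
  qed
qed

lemma valid_path:
  assumes "valid i a b"
  shows "gp (a # seg i (i + n - 3) @ [b])" "set (a # seg i (i + n - 3) @ [b]) = tset i a b"
    "length (a # seg i (i + n - 3) @ [b]) = n"
proof -
  have 1: "i < i + n - 3" "i + n - 3 < length D" using assms n4 by (auto simp: valid_def)
  have 2: "i + n - 3 - 1 = i + n - 4" by simp
  show "gp (a # seg i (i + n - 3) @ [b])"
    by (rule gp_extend_seg[OF 1]) (use assms in \<open>auto simp: valid_def 2\<close>)
  show "set (a # seg i (i + n - 3) @ [b]) = tset i a b"
    using seg(3)[OF less_imp_le[OF 1(1)] 1(2)] by (auto simp: tset_def)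
  show "length (a # seg i (i + n - 3) @ [b]) = n"
    using seg(2)[OF less_imp_le[OF 1(1)] 1(2)] n4 by simp
qed

text \<open>\<open>p\<close> and \<open>q\<close> count the vertices of \<open>P\<close> off
  \<open>D\<close> at its two ends; \<open>s\<close> and \<open>t\<close> are the positions on
  \<open>D\<close> of its first and last vertex there.\<close>

lemma path_structure_aux:
  assumes P: "gp P" "length P = n" and p: "p \<le> 1" "q \<le> 1"
    and st: "s < t" "t < length D" "P ! p = D ! s" "P ! (n - 1 - q) = D ! t"
    and off: "p = 1 \<Longrightarrow> P ! 0 \<notin> set D" "q = 1 \<Longrightarrow> P ! (n - 1) \<notin> set D"
  shows "\<exists>i a b. valid i a b \<and> set P = tset i a b"
proof -
  let ?M = "take (n - p - q) (drop p P)"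
  have lM: "length ?M = n - p - q" using P p n4 by simp
  have gM: "gp ?M" by (intro gp_take gp_drop P) (use P p n4 in auto)
  have "hd ?M = D ! s" using P p n4 st by (simp add: hd_drop_conv_nth)
  moreover have "last ?M = D ! t" using P p n4 st by (simp add: last_conv_nth)
  moreover note S = seg[OF less_imp_le[OF st(1)] st(2)]
  \<comment> \<open>Between two vertices of \<open>D\<close> the path \<open>P\<close> can only
    follow \<open>D\<close>.\<close>
  ultimately have M: "?M = seg s t" using gp_unique[OF gM S(1)] S(4,5) by simp
  have m: "n - p - q = Suc t - s" using arg_cong[OF M, of length] lM S(2) by linarith
  \<comment> \<open>The position on \<open>D\<close> of the second vertex of \<open>P\<close>,
    whether \<open>P\<close> starts on \<open>D\<close> or one step off it.\<close>
  define i where "i = Suc s - p"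
  have inner: "P ! j = D ! (i + j - 1)" if j: "1 \<le> j" "j \<le> n - 2" for j
  proof -
    have "P ! j = ?M ! (j - p)" using j p P n4 by simp
    also have "\<dots> = D ! (s + (j - p))" unfolding M by (rule S(6)) (use j p m n4 in linarith)
    also have "s + (j - p) = i + j - 1" using j p by (auto simp: i_def)
    finally show ?thesis .
  qed
  \<comment> \<open>If \<open>P\<close> starts off \<open>D\<close>, \<open>off_arm_bound\<close>
    guarantees a vertex of \<open>D\<close> before position \<open>s\<close>; \<open>i2\<close> uses
    the same bound at the other end.\<close>
  have i1: "1 \<le> i"
  proof (cases "p = 1")
    case True
    have "gp [D ! s, P ! 0]" using gp_nth_edge[OF P(1), of 0] True st(3) P n4 by (intro gp_edge, intro sym[of "P ! 0"]) simp
    then show ?thesis using off_arm_bound(1)[of s "[P ! 0]"] off(1) True st by (simp add: i_def)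
  qed (use p in \<open>auto simp: i_def\<close>)
  have it: "i + n - 2 = t + q" using m p st n4 by (auto simp: i_def)
  have i2: "i + n - 2 < length D"
  proof (cases "q = 1")
    case True
    have "gp [D ! t, P ! (n - 1)]"
      using gp_nth_edge[OF P(1), of "n - 2"] True st(4) P n4 by (intro gp_edge) (simp add: numeral_2_eq_2 Suc_diff_Suc)
    then show ?thesis using off_arm_bound(2)[of t "[P ! (n - 1)]"] off(2) True st it by simp
  qed (use p it st in auto)
  have "valid i (P ! 0) (P ! (n - 1))"
    unfolding valid_def
  proof (intro conjI i1 i2)
    show "E (P ! 0) (D ! i)" using gp_nth_edge[OF P(1), of 0] inner[of 1] P n4 by simp
    show "P ! 0 \<noteq> D ! Suc i" using gp_nth_eq[OF P(1), of 0 2] inner[of 2] P n4 by simp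
    have "Suc (n - 2) = n - 1" using n4 by simp
    then have "E (P ! (n - 2)) (P ! (n - 1))" using gp_nth_edge[OF P(1), of "n - 2"] P n4 by simp
    moreover have "i + (n - 2) - 1 = i + n - 3" "i + (n - 3) - 1 = i + n - 4" using n4 by auto
    ultimately show "E (P ! (n - 1)) (D ! (i + n - 3))" "P ! (n - 1) \<noteq> D ! (i + n - 4)"
      using inner[of "n - 2"] inner[of "n - 3"] gp_nth_eq[OF P(1), of "n - 1" "n - 3"] P n4 by (auto intro: sym)
  qed
  moreover have "set P = tset i (P ! 0) (P ! (n - 1))"
  proof -
    have "set P = (!) P ` {..<n}" using P(2) by (auto simp: set_conv_nth)
    also have "{..<n} = {0, n - 1} \<union> {1..n - 2}" using n4 by auto
    also have "(!) P ` ({0, n - 1} \<union> {1..n - 2}) = {P ! 0, P ! (n - 1)} \<union> (!) P ` {1..n - 2}" by auto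
    also have "(!) P ` {1..n - 2} = (\<lambda>j. D ! (i + j - 1)) ` {1..n - 2}"
      by (rule image_cong) (use inner in auto)
    also have "\<dots> = (!) D ` ((\<lambda>j. i + j - 1) ` {1..n - 2})" by (simp add: image_image)
    also have "(\<lambda>j. i + j - 1) ` {1..n - 2} = {i..i + n - 3}"
    proof -
      have "x \<in> (\<lambda>j. i + j - 1) ` {1..n - 2}" if "x \<in> {i..i + n - 3}" for x
        by (rule image_eqI[of _ _ "Suc x - i"]) (use that n4 in auto)
      then show ?thesis using n4 by auto
    qed
    finally show ?thesis by (simp add: tset_def)
  qed
  ultimately show ?thesis by blast
qed

theorem path_structure:
  assumes P: "gp P" "length P = n"
  shows "\<exists>i a b. valid i a b \<and> set P = tset i a b"
proof -
  have ex: "\<exists>x\<in>set P. x \<in> set D" using path_meets_longest[OF P] by blast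
  then obtain P1 c R1 where p1: "P = P1 @ c # R1" "c \<in> set D" "\<forall>x\<in>set P1. x \<notin> set D"
    by (rule split_list_first_propE)
  from ex obtain R4 c' P4 where p4: "P = R4 @ c' # P4" "c' \<in> set D" "\<forall>x\<in>set P4. x \<notin> set D"
    by (rule split_list_last_propE)
  obtain s where s: "s < length D" "c = D ! s" using p1(2) by (auto simp: in_set_conv_nth)
  obtain t where t: "t < length D" "c' = D ! t" using p4(2) by (auto simp: in_set_conv_nth)
  have l1: "length P1 \<le> 1"
  proof -
    have "length (rev P1) \<le> 1"
    proof (rule off_arm_short[OF s(1)])
      show "gp (rev (rev P1) @ D ! s # R1)" using P(1) p1 s by simp
      show "length (rev P1) + Suc (length R1) = n" using P(2) p1 by simp
      show "hd (rev P1) \<notin> set D" if "rev P1 \<noteq> []" using hd_in_set[OF that] p1(3) by simp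
    qed
    then show ?thesis by simp
  qed
  have l4: "length P4 \<le> 1"
  proof (rule off_arm_short[OF t(1)])
    have "gp (rev P)" using P(1) by (simp only: gp_rev)
    then show "gp (rev P4 @ D ! t # rev R4)" using p4 t by simp
    show "length P4 + Suc (length (rev R4)) = n" using P(2) p4 by simp
    show "hd P4 \<notin> set D" if "P4 \<noteq> []" using hd_in_set[OF that] p4(3) by simp
  qed
  have c: "P ! length P1 = D ! s" using p1(1) s by simp
  have r4: "length R4 = n - 1 - length P4" using p4(1) P(2) by auto
  have c': "P ! (n - 1 - length P4) = D ! t" using p4(1) t r4 by (metis nth_append_length)
  have o1: "P ! 0 \<notin> set D" if "length P1 = 1" using p1 that by (cases P1) auto
  have o4: "P ! (n - 1) \<notin> set D" if l: "length P4 = 1"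
  proof -
    obtain y where "P4 = [y]" using l by (cases P4) auto
    moreover from this have "last P = y" using p4(1) by simp
    moreover have "P ! (n - 1) = last P" using P by (simp add: last_conv_nth gp_def)
    ultimately show ?thesis using p4(3) by simp
  qed
  have "length P1 \<noteq> n - 1 - length P4" using l1 l4 n4 by linarith
  then have "s \<noteq> t" using c c' gp_nth_eq[OF P(1), of "length P1" "n - 1 - length P4"] l1 l4 n4 P(2) by auto
  then consider "s < t" | "t < s" by linarith
  then show ?thesis
  proof cases
    case 1
    show ?thesis by (rule path_structure_aux[OF P l1 l4 1 t(1) c c' o1 o4])
  next
    case 2
    have "\<exists>i a b. valid i a b \<and> set (rev P) = tset i a b"
    proof (rule path_structure_aux[OF _ _ l4 l1 2 s(1)])
      show "gp (rev P)" using P(1) by (simp only: gp_rev)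
      show "length (rev P) = n" using P(2) by simp
      show "rev P ! length P4 = D ! t" using c' l4 n4 P(2) by (simp add: rev_nth)
      show "rev P ! (n - 1 - length P1) = D ! s" using c l1 n4 P(2) by (simp add: rev_nth)
      show "rev P ! 0 \<notin> set D" if "length P4 = 1" using o4 that n4 P(2) by (simp add: rev_nth)
      show "rev P ! (n - 1) \<notin> set D" if "length P1 = 1" using o1 that n4 P(2) by (simp add: rev_nth)
    qed
    then show ?thesis by simp
  qed
qed

text \<open>\<open>u\<close> and \<open>v\<close> lie on \<open>D\<close> or are attached to it at
  positions \<open>j\<close> and \<open>k\<close>, with \<open>p\<close> strictly between. The path
  joining them has at least three vertices.\<close>

lemma separated:
  assumes jk: "j < p" "p < k" "k < length D"
    and u: "u = D ! j \<or> E u (D ! j) \<and> u \<noteq> D ! Suc j" and v: "v = D ! k \<or> E v (D ! k) \<and> v \<noteq> D ! (k - 1)"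
  shows "u \<noteq> v \<and> \<not> E u v"
proof -
  have jk': "j < k" using jk by simp
  note s = seg[OF less_imp_le[OF jk'] jk(3)]
  have ne: "seg j k \<noteq> []" using s(1) by (simp add: gp_def)
  have l: "3 \<le> length (seg j k)" using s(2) jk by simp
  have "\<exists>q. gp q \<and> 3 \<le> length q \<and> hd q = u \<and> last q = v"
  proof -
    consider "u = D ! j" "v = D ! k" | "u = D ! j" "E v (D ! k) \<and> v \<noteq> D ! (k - 1)"
      | "E u (D ! j) \<and> u \<noteq> D ! Suc j" "v = D ! k" | "E u (D ! j) \<and> u \<noteq> D ! Suc j" "E v (D ! k) \<and> v \<noteq> D ! (k - 1)"
      using u v by blast
    then show ?thesis
    proof cases
      case 1
      then show ?thesis using s(1,4,5) l by (intro exI[of _ "seg j k"]) auto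
    next
      case 2
      have "gp (seg j k @ [v])"
      proof (rule gp_snoc[OF s(1)])
        show "E v (last (seg j k))" using 2 s(5) by simp
        show "v \<noteq> seg j k ! (length (seg j k) - 2)" using s(6)[of "k - j - 1"] s(2) 2 jk by (simp add: Suc_diff_le)
      qed
      then show ?thesis using 2 s(4) l ne by (intro exI[of _ "seg j k @ [v]"]) auto
    next
      case 3
      have "gp (u # seg j k)"
      proof (rule gp_Cons[OF s(1)])
        show "E u (hd (seg j k))" using 3 s(4) by simp
        show "u \<noteq> seg j k ! 1" using s(6)[of 1] 3 jk by simp
      qed
      then show ?thesis using 3 s(5) l ne by (intro exI[of _ "u # seg j k"]) auto
    next
      case 4
      have "gp (u # seg j k @ [v])" by (rule gp_extend_seg[OF jk' jk(3)]) (use 4 in auto)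
      then show ?thesis using l by (intro exI[of _ "u # seg j k @ [v]"]) auto
    qed
  qed
  then obtain q where "gp q" "3 \<le> length q" "hd q = u" "last q = v" by blast
  then show ?thesis using not_adjacent_far[of q] by simp
qed

text \<open>The path given by \<open>i\<close>, \<open>a\<close>, \<open>b\<close> lies to the right
  of \<open>p\<close>. If the other one missed \<open>D ! p\<close>, it would lie entirely to the
  left, and the two would be apart, against \<open>no_two_paths\<close>.\<close>

lemma reach:
  assumes t': "valid i' a' b'" and t: "valid i a b" and p: "i' \<le> p" "p < length D"
    and right: "\<And>v. v \<in> tset i a b \<Longrightarrow> \<exists>k>p. k < length D \<and> (v = D ! k \<or> E v (D ! k) \<and> v \<noteq> D ! (k - 1))"
  shows "D ! p \<in> tset i' a' b'"
proof (rule ccontr)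
  assume no: "D ! p \<notin> tset i' a' b'"
  have pi: "i' + n - 3 < p"
  proof (rule ccontr)
    assume "\<not> i' + n - 3 < p"
    then have "p \<in> {i'..i' + n - 3}" using p by simp
    then show False using no by (auto simp: tset_def)
  qed
  have left: "\<exists>j<p. u = D ! j \<or> E u (D ! j) \<and> u \<noteq> D ! Suc j" if u: "u \<in> tset i' a' b'" for u
  proof -
    consider "u = a'" | "u = b'" | j where "u = D ! j" "i' \<le> j" "j \<le> i' + n - 3" using u by (auto simp: tset_def)
    then show ?thesis
    proof cases
      case 1
      then show ?thesis using t' pi n4 by (intro exI[of _ i']) (auto simp: valid_def)
    next
      case 2
      \<comment> \<open>The right end either continues along \<open>D\<close>, and then sits at the
        next position, or is attached to \<open>D\<close> at the last inner position.\<close>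
      show ?thesis
      proof (cases "b' = D ! Suc (i' + n - 3)")
        case True
        then have "Suc (i' + n - 3) \<noteq> p" using no by (auto simp: tset_def)
        then show ?thesis using True 2 pi by (intro exI[of _ "Suc (i' + n - 3)"]) auto
      next
        case False
        then show ?thesis using t' 2 pi by (intro exI[of _ "i' + n - 3"]) (auto simp: valid_def)
      qed
    next
      case 3
      then show ?thesis using pi by (intro exI[of _ j]) auto
    qed
  qed
  have "\<not> (u = v \<or> E u v)" if uv: "u \<in> tset i' a' b'" "v \<in> tset i a b" for u v
  proof -
    obtain j where "j < p" "u = D ! j \<or> E u (D ! j) \<and> u \<noteq> D ! Suc j" using left[OF uv(1)] by blast
    moreover obtain k where "p < k" "k < length D" "v = D ! k \<or> E v (D ! k) \<and> v \<noteq> D ! (k - 1)" using right[OF uv(2)] by blast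
    ultimately show ?thesis using separated by blast
  qed
  then show False
    using no_two_paths[OF valid_path(1)[OF t'] valid_path(1)[OF t] valid_path(3)[OF t'] valid_path(3)[OF t]]
    unfolding valid_path(2)[OF t'] valid_path(2)[OF t] by blast
qed

text \<open>
  The weight encodes the lexicographic order on triples: position on \<open>D\<close>, then the left end, where
  the predecessor on \<open>D\<close> counts as smallest, then the right end.
\<close>

definition wt :: "nat \<Rightarrow> 'a \<Rightarrow> 'a \<Rightarrow> ('a \<Rightarrow> nat) \<Rightarrow> nat" where
  "wt i a b f = (i * (card (UNIV :: 'a set) + 1) + (if a = D ! (i - 1) then 0 else Suc (f a))) * (card (UNIV :: 'a set) + 1) + f b"

lemma wt_less:
  assumes f: "\<And>v. f v < card (UNIV :: 'a set)"
  shows "i' < i \<Longrightarrow> wt i' a' b' f < wt i a b f"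
    and "(a' = D ! (i - 1) \<and> a \<noteq> D ! (i - 1)) \<or> (a' \<noteq> D ! (i - 1) \<and> a \<noteq> D ! (i - 1) \<and> f a' < f a) \<Longrightarrow> wt i a' b' f < wt i a b f"
    and "f b' < f b \<Longrightarrow> wt i a b' f < wt i a b f"
proof -
  define K where "K = card (UNIV :: 'a set) + 1"
  have lex: "x' * K + y' < x * K + y" if "x' < x" "y' < K" for x' y' x y
  proof -
    have "x' * K + y' < Suc x' * K" using that by simp
    also have "\<dots> \<le> x * K" using that(1) by (intro mult_right_mono) auto
    finally show ?thesis by simp
  qed
  have fK: "f v < K" "(if P then 0 else Suc (f v)) < K" for v P using f[of v] by (auto simp: K_def)
  show "i' < i \<Longrightarrow> wt i' a' b' f < wt i a b f"
    unfolding wt_def K_def[symmetric] by (intro lex fK)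
  show "(a' = D ! (i - 1) \<and> a \<noteq> D ! (i - 1)) \<or> (a' \<noteq> D ! (i - 1) \<and> a \<noteq> D ! (i - 1) \<and> f a' < f a) \<Longrightarrow> wt i a' b' f < wt i a b f"
    unfolding wt_def K_def[symmetric] by (rule lex[OF _ fK(1)]) auto
  show "f b' < f b \<Longrightarrow> wt i a b' f < wt i a b f"
    unfolding wt_def by simp
qed

text \<open>With equal positions, a differing left end is exchanged, and otherwise the right end. If
  \<open>i'\<close> is smaller and \<open>a\<close> is not the predecessor on \<open>D\<close>, that
  predecessor replaces \<open>a\<close>. If \<open>a\<close> is the predecessor, the window moves
  one step left: \<open>b\<close> is dropped, and the new left end is a vertex of the other
  path.\<close>

lemma exchange:
  assumes f: "\<And>v. f v < card (UNIV :: 'a set)" "inj f"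
    and t: "valid i a b" and t': "valid i' a' b'" and ne: "tset i a b \<noteq> tset i' a' b'"
    and le: "wt i' a' b' f \<le> wt i a b f"
  shows "\<exists>i'' a'' b''. valid i'' a'' b'' \<and> wt i'' a'' b'' f < wt i a b f \<and>
     (\<exists>x\<in>tset i' a' b'. tset i'' a'' b'' - tset i a b = {x})"
proof -
  have fin: "f u = f v \<longleftrightarrow> u = v" for u v using f(2) by (auto simp: inj_def)
  have vi: "1 \<le> i" "i + n - 3 < length D" "i < i + n - 3" "i + n - 2 < length D"
    and va: "E a (D ! i)" "a \<noteq> D ! Suc i" and vb: "E b (D ! (i + n - 3))" "b \<noteq> D ! (i + n - 4)"
    using t n4 by (auto simp: valid_def)
  have vi': "1 \<le> i'" and va': "E a' (D ! i')" "a' \<noteq> D ! Suc i'"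
    using t' by (auto simp: valid_def)
  have e4: "i + n - 3 - 1 = i + n - 4" by simp
  have Dedge: "E (D ! (j - 1)) (D ! j)" "D ! (j - 1) \<noteq> D ! Suc j" if "1 \<le> j" "Suc j < length D" for j
    using gp_nth_edge[OF D, of "j - 1"] gp_nth_eq[OF D, of "j - 1" "Suc j"] that by auto
  have le_i: "i' \<le> i" using le wt_less(1)[of f, OF f(1), where i' = i and i = i'] by (meson leD leI)
  \<comment> \<open>A left end attached at or before position \<open>i\<close> avoids the segment
    and \<open>b\<close>, because together they form a path.\<close>
  have ext: "x \<notin> (!) D ` {j..i + n - 3}" "x \<noteq> b"
    if "j \<le> i" "E x (D ! j)" "x \<noteq> D ! Suc j" for x j
  proof -
    have j: "j < i + n - 3" using that(1) vi by simp
    have "gp (x # seg j (i + n - 3) @ [b])"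
      by (rule gp_extend_seg[OF j vi(2)]) (use that vb e4 in auto)
    then show "x \<notin> (!) D ` {j..i + n - 3}" "x \<noteq> b"
      using seg(3)[of j "i + n - 3"] j vi by (auto simp: gp_def)
  qed
  have interval: "(!) D ` {i - 1..i + n - 3} = insert (D ! (i - 1)) ((!) D ` {i..i + n - 3})"
  proof -
    have "{i - 1..i + n - 3} = insert (i - 1) {i..i + n - 3}" using vi by auto
    then show ?thesis by simp
  qed
  show ?thesis
  proof (cases "i' = i")
    case True
    show ?thesis
    proof (cases "a' = a")
      case aa: True
      have bb: "b' \<noteq> b" using ne True aa by auto
      have "\<not> f b < f b'" using le wt_less(3)[of f, OF f(1), where b' = b and b = b' and i = i and a = a] True aa by auto
      then have "f b' < f b" using fin bb by (metis linorder_neqE_nat)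
      then have w: "wt i a b' f < wt i a b f" by (rule wt_less(3)[of f, OF f(1)])
      have "distinct (a # seg i (i + n - 3) @ [b'])" using valid_path(1)[OF t'] True aa by (auto simp: gp_def)
      moreover have "set (seg i (i + n - 3)) = (!) D ` {i..i + n - 3}" using seg(3)[of i "i + n - 3"] vi by simp
      ultimately have "tset i a b' - tset i a b = {b'}" using bb by (auto simp: tset_def)
      moreover have "b' \<in> tset i' a' b'" by (simp add: tset_def)
      ultimately show ?thesis using w t' True aa by blast
    next
      case aa: False
      have "\<not> ((a = D ! (i - 1) \<and> a' \<noteq> D ! (i - 1)) \<or> (a \<noteq> D ! (i - 1) \<and> a' \<noteq> D ! (i - 1) \<and> f a < f a'))"
        using le wt_less(2)[of f, OF f(1), where a = a' and a' = a and i = i and b = b' and b' = b] True by auto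
      moreover have "f a' \<noteq> f a" using fin aa by simp
      ultimately have "(a' = D ! (i - 1) \<and> a \<noteq> D ! (i - 1)) \<or> (a' \<noteq> D ! (i - 1) \<and> a \<noteq> D ! (i - 1) \<and> f a' < f a)"
        using aa by (metis linorder_neqE_nat)
      then have w: "wt i a' b f < wt i a b f" by (rule wt_less(2)[of f, OF f(1)])
      have v: "valid i a' b" using t t' True by (auto simp: valid_def)
      have "tset i a' b - tset i a b = {a'}"
        using ext[of i a'] va' True aa by (auto simp: tset_def)
      moreover have "a' \<in> tset i' a' b'" by (simp add: tset_def)
      ultimately show ?thesis using w v by blast
    qed
  next
    case False
    then have lt: "i' < i" using le_i by simp
    have Di: "E (D ! (i - 1)) (D ! i)" "D ! (i - 1) \<noteq> D ! Suc i" using Dedge[of i] vi by auto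
    show ?thesis
    proof (cases "a = D ! (i - 1)")
      case aD: True
      have tsub: "tset i a b = insert b ((!) D ` {i - 1..i + n - 3})" using aD interval by (auto simp: tset_def)
      have i2: "2 \<le> i" using lt vi' by simp
      \<comment> \<open>The shifted path ends in \<open>D ! (i + n - 3)\<close>, which the old path
        contains already, so \<open>x\<close> is its only new vertex.\<close>
      have good: "\<exists>i'' a'' b''. valid i'' a'' b'' \<and> wt i'' a'' b'' f < wt i a b f \<and>
         (\<exists>x\<in>tset i' a' b'. tset i'' a'' b'' - tset i a b = {x})"
        if x: "E x (D ! (i - 1))" "x \<noteq> D ! i" "x \<in> tset i' a' b'" for x
      proof -
        have s: "Suc (i - 1) = i" using vi by simp
        have v: "valid (i - 1) x (D ! (i + n - 3))"
        proof -
          have "i - 1 + n - 3 = i + n - 4" "i - 1 + n - 4 = i + n - 5" "i - 1 + n - 2 = i + n - 3" using i2 by auto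
          moreover have "E (D ! (i + n - 3)) (D ! (i + n - 4))"
            using gp_nth_edge[OF D, of "i + n - 4"] vi n4 by (intro sym[of "D ! (i + n - 4)"]) (simp add: Suc_diff_Suc numeral_eq_Suc)
          moreover have "D ! (i + n - 3) \<noteq> D ! (i + n - 5)"
            using gp_nth_eq[OF D, of "i + n - 3" "i + n - 5"] vi n4 by auto
          ultimately show ?thesis using x i2 vi s by (auto simp: valid_def)
        qed
        have e: "x \<notin> (!) D ` {i - 1..i + n - 3}" "x \<noteq> b" using ext[of "i - 1" x] x s by auto
        have "tset (i - 1) x (D ! (i + n - 3)) = insert x ((!) D ` {i - 1..i + n - 3})"
        proof -
          have "{i - 1..i + n - 3} = insert (i + n - 3) {i - 1..i - 1 + n - 3}" using i2 n4 by auto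
          then show ?thesis by (auto simp: tset_def)
        qed
        then have "tset (i - 1) x (D ! (i + n - 3)) - tset i a b = {x}" using e tsub by auto
        moreover have "wt (i - 1) x (D ! (i + n - 3)) f < wt i a b f" by (rule wt_less(1)[of f, OF f(1)]) (use vi in simp)
        ultimately show ?thesis using v x(3) by blast
      qed
      show ?thesis
      proof (cases "i' = i - 1")
        case True
        show ?thesis by (rule good[of a']) (use va' True vi in \<open>auto simp: tset_def\<close>)
      next
        case i'i: False
        \<comment> \<open>The old path lies to the right of position i - 2, so by
          \<open>reach\<close> the other path contains \<open>D ! (i - 2)\<close>, which serves as
          \<open>x\<close>.\<close>
        have p: "i' \<le> i - 2" "i - 2 < length D" using lt i'i vi by auto
        have "D ! (i - 2) \<in> tset i' a' b'"
        proof (rule reach[OF t' t p])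
          fix v assume "v \<in> tset i a b"
          then consider "v = b" | k where "v = D ! k" "i - 1 \<le> k" "k \<le> i + n - 3" using tsub by auto
          then show "\<exists>k>i - 2. k < length D \<and> (v = D ! k \<or> E v (D ! k) \<and> v \<noteq> D ! (k - 1))"
          proof cases
            case 1
            then show ?thesis using vb vi e4 n4 by (intro exI[of _ "i + n - 3"]) auto
          next
            case 2
            then show ?thesis using vi i2 by (intro exI[of _ k]) auto
          qed
        qed
        moreover have "E (D ! (i - 2)) (D ! (i - 1))" "D ! (i - 2) \<noteq> D ! i"
          using Dedge[of "i - 1"] vi i2 lt i'i vi' by (auto simp: numeral_2_eq_2)
        ultimately show ?thesis by (intro good)
      qed
    next
      case aD: False
      have p: "i' \<le> i - 1" "i - 1 < length D" using lt vi by auto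
      have x: "D ! (i - 1) \<in> tset i' a' b'"
      proof (rule reach[OF t' t p])
        fix v assume "v \<in> tset i a b"
        then consider "v = a" | "v = b" | k where "v = D ! k" "i \<le> k" "k \<le> i + n - 3" by (auto simp: tset_def)
        then show "\<exists>k>i - 1. k < length D \<and> (v = D ! k \<or> E v (D ! k) \<and> v \<noteq> D ! (k - 1))"
        proof cases
          case 1
          then show ?thesis using va vi aD by (intro exI[of _ i]) auto
        next
          case 2
          then show ?thesis using vb vi e4 n4 by (intro exI[of _ "i + n - 3"]) auto
        next
          case 3
          then show ?thesis using vi by (intro exI[of _ k]) auto
        qed
      qed
      have "tset i (D ! (i - 1)) b - tset i a b = {D ! (i - 1)}"
        using ext[of i "D ! (i - 1)"] Di aD by (auto simp: tset_def)
      moreover have "valid i (D ! (i - 1)) b" using t Di by (auto simp: valid_def)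
      moreover have "wt i (D ! (i - 1)) b f < wt i a b f" by (rule wt_less(2)[of f, OF f(1)]) (use aD in simp)
      ultimately show ?thesis using x by blast
    qed
  qed
qed

theorem path_sets_linear_order:
  "\<exists>ms. distinct ms \<and> set ms = {set p | p. gp p \<and> length p = n} \<and>
      (\<forall>k<length ms. \<exists>A. \<forall>W. (\<exists>j<k. ms ! j \<subseteq> W \<union> ms ! k) \<longleftrightarrow> W \<inter> A \<noteq> {})"
proof -
  let ?G = "{set p | p. gp p \<and> length p = n}"
  obtain f :: "'a \<Rightarrow> nat" and N where f: "f ` UNIV = {i. i < N}" "inj f"
    using finite_imp_inj_to_nat_seg[of "UNIV :: 'a set"] by auto
  have "N = card (UNIV :: 'a set)" using card_image[OF f(2)] f(1) by simp
  then have fl: "f v < card (UNIV :: 'a set)" for v using f(1) by auto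
  \<comment> \<open>Taking the least weight makes the key depend on the set alone, even if several
    triples describe it; \<open>exchange\<close> is applied to triples attaining the
    minimum.\<close>
  define \<kappa> where "\<kappa> = (\<lambda>m. LEAST w. \<exists>i a b. valid i a b \<and> tset i a b = m \<and> wt i a b f = w)"
  have \<kappa>_le: "\<kappa> (tset i a b) \<le> wt i a b f" if "valid i a b" for i a b
    unfolding \<kappa>_def by (rule Least_le) (use that in blast)
  have \<kappa>_ex: "\<exists>i a b. valid i a b \<and> tset i a b = m \<and> wt i a b f = \<kappa> m" if m: "m \<in> ?G" for m
  proof -
    have "\<exists>i a b. valid i a b \<and> tset i a b = m" using m path_structure by blast
    then have "\<exists>w i a b. valid i a b \<and> tset i a b = m \<and> wt i a b f = w" by blast
    then show ?thesis unfolding \<kappa>_def by (rule LeastI_ex)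
  qed
  show ?thesis
  proof (rule linear_order_of_key[of ?G \<kappa>])
    fix m m' assume m: "m \<in> ?G" "m' \<in> ?G" "m \<noteq> m'" "\<kappa> m' \<le> \<kappa> m"
    obtain i a b where t: "valid i a b" "tset i a b = m" "wt i a b f = \<kappa> m" using \<kappa>_ex[OF m(1)] by blast
    obtain i' a' b' where t': "valid i' a' b'" "tset i' a' b' = m'" "wt i' a' b' f = \<kappa> m'" using \<kappa>_ex[OF m(2)] by blast
    obtain i'' a'' b'' x where t'': "valid i'' a'' b''" "wt i'' a'' b'' f < wt i a b f"
      "x \<in> tset i' a' b'" "tset i'' a'' b'' - tset i a b = {x}"
      using exchange[OF fl f(2) t(1) t'(1)] t t' m(3,4) by auto
    have "tset i'' a'' b'' \<in> ?G" using valid_path[OF t''(1)] by (metis (mono_tags, lifting) mem_Collect_eq)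
    moreover have "\<kappa> (tset i'' a'' b'') < \<kappa> m" using \<kappa>_le[OF t''(1)] t''(2) t(3) by simp
    ultimately show "\<exists>m''\<in>?G. \<kappa> m'' < \<kappa> m \<and> (\<exists>x\<in>m'. m'' - m = {x})"
      using t''(3,4) t(2) t'(2) by blast
  qed
qed

end

section \<open>Induced subgraphs and path ideals\<close>

definition induced_embedding :: "'b pair_pre_digraph \<Rightarrow> 'a pair_pre_digraph \<Rightarrow> ('b \<Rightarrow> 'a) \<Rightarrow> bool" where
  "induced_embedding H G f \<longleftrightarrow> inj_on f (pverts H) \<and> f ` pverts H \<subseteq> pverts G \<and>
     (\<forall>u\<in>pverts H. \<forall>v\<in>pverts H. (u, v) \<in> parcs H \<longleftrightarrow> (f u, f v) \<in> parcs G)"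

text \<open>Arcs are pairs of vertices here, so an isomorphism onto an induced subgraph is
  determined by its vertex map.\<close>

lemma contains_induced_iff:
  assumes G: "parcs G \<subseteq> pverts G \<times> pverts G" and H: "parcs H \<subseteq> pverts H \<times> pverts H"
  shows "contains_induced G H \<longleftrightarrow> (\<exists>f. induced_embedding H G f)"
proof
  assume "contains_induced G H"
  then obtain H' h where ind: "induced_subgraph H' (with_proj G)"
    and iso: "pre_digraph.digraph_isomorphism (with_proj H) h" "H' = app_iso h (with_proj H)"
    by (auto simp: contains_induced_def digraph_iso_def)
  let ?f = "iso_verts h"
  have inj: "inj_on ?f (pverts H)" using iso(1) by (simp add: pre_digraph.digraph_isomorphism_def)
  have sub: "verts H' \<subseteq> pverts G" "arcs H' \<subseteq> parcs G" "tail H' = fst" "head H' = snd"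
    and arcs: "arcs H' = {e \<in> parcs G. fst e \<in> verts H' \<and> snd e \<in> verts H'}"
    using ind by (auto simp: induced_subgraph_def subgraph_def compatible_def)
  have vH': "verts H' = ?f ` pverts H" and aH': "arcs H' = iso_arcs h ` parcs H"
    and th: "iso_tail h = fst" "iso_head h = snd"
    using iso(2) sub(3,4) by auto
  have arc: "iso_arcs h (u, v) = (?f u, ?f v)" if "(u, v) \<in> parcs H" for u v
  proof -
    have "\<forall>a\<in>parcs H. ?f (fst a) = iso_tail h (iso_arcs h a) \<and> ?f (snd a) = iso_head h (iso_arcs h a)"
      using iso(1) by (simp add: pre_digraph.digraph_isomorphism_def)
    from bspec[OF this that] show ?thesis using th by (simp add: prod_eq_iff)
  qed
  have "induced_embedding H G ?f"
    unfolding induced_embedding_def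
  proof (intro conjI inj ballI)
    show "?f ` pverts H \<subseteq> pverts G" using vH' sub(1) by simp
    fix u v assume uv: "u \<in> pverts H" "v \<in> pverts H"
    show "(u, v) \<in> parcs H \<longleftrightarrow> (?f u, ?f v) \<in> parcs G"
    proof
      assume "(u, v) \<in> parcs H"
      then show "(?f u, ?f v) \<in> parcs G" using arc aH' sub(2) by (metis image_eqI subsetD)
    next
      assume "(?f u, ?f v) \<in> parcs G"
      then have "(?f u, ?f v) \<in> arcs H'" using arcs vH' uv by simp
      then obtain u' v' where e: "(u', v') \<in> parcs H" "(?f u, ?f v) = iso_arcs h (u', v')" unfolding aH' by auto
      then have "?f u = ?f u'" "?f v = ?f v'" using arc by auto
      moreover have "u' \<in> pverts H" "v' \<in> pverts H" using e(1) H by auto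
      ultimately have "u = u'" "v = v'" using inj_onD[OF inj] uv by blast+
      then show "(u, v) \<in> parcs H" using e(1) by simp
    qed
  qed
  then show "\<exists>f. induced_embedding H G f" by (rule exI[of _ "iso_verts h"])
next
  assume "\<exists>f. induced_embedding H G f"
  then obtain f where f: "inj_on f (pverts H)" "f ` pverts H \<subseteq> pverts G"
    "\<And>u v. u \<in> pverts H \<Longrightarrow> v \<in> pverts H \<Longrightarrow> (u, v) \<in> parcs H \<longleftrightarrow> (f u, f v) \<in> parcs G"
    unfolding induced_embedding_def by blast
  define h :: "('b, 'b \<times> 'b, 'a, 'a \<times> 'a) digraph_isomorphism" where
    "h = \<lparr>iso_verts = f, iso_arcs = map_prod f f, iso_head = snd, iso_tail = fst\<rparr>"
  let ?H' = "app_iso h (with_proj H)"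
  have wG: "wf_digraph (with_proj G)" and wH: "wf_digraph (with_proj H)"
    using G H by (auto simp: wf_digraph_def)
  have v': "verts ?H' = f ` pverts H" and a': "arcs ?H' = map_prod f f ` parcs H"
    and t': "tail ?H' = fst" "head ?H' = snd" by (auto simp: h_def)
  have "inj_on (map_prod f f) (parcs H)"
    by (rule inj_on_subset[OF _ H]) (use f(1) in \<open>auto simp: inj_on_def\<close>)
  then have iso: "pre_digraph.digraph_isomorphism (with_proj H) h"
    using wH f(1) by (auto simp: pre_digraph.digraph_isomorphism_def h_def)
  have arcs: "arcs ?H' = {e \<in> parcs G. fst e \<in> verts ?H' \<and> snd e \<in> verts ?H'}"
  proof
    show "arcs ?H' \<subseteq> {e \<in> parcs G. fst e \<in> verts ?H' \<and> snd e \<in> verts ?H'}"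
      unfolding a' v' using f(3) H by auto
    show "{e \<in> parcs G. fst e \<in> verts ?H' \<and> snd e \<in> verts ?H'} \<subseteq> arcs ?H'"
    proof
      fix e assume "e \<in> {e \<in> parcs G. fst e \<in> verts ?H' \<and> snd e \<in> verts ?H'}"
      then obtain u v where e: "e = (f u, f v)" "u \<in> pverts H" "v \<in> pverts H" "e \<in> parcs G"
        unfolding v' by (cases e) auto
      then have "(u, v) \<in> parcs H" using f(3) by simp
      then show "e \<in> arcs ?H'" unfolding a' e(1) by (metis image_eqI map_prod_simp)
    qed
  qed
  have "wf_digraph ?H'" unfolding wf_digraph_def t' a' v' using H by auto
  then have "induced_subgraph ?H' (with_proj G)"
    unfolding induced_subgraph_def subgraph_def compatible_def
    using wG arcs v' t' f(2) by auto
  then show "contains_induced G H" unfolding contains_induced_def digraph_iso_def using iso by blast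
qed

lemma pverts_path_graph: "pverts (path_graph n) = {1..n}"
  and parcs_path_graph: "(i, j) \<in> parcs (path_graph n) \<longleftrightarrow>
     1 \<le> i \<and> 1 \<le> j \<and> i \<le> n \<and> j \<le> n \<and> (j = Suc i \<or> i = Suc j)"
  by (auto simp: path_graph_def graph_of_edges_def)

lemma pverts_disjoint_union: "pverts (disjoint_union G H) = Inl ` pverts G \<union> Inr ` pverts H"
  and parcs_disjoint_union:
    "(Inl u, Inl v) \<in> parcs (disjoint_union G H) \<longleftrightarrow> (u, v) \<in> parcs G"
    "(Inr u', Inr v') \<in> parcs (disjoint_union G H) \<longleftrightarrow> (u', v') \<in> parcs H"
    "(Inl u, Inr v') \<notin> parcs (disjoint_union G H)" "(Inr u', Inl v) \<notin> parcs (disjoint_union G H)"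
  by (auto simp: disjoint_union_def)

lemma wf_disjoint_paths:
  "parcs (disjoint_union (path_graph n) (path_graph m)) \<subseteq>
   pverts (disjoint_union (path_graph n) (path_graph m)) \<times> pverts (disjoint_union (path_graph n) (path_graph m))"
  by (auto simp: disjoint_union_def parcs_path_graph pverts_path_graph)

lemma pverts_L_graph: "pverts (L_graph n k) = X ` {1..n} \<union> Y ` {1..k - 1}"
  by (simp add: L_graph_def graph_of_edges_def)

lemma parcs_L_graph:
  assumes "2 \<le> k" "k \<le> n"
  shows "(X i, X j) \<in> parcs (L_graph n k) \<longleftrightarrow> 1 \<le> i \<and> 1 \<le> j \<and> i \<le> n \<and> j \<le> n \<and> (j = Suc i \<or> i = Suc j)"
    "(Y i, Y j) \<in> parcs (L_graph n k) \<longleftrightarrow> 1 \<le> i \<and> 1 \<le> j \<and> i \<le> k - 1 \<and> j \<le> k - 1 \<and> (j = Suc i \<or> i = Suc j)"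
    "(X i, Y j) \<in> parcs (L_graph n k) \<longleftrightarrow> i = k \<and> j = k - 1"
    "(Y j, X i) \<in> parcs (L_graph n k) \<longleftrightarrow> i = k \<and> j = k - 1"
  using assms by (auto simp: L_graph_def graph_of_edges_def)

lemma wf_L_graph:
  assumes "2 \<le> k" "k \<le> n"
  shows "parcs (L_graph n k) \<subseteq> pverts (L_graph n k) \<times> pverts (L_graph n k)"
proof
  fix e assume "e \<in> parcs (L_graph n k)"
  moreover obtain u v where "e = (u, v)" by (cases e)
  ultimately show "e \<in> pverts (L_graph n k) \<times> pverts (L_graph n k)"
    using assms by (cases u; cases v) (auto simp: parcs_L_graph[OF assms] pverts_L_graph)
qed

section \<open>Tree digraphs as adjacency relations\<close>

abbreviation adj :: "'a pair_pre_digraph \<Rightarrow> 'a \<Rightarrow> 'a \<Rightarrow> bool" where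
  "adj G u v \<equiv> (u, v) \<in> parcs G"

lemma awalk_of_vwalk:
  assumes "w \<noteq> []"
  shows "pawalk_verts (hd w) (vwalk_arcs w) = w" "pcas (hd w) (vwalk_arcs w) (last w)"
  using assms by (induction w rule: vwalk_arcs.induct) auto

lemma vwalk_arcs_successively: "set (vwalk_arcs w) \<subseteq> parcs G \<longleftrightarrow> successively (adj G) w"
  by (induction w rule: vwalk_arcs.induct) auto

lemma length_vwalk_arcs: "length (vwalk_arcs w) = length w - 1"
  by (induction w rule: vwalk_arcs.induct) auto

lemma utree_of_tree_graph:
  assumes t: "tree_graph G" and V: "pverts G = UNIV"
  shows "utree (adj G)"
proof
  have "pair_graph G" using t by (simp add: tree_graph_def)
  then interpret pair_graph G .
  show s: "adj G v u" if "adj G u v" for u v using that arcs_symmetric by blast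
  show "\<not> adj G v v" for v using no_loops by force
  show "(adj G)\<^sup>*\<^sup>* u v" for u v
  proof -
    have "strongly_connected (mk_symmetric (with_proj G))" using t by (simp add: tree_graph_def connected_def)
    then have "u \<rightarrow>\<^sup>*\<^bsub>with_proj (mk_symmetric (with_proj G))\<^esub> v" using V by (simp add: strongly_connected_def mk_symmetric_def)
    then have "(u, v) \<in> rtrancl_on UNIV (parcs (mk_symmetric (with_proj G)))"
      by (simp add: reachable_def mk_symmetric_def V)
    moreover have "parcs (mk_symmetric (with_proj G)) = parcs G"
      using s by (auto simp: mk_symmetric_def)
    ultimately have "(u, v) \<in> rtrancl_on UNIV (parcs G)" by simp
    then show ?thesis
      by (induction rule: rtrancl_on_induct) (auto intro: rtranclp.rtrancl_into_rtrancl)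
  qed
  show "\<not> adj G (last p) (hd p)" if p: "distinct p" "successively (adj G) p" "3 \<le> length p" for p
  proof
    assume e: "adj G (last p) (hd p)"
    obtain v p' where v: "p = v # p'" using p(3) by (cases p) auto
    then have hp: "hd p = v" by simp
    \<comment> \<open>A path with adjacent ends is closed up by repeating its first vertex; the
      closed walk has as many arcs as the path has vertices, so at least 3.\<close>
    let ?w = "p @ [v]" and ?a = "vwalk_arcs (p @ [v])"
    have "successively (adj G) ?w" using p(2) e unfolding hp by (simp add: successively_append_iff)
    then have "set ?a \<subseteq> parcs G" by (simp add: vwalk_arcs_successively)
    moreover have "pawalk_verts v ?a = ?w" "pcas v ?a v" using awalk_of_vwalk[of ?w] v by auto
    moreover have l: "length ?a = length p" by (simp add: length_vwalk_arcs)
    ultimately have "pre_digraph.cycle (with_proj G) ?a"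
      unfolding pre_digraph.cycle_def pre_digraph.awalk_def awalk_verts_with_proj_eq cas_with_proj_eq
      using v p(1,3) V by (intro exI[of _ v]) auto
    then show False using t l p(3) unfolding tree_graph_def by metis
  qed
qed

lemma vpath_iff_gp:
  assumes "tree_graph G" and V: "pverts G = UNIV"
  shows "vpath p (with_proj G) \<longleftrightarrow> utree.gp (adj G) p"
  unfolding utree.gp_def[OF utree_of_tree_graph[OF assms]] vpath_def vwalk_def
  using V by (auto simp: vwalk_arcs_successively)

theorem path_ideal_eq_sqf_ideal:
  fixes G :: "'a::finite pair_pre_digraph"
  assumes "tree_graph G" and "pverts G = UNIV"
  shows "path_ideal n G = (sqf_ideal {set p | p. utree.gp (adj G) p \<and> length p = n} :: ('a, 'k::field) pring set)"
proof -
  have d: "distinct p" if "utree.gp (adj G) p" for p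
    using that by (simp add: utree.gp_def[OF utree_of_tree_graph[OF assms]])
  have "{prod_list (map var vs) | vs. vpath vs (with_proj G) \<and> length vs = n} =
      (pmono ` sqf ` {set p | p. utree.gp (adj G) p \<and> length p = n} :: ('a, 'k) pring set)"
    (is "?L = ?R")
  proof
    show "?L \<subseteq> ?R"
    proof
      fix x :: "('a, 'k) pring" assume "x \<in> ?L"
      then obtain vs where "x = prod_list (map var vs)" "utree.gp (adj G) vs" "length vs = n"
        by (auto simp: vpath_iff_gp[OF assms])
      then show "x \<in> ?R" using prod_list_var[OF d] by blast
    qed
    show "?R \<subseteq> ?L"
    proof
      fix x :: "('a, 'k) pring" assume "x \<in> ?R"
      then obtain vs where vs: "x = pmono (sqf (set vs))" "utree.gp (adj G) vs" "length vs = n" by blast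
      then have "x = prod_list (map var vs)" by (simp add: prod_list_var d)
      then show "x \<in> ?L" using vs by (auto simp: vpath_iff_gp[OF assms])
    qed
  qed
  then show ?thesis by (simp add: path_ideal_def sqf_ideal_def)
qed

section \<open>Forbidden subgraphs and the main theorem\<close>

context utree
begin

definition path_sets :: "nat \<Rightarrow> 'a set set" where
  "path_sets n = {set p | p. gp p \<and> length p = n}"

lemma card_path_sets: "\<forall>u\<in>path_sets n. card u = n"
  by (auto simp: path_sets_def gp_def distinct_card)

text \<open>An induced copy of \<open>L_graph m (Suc a)\<close>: the centre is
  \<open>x (Suc a)\<close>, and the first \<open>a\<close> vertices of \<open>x\<close> and those of
  \<open>y\<close> are two legs of equal length, numbered towards the centre.\<close>

definition spider :: "nat \<Rightarrow> nat \<Rightarrow> (nat \<Rightarrow> 'a) \<Rightarrow> (nat \<Rightarrow> 'a) \<Rightarrow> bool" where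
  "spider m a x y \<longleftrightarrow>
     (\<forall>i\<in>{1..m}. \<forall>j\<in>{1..m}. (x i = x j \<longleftrightarrow> i = j) \<and> (E (x i) (x j) \<longleftrightarrow> j = Suc i \<or> i = Suc j)) \<and>
     (\<forall>i\<in>{1..a}. \<forall>j\<in>{1..a}. (y i = y j \<longleftrightarrow> i = j) \<and> (E (y i) (y j) \<longleftrightarrow> j = Suc i \<or> i = Suc j)) \<and>
     (\<forall>i\<in>{1..m}. \<forall>j\<in>{1..a}. x i \<noteq> y j \<and> (E (x i) (y j) \<longleftrightarrow> i = Suc a \<and> j = a))"

lemma spiderD:
  assumes "spider m a x y"
  shows "\<And>i j. i \<in> {1..m} \<Longrightarrow> j \<in> {1..m} \<Longrightarrow> x i = x j \<longleftrightarrow> i = j"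
    "\<And>i j. i \<in> {1..m} \<Longrightarrow> j \<in> {1..m} \<Longrightarrow> E (x i) (x j) \<longleftrightarrow> j = Suc i \<or> i = Suc j"
    "\<And>i j. i \<in> {1..a} \<Longrightarrow> j \<in> {1..a} \<Longrightarrow> y i = y j \<longleftrightarrow> i = j"
    "\<And>i j. i \<in> {1..a} \<Longrightarrow> j \<in> {1..a} \<Longrightarrow> E (y i) (y j) \<longleftrightarrow> j = Suc i \<or> i = Suc j"
    "\<And>i j. i \<in> {1..m} \<Longrightarrow> j \<in> {1..a} \<Longrightarrow> x i \<noteq> y j"
    "\<And>i j. i \<in> {1..m} \<Longrightarrow> j \<in> {1..a} \<Longrightarrow> E (x i) (y j) \<longleftrightarrow> i = Suc a \<and> j = a"
  using assms unfolding spider_def by blast+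

text \<open>Any two arms form a path through \<open>c\<close>, and a path in a tree has no chords.
  Every pair of vertices lies on one of the three paths, so equality and adjacency are read off from
  positions.\<close>

lemma spider_of_arms:
  assumes ar: "arms c p q r" and len: "length p = a" "length q = a" "length r = m - Suc a" and am: "1 \<le> a" "Suc a < m"
  shows "spider m a (\<lambda>i. (rev p @ c # r) ! (i - 1)) (\<lambda>j. rev q ! (j - 1))"
proof -
  define x where "x = (\<lambda>i. (rev p @ c # r) ! (i - 1))"
  define y where "y = (\<lambda>j. rev q ! (j - 1))"
  have P1: "gp (rev p @ c # r)" and P2: "gp (rev q @ c # r)" and P3: "gp (rev q @ c # p)"
    using ar by (auto simp: arms_def intro!: gp_join)
  have l: "length (rev p @ c # r) = m" "length (rev q @ c # r) = m" "length (rev q @ c # p) = Suc (a + a)"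
    using len am by auto
  have y2: "y j = (rev q @ c # r) ! (j - 1)" "y j = (rev q @ c # p) ! (j - 1)" if "j \<in> {1..a}" for j
    using that len by (auto simp: y_def nth_append)
  have x2: "x i = (rev q @ c # r) ! (i - 1)" if "Suc a \<le> i" "i \<le> m" for i
    using that len by (auto simp: x_def nth_append)
  \<comment> \<open>On \<open>rev q @ c # p\<close> this leg is traversed outwards, from position a
    + 1 for \<open>x a\<close> to 2a for \<open>x 1\<close>.\<close>
  have x3: "x i = (rev q @ c # p) ! (2 * a + 1 - i)" if "1 \<le> i" "i \<le> a" for i
  proof -
    have "i - 1 < a" using that by linarith
    then have "x i = p ! (a - i)" using that len by (simp add: x_def nth_append rev_nth)
    moreover have "2 * a + 1 - i = length (rev q) + Suc (a - i)" using that len by simp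
    ultimately show ?thesis by (simp only: nth_append_length_plus nth_Cons_Suc)
  qed
  have ix: "i - 1 = j - 1 \<longleftrightarrow> i = j" "j - 1 = Suc (i - 1) \<longleftrightarrow> j = Suc i" if "1 \<le> i" "1 \<le> j" for i j :: nat
    using that by auto
  have "spider m a x y"
    unfolding spider_def
  proof (intro conjI ballI)
    fix i j assume ij: "i \<in> {1..m}" "j \<in> {1..m}"
    then have b: "i - 1 < length (rev p @ c # r)" "j - 1 < length (rev p @ c # r)" unfolding l by auto
    show "x i = x j \<longleftrightarrow> i = j" unfolding x_def gp_nth_eq[OF P1 b] using ij by (intro ix) auto
    show "E (x i) (x j) \<longleftrightarrow> j = Suc i \<or> i = Suc j"
      unfolding x_def gp_adjacent_iff[OF P1 b] using ix(2)[of i j] ix(2)[of j i] ij by auto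
  next
    fix i j assume ij: "i \<in> {1..a}" "j \<in> {1..a}"
    then have b: "i - 1 < length (rev q @ c # r)" "j - 1 < length (rev q @ c # r)" unfolding l using am by auto
    show "y i = y j \<longleftrightarrow> i = j" unfolding y2(1)[OF ij(1)] y2(1)[OF ij(2)] gp_nth_eq[OF P2 b] using ij by (intro ix) auto
    show "E (y i) (y j) \<longleftrightarrow> j = Suc i \<or> i = Suc j"
      unfolding y2(1)[OF ij(1)] y2(1)[OF ij(2)] gp_adjacent_iff[OF P2 b] using ix(2)[of i j] ix(2)[of j i] ij by auto
  next
    fix i j assume ij: "i \<in> {1..m}" "j \<in> {1..a}"
    have "x i \<noteq> y j \<and> (E (x i) (y j) \<longleftrightarrow> i = Suc a \<and> j = a)"
    proof (cases "Suc a \<le> i")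
      case True
      have b: "i - 1 < length (rev q @ c # r)" "j - 1 < length (rev q @ c # r)" unfolding l using ij am by auto
      have "x i = (rev q @ c # r) ! (i - 1)" using x2 True ij by auto
      then show ?thesis
        unfolding y2(1)[OF ij(2)] using gp_nth_eq[OF P2 b] gp_adjacent_iff[OF P2 b] True ij by auto
    next
      case False
      have b: "2 * a + 1 - i < length (rev q @ c # p)" "j - 1 < length (rev q @ c # p)" unfolding l using ij False by auto
      have "x i = (rev q @ c # p) ! (2 * a + 1 - i)" using x3 False ij by auto
      moreover have "j - 1 \<noteq> 2 * a + 1 - i" "j - 1 \<noteq> Suc (2 * a + 1 - i)" "2 * a + 1 - i \<noteq> Suc (j - 1)" using ij False by auto
      ultimately show ?thesis
        unfolding y2(2)[OF ij(2)] using gp_nth_eq[OF P3 b] gp_adjacent_iff[OF P3 b] False by auto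
    qed
    then show "x i \<noteq> y j" "E (x i) (y j) \<longleftrightarrow> i = Suc a \<and> j = a" by auto
  qed
  then show ?thesis by (simp add: x_def y_def)
qed

lemma gp_map_upt:
  assumes "i < j" "\<And>k l. k \<in> {i..<j} \<Longrightarrow> l \<in> {i..<j} \<Longrightarrow> h k = h l \<Longrightarrow> k = l"
    "\<And>k. i \<le> k \<Longrightarrow> Suc k < j \<Longrightarrow> E (h k) (h (Suc k))"
  shows "gp (map h [i..<j])"
  unfolding gp_def using assms by (auto simp: distinct_map inj_on_def successively_conv_nth)

text \<open>For the spine and the path using the other leg, \<open>u'\<close> is the spine without
  some \<open>x m\<close> but with some \<open>y j\<close>. Connectedness forces j = a and keeps the
  centre, which has at most two neighbours on a path; so \<open>x a\<close> or
  \<open>x (a + 2)\<close> was removed. That cuts off \<open>x 1\<close> or \<open>x n\<close>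
  respectively, as a >= 2 and a + 3 <= n.\<close>

lemma spider_not_linear:
  assumes sp: "spider n a x y" and a: "2 \<le> a" "2 * a \<le> n - 1"
    and syz: "\<And>u v. u \<in> path_sets n \<Longrightarrow> v \<in> path_sets n \<Longrightarrow> u \<noteq> v \<Longrightarrow>
      \<exists>u'\<in>path_sets n. card (u' - u) = 1 \<and> u' \<subseteq> u \<union> v"
  shows False
proof -
  note s = spiderD[OF sp]
  let ?u = "x ` {1..n}" and ?v = "y ` {1..a} \<union> x ` {Suc a..n}"
  have an: "a + 3 \<le> n" using a by linarith
  have "gp (map x [1..<Suc n])" by (rule gp_map_upt) (use s(1,2) a in auto)
  moreover have "set (map x [1..<Suc n]) = ?u" by (simp only: set_map set_upt atLeastLessThanSuc_atLeastAtMost)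
  moreover have "length (map x [1..<Suc n]) = n" by simp
  ultimately have u: "?u \<in> path_sets n" unfolding path_sets_def by (metis (mono_tags, lifting) mem_Collect_eq)
  have "gp (map y [1..<Suc a] @ map x [Suc a..<Suc n])"
  proof -
    have 1: "gp (map y [1..<Suc a])" by (rule gp_map_upt) (use s(3,4) a in auto)
    have 2: "gp (map x [Suc a..<Suc n])" by (rule gp_map_upt) (use s(1,2) a in auto)
    have 3: "last (map y [1..<Suc a]) = y a" "hd (map x [Suc a..<Suc n]) = x (Suc a)" using a by (auto simp: hd_map last_map)
    have 4: "E (y a) (x (Suc a))" using s(6)[of "Suc a" a] a by (intro sym[of "x (Suc a)"]) auto
    have 5: "set (map y [1..<Suc a]) \<inter> set (map x [Suc a..<Suc n]) = {}"
    proof (rule ccontr)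
      assume "set (map y [1..<Suc a]) \<inter> set (map x [Suc a..<Suc n]) \<noteq> {}"
      then obtain w where "w \<in> x ` {Suc a..<Suc n}" "w \<in> y ` {1..<Suc a}" unfolding set_map set_upt by blast
      then obtain i j where ij: "x i = y j" "i \<in> {Suc a..<Suc n}" "j \<in> {1..<Suc a}" by (metis imageE)
      then show False using s(5)[of i j] by auto
    qed
    show ?thesis using 1 2 4 5 unfolding gp_def successively_append_iff distinct_append 3 by simp
  qed
  moreover have "set (map y [1..<Suc a] @ map x [Suc a..<Suc n]) = ?v" by (simp only: set_append set_map set_upt atLeastLessThanSuc_atLeastAtMost)
  moreover have "Suc a \<le> n" using a by linarith
  then have "length (map y [1..<Suc a] @ map x [Suc a..<Suc n]) = n" using a(1) by simp
  ultimately have v: "?v \<in> path_sets n" unfolding path_sets_def by (metis (mono_tags, lifting) mem_Collect_eq)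
  have "y 1 \<notin> ?u" using s(5)[of _ 1] a by force
  moreover have "y 1 \<in> ?v" using a by auto
  ultimately have "?u \<noteq> ?v" by blast
  from syz[OF u v this] obtain u' where u': "u' \<in> path_sets n" "card (u' - ?u) = 1" "u' \<subseteq> ?u \<union> ?v" by blast
  obtain w where w: "u' - ?u = {w}" using u'(2) by (auto simp: card_1_singleton_iff)
  obtain p where p: "gp p" "length p = n" "u' = set p" using u'(1) by (auto simp: path_sets_def)
  have wu: "w \<in> u'" "w \<notin> ?u" using w by auto
  have "?v \<subseteq> y ` {1..a} \<union> ?u" by (intro Un_mono image_mono) auto
  moreover have "w \<in> ?u \<union> ?v" using u'(3) wu(1) by (rule subsetD)
  ultimately have "w \<in> y ` {1..a}" using wu(2) by (meson Un_iff subsetD)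
  then obtain j where j: "w = y j" "j \<in> {1..a}" by blast
  have cu: "card ?u = n" using card_path_sets u by blast
  have cu': "card u' = n" using card_path_sets u'(1) by blast
  have fin: "finite u'" "finite ?u" using p by auto
  have "card (u' \<inter> ?u) + card (u' - ?u) = card u'"
    using fin by (subst card_Un_disjoint[symmetric]) (auto simp: Int_Diff_Un)
  then have ci: "card (u' \<inter> ?u) = n - 1" using cu' u'(2) by simp
  have "card (?u \<inter> u') + card (?u - u') = card ?u"
    using fin by (subst card_Un_disjoint[symmetric]) (auto simp: Int_Diff_Un)
  then have "card (?u - u') = 1" using ci cu a by (simp add: Int_commute)
  then obtain z where z: "?u - u' = {z}" by (auto simp: card_1_singleton_iff)
  then obtain m where m: "z = x m" "m \<in> {1..n}" by blast
  have inx: "x i \<in> u'" if "i \<in> {1..n}" "i \<noteq> m" for i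
  proof (rule ccontr)
    assume "x i \<notin> u'"
    then have "x i \<in> ?u - u'" using that(1) by blast
    then have "x i = x m" using z m(1) by (metis singletonD)
    then show False using s(1)[OF that(1) m(2)] that(2) by blast
  qed
  have mnot: "x m \<notin> u'" using z m by auto
  have other: "\<exists>i\<in>{1..n}. b = x i" if "b \<in> u'" "b \<noteq> w" for b
  proof -
    have "b \<in> ?u" using that w by (metis DiffI singletonD)
    then show ?thesis by (rule imageE) blast
  qed
  have ja: "j = a" and xa: "x (Suc a) \<in> u'"
  proof -
    have "u' \<noteq> {w}" using cu' a by auto
    then obtain b where b: "b \<in> u'" "b \<noteq> w" using wu(1) by blast
    have "\<exists>u\<in>set p. \<exists>v\<in>set p. u \<in> {w} \<and> v \<notin> {w} \<and> E u v"
      by (rule gp_crossing_edge[OF p(1)]) (use wu b p(3) in auto)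
    then obtain b' where b': "b' \<in> u'" "b' \<noteq> w" "E w b'" using p(3) by blast
    then obtain i where i: "i \<in> {1..n}" "b' = x i" using other by blast
    then have "E (x i) (y j)" using b'(3) j(1) sym by blast
    then show "j = a" "x (Suc a) \<in> u'" using s(6)[OF i(1) j(2)] i b' by auto
  qed
  \<comment> \<open>A block of spine indices whose only outside neighbour is the missing
    \<open>m\<close> would be cut off from \<open>w\<close> within the path
    \<open>p\<close>.\<close>
  have no_nbrs: "False" if A: "A \<subseteq> {1..n}" "i \<in> A" "i \<noteq> m" and
    nb: "\<And>i i'. i \<in> A \<Longrightarrow> i' \<in> {1..n} \<Longrightarrow> i' \<notin> A \<Longrightarrow> i' = Suc i \<or> i = Suc i' \<Longrightarrow> i' = m" and "Suc a \<notin> A" for A i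
  proof -
    have "\<exists>u\<in>set p. \<exists>v\<in>set p. u \<in> x ` A \<and> v \<notin> x ` A \<and> E u v"
    proof (rule gp_crossing_edge[OF p(1)])
      show "x i \<in> set p" "x i \<in> x ` A" using inx A p(3) by auto
      show "w \<in> set p" using wu p(3) by simp
      show "w \<notin> x ` A" using wu A by auto
    qed
    then obtain i1 b where b: "i1 \<in> A" "b \<in> u'" "b \<notin> x ` A" "E (x i1) b" using p(3) by blast
    have i1: "i1 \<in> {1..n}" using b A by auto
    have "b \<noteq> w"
    proof
      assume "b = w"
      then have "i1 = Suc a" using s(6)[OF i1 j(2)] b(4) j(1) by simp
      then show False using b(1) \<open>Suc a \<notin> A\<close> by simp
    qed
    then obtain i2 where i2: "i2 \<in> {1..n}" "b = x i2" using other b(2) by blast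
    then have "i2 = Suc i1 \<or> i1 = Suc i2" using s(2)[OF i1 i2(1)] b(4) by simp
    then have "i2 = m" using nb[OF b(1) i2(1)] b(3) i2(2) by blast
    then show False using b(2) i2(2) mnot by simp
  qed
  have "x a \<notin> u' \<or> x (Suc (Suc a)) \<notin> u'"
  proof (rule ccontr)
    assume c: "\<not> ?thesis"
    show False
    proof (rule gp_degree_le_2[OF p(1), of "x (Suc a)" "x a" "x (Suc (Suc a))" "y a"])
      show "x (Suc a) \<in> set p" "x a \<in> set p" "x (Suc (Suc a)) \<in> set p" "y a \<in> set p"
        using c xa wu j(1) ja p(3) by auto
      show "E (x (Suc a)) (x a)" "E (x (Suc a)) (x (Suc (Suc a)))" "E (x (Suc a)) (y a)"
        using s(2)[of "Suc a" a] s(2)[of "Suc a" "Suc (Suc a)"] s(6)[of "Suc a" a] a by auto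
      show "x a \<noteq> x (Suc (Suc a))" using s(1)[of a "Suc (Suc a)"] a by auto
      show "x (Suc (Suc a)) \<noteq> y a" using s(5)[of "Suc (Suc a)" a] a by auto
      show "x a \<noteq> y a" using s(5)[of a a] a by auto
    qed
  qed
  then show False
  proof
    assume "x a \<notin> u'"
    then have ma: "m = a" using inx[of a] a an by auto
    show False
      by (rule no_nbrs[of "{1..<a}" 1]) (use ma a an in auto)
  next
    assume "x (Suc (Suc a)) \<notin> u'"
    then have ma: "m = Suc (Suc a)" using inx[of "Suc (Suc a)"] a an by auto
    show False
      by (rule no_nbrs[of "{a + 3..n}" n]) (use ma a an in auto)
  qed
qed

text \<open>The exchanged path would meet both vertex sets and stay in their union, so it would
  cross from one to the other along an edge.\<close>

lemma two_paths_not_linear: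
  assumes p: "gp p" "length p = n" and q: "gp q" "length q = n" and n: "2 \<le> n"
    and far: "\<And>u v. u \<in> set p \<Longrightarrow> v \<in> set q \<Longrightarrow> u \<noteq> v \<and> \<not> E u v"
    and syz: "\<And>u v. u \<in> path_sets n \<Longrightarrow> v \<in> path_sets n \<Longrightarrow> u \<noteq> v \<Longrightarrow>
      \<exists>u'\<in>path_sets n. card (u' - u) = 1 \<and> u' \<subseteq> u \<union> v"
  shows False
proof -
  have "set p \<in> path_sets n" "set q \<in> path_sets n" using p q by (auto simp: path_sets_def)
  moreover have "set p \<noteq> set q" using far p(1) by (metis gp_def last_in_set)
  ultimately obtain u' where u': "u' \<in> path_sets n" "card (u' - set p) = 1" "u' \<subseteq> set p \<union> set q" using syz by blast
  obtain w where w: "u' - set p = {w}" using u'(2) by (auto simp: card_1_singleton_iff)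
  obtain r where r: "gp r" "length r = n" "u' = set r" using u'(1) by (auto simp: path_sets_def)
  have "card u' = n" using card_path_sets u'(1) by blast
  then have "u' \<noteq> {w}" using n by auto
  then obtain b where b: "b \<in> u'" "b \<in> set p" using w by blast
  have "\<exists>u\<in>set r. \<exists>v\<in>set r. u \<in> set p \<and> v \<notin> set p \<and> E u v"
    by (rule gp_crossing_edge[OF r(1), of b _ w]) (use b w r(3) in auto)
  then show False using far u'(3) r(3) by blast
qed

end

lemma contains_L_graph_iff:
  fixes G :: "'a pair_pre_digraph"
  assumes T: "utree (adj G)" and V: "pverts G = UNIV" and a: "1 \<le> a" "Suc a \<le> m"
  shows "contains_induced G (L_graph m (Suc a)) \<longleftrightarrow> (\<exists>x y. utree.spider (adj G) m a x y)"
proof -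
  interpret utree "adj G" by fact
  have k: "2 \<le> Suc a" "Suc a \<le> m" using a by auto
  note arcs = parcs_L_graph[OF k]
  have G: "parcs G \<subseteq> pverts G \<times> pverts G" using V by auto
  have "(\<exists>f. induced_embedding (L_graph m (Suc a)) G f) \<longleftrightarrow> (\<exists>x y. spider m a x y)"
  proof
    assume "\<exists>f. induced_embedding (L_graph m (Suc a)) G f"
    then obtain f where f: "induced_embedding (L_graph m (Suc a)) G f" ..
    have fe: "(f u = f v \<longleftrightarrow> u = v) \<and> (adj G (f u) (f v) \<longleftrightarrow> (u, v) \<in> parcs (L_graph m (Suc a)))"
      if "u \<in> pverts (L_graph m (Suc a))" "v \<in> pverts (L_graph m (Suc a))" for u v
      using f that unfolding induced_embedding_def by (auto dest: inj_onD)
    have "spider m a (\<lambda>i. f (X i)) (\<lambda>j. f (Y j))"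
      unfolding spider_def
    proof (intro ballI conjI)
      fix i j assume "i \<in> {1..m}" "j \<in> {1..m}"
      then show "f (X i) = f (X j) \<longleftrightarrow> i = j" "adj G (f (X i)) (f (X j)) \<longleftrightarrow> j = Suc i \<or> i = Suc j"
        using fe[of "X i" "X j"] by (auto simp: pverts_L_graph arcs)
    next
      fix i j assume "i \<in> {1..a}" "j \<in> {1..a}"
      then show "f (Y i) = f (Y j) \<longleftrightarrow> i = j" "adj G (f (Y i)) (f (Y j)) \<longleftrightarrow> j = Suc i \<or> i = Suc j"
        using fe[of "Y i" "Y j"] by (auto simp: pverts_L_graph arcs)
    next
      fix i j assume "i \<in> {1..m}" "j \<in> {1..a}"
      then show "f (X i) \<noteq> f (Y j)" "adj G (f (X i)) (f (Y j)) \<longleftrightarrow> i = Suc a \<and> j = a"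
        using fe[of "X i" "Y j"] by (auto simp: pverts_L_graph arcs)
    qed
    then show "\<exists>x y. spider m a x y" by blast
  next
    assume "\<exists>x y. spider m a x y"
    then obtain x y where sp: "spider m a x y" by blast
    note s = spiderD[OF sp]
    define f where "f = (\<lambda>v. case v of X i \<Rightarrow> x i | Y j \<Rightarrow> y j)"
    have fe: "(f u = f v \<longrightarrow> u = v) \<and> (adj G (f u) (f v) \<longleftrightarrow> (u, v) \<in> parcs (L_graph m (Suc a)))"
      if uv: "u \<in> pverts (L_graph m (Suc a))" "v \<in> pverts (L_graph m (Suc a))" for u v
    proof -
      consider i j where "u = X i" "v = X j" "i \<in> {1..m}" "j \<in> {1..m}" | i j where "u = X i" "v = Y j" "i \<in> {1..m}" "j \<in> {1..a}"
        | i j where "u = Y j" "v = X i" "i \<in> {1..m}" "j \<in> {1..a}" | i j where "u = Y i" "v = Y j" "i \<in> {1..a}" "j \<in> {1..a}"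
        using uv by (auto simp: pverts_L_graph)
      then show ?thesis
      proof cases
        case (1 i j)
        then show ?thesis using s(1)[of i j] s(2)[of i j] by (auto simp: f_def arcs)
      next
        case (2 i j)
        then show ?thesis using s(5)[of i j] s(6)[of i j] by (auto simp: f_def arcs)
      next
        case (3 i j)
        have "adj G (y j) (x i) \<longleftrightarrow> adj G (x i) (y j)" using sym by blast
        then show ?thesis using 3 s(5)[of i j] s(6)[of i j] by (auto simp: f_def arcs)
      next
        case (4 i j)
        then show ?thesis using s(3)[of i j] s(4)[of i j] by (auto simp: f_def arcs)
      qed
    qed
    have "induced_embedding (L_graph m (Suc a)) G f"
      unfolding induced_embedding_def using fe V by (auto intro!: inj_onI)
    then show "\<exists>f. induced_embedding (L_graph m (Suc a)) G f" by (rule exI[of _ f])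
  qed
  then show ?thesis using contains_induced_iff[OF G wf_L_graph[OF k]] by simp
qed

lemma contains_two_paths_iff:
  fixes G :: "'a pair_pre_digraph"
  assumes T: "utree (adj G)" and V: "pverts G = UNIV" and n: "1 \<le> n"
  shows "contains_induced G (disjoint_union (path_graph n) (path_graph n)) \<longleftrightarrow>
    (\<exists>p q. utree.gp (adj G) p \<and> utree.gp (adj G) q \<and> length p = n \<and> length q = n \<and>
       (\<forall>u\<in>set p. \<forall>v\<in>set q. u \<noteq> v \<and> \<not> adj G u v))"
proof -
  interpret utree "adj G" by fact
  let ?H = "disjoint_union (path_graph n) (path_graph n)"
  have G: "parcs G \<subseteq> pverts G \<times> pverts G" using V by auto
  have VH: "pverts ?H = Inl ` {1..n} \<union> Inr ` {1..n}" by (simp add: pverts_disjoint_union pverts_path_graph)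
  note arcs = parcs_disjoint_union parcs_path_graph
  have "(\<exists>f. induced_embedding ?H G f) \<longleftrightarrow>
    (\<exists>p q. gp p \<and> gp q \<and> length p = n \<and> length q = n \<and> (\<forall>u\<in>set p. \<forall>v\<in>set q. u \<noteq> v \<and> \<not> adj G u v))"
  proof
    assume "\<exists>f. induced_embedding ?H G f"
    then obtain f where f: "induced_embedding ?H G f" ..
    have fe: "(f u = f v \<longleftrightarrow> u = v) \<and> (adj G (f u) (f v) \<longleftrightarrow> (u, v) \<in> parcs ?H)"
      if "u \<in> pverts ?H" "v \<in> pverts ?H" for u v
      using f that unfolding induced_embedding_def by (auto dest: inj_onD)
    let ?p = "map (\<lambda>i. f (Inl i)) [1..<Suc n]" and ?q = "map (\<lambda>i. f (Inr i)) [1..<Suc n]"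
    have p: "gp ?p"
    proof (rule gp_map_upt)
      fix k l assume "k \<in> {1..<Suc n}" "l \<in> {1..<Suc n}" "f (Inl k) = f (Inl l)"
      then show "k = l" using fe[of "Inl k" "Inl l"] by (auto simp: VH)
    next
      fix k assume "1 \<le> k" "Suc k < Suc n"
      then show "adj G (f (Inl k)) (f (Inl (Suc k)))" using fe[of "Inl k" "Inl (Suc k)"] by (auto simp: VH arcs)
    qed (use n in auto)
    have q: "gp ?q"
    proof (rule gp_map_upt)
      fix k l assume "k \<in> {1..<Suc n}" "l \<in> {1..<Suc n}" "f (Inr k) = f (Inr l)"
      then show "k = l" using fe[of "Inr k" "Inr l"] by (auto simp: VH)
    next
      fix k assume "1 \<le> k" "Suc k < Suc n"
      then show "adj G (f (Inr k)) (f (Inr (Suc k)))" using fe[of "Inr k" "Inr (Suc k)"] by (auto simp: VH arcs)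
    qed (use n in auto)
    have far: "u \<noteq> v \<and> \<not> adj G u v" if uv: "u \<in> set ?p" "v \<in> set ?q" for u v
    proof -
      obtain i where i: "u = f (Inl i)" "i \<in> {1..n}" using uv(1) by (auto simp: atLeastLessThanSuc_atLeastAtMost)
      obtain j where j: "v = f (Inr j)" "j \<in> {1..n}" using uv(2) by (auto simp: atLeastLessThanSuc_atLeastAtMost)
      show ?thesis using fe[of "Inl i" "Inr j"] i j by (auto simp: VH arcs)
    qed
    show "\<exists>p q. gp p \<and> gp q \<and> length p = n \<and> length q = n \<and> (\<forall>u\<in>set p. \<forall>v\<in>set q. u \<noteq> v \<and> \<not> adj G u v)"
    proof (rule exI[of _ ?p], rule exI[of _ ?q], intro conjI)
      show "\<forall>u\<in>set ?p. \<forall>v\<in>set ?q. u \<noteq> v \<and> \<not> adj G u v" by (intro ballI far)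
    qed (rule p, rule q, simp_all)
  next
    assume "\<exists>p q. gp p \<and> gp q \<and> length p = n \<and> length q = n \<and> (\<forall>u\<in>set p. \<forall>v\<in>set q. u \<noteq> v \<and> \<not> adj G u v)"
    then obtain p q where pq: "gp p" "gp q" "length p = n" "length q = n" and far: "\<forall>u\<in>set p. \<forall>v\<in>set q. u \<noteq> v \<and> \<not> adj G u v"
      by (elim exE conjE) (rule that)
    define f where "f = (\<lambda>v. case v of Inl i \<Rightarrow> p ! (i - 1) | Inr j \<Rightarrow> q ! (j - 1))"
    have aux: "(r ! (i - 1) = r ! (j - 1) \<longleftrightarrow> i = j) \<and> (adj G (r ! (i - 1)) (r ! (j - 1)) \<longleftrightarrow> j = Suc i \<or> i = Suc j)"
      if "gp r" "length r = n" "i \<in> {1..n}" "j \<in> {1..n}" for r i j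
    proof -
      have b: "i - 1 < length r" "j - 1 < length r" using that by auto
      show ?thesis unfolding gp_nth_eq[OF that(1) b] gp_adjacent_iff[OF that(1) b] using that(3,4) by auto
    qed
    have fe: "(f u = f v \<longrightarrow> u = v) \<and> (adj G (f u) (f v) \<longleftrightarrow> (u, v) \<in> parcs ?H)"
      if uv: "u \<in> pverts ?H" "v \<in> pverts ?H" for u v
    proof -
      consider i j where "u = Inl i" "v = Inl j" "i \<in> {1..n}" "j \<in> {1..n}" | i j where "u = Inl i" "v = Inr j" "i \<in> {1..n}" "j \<in> {1..n}"
        | i j where "u = Inr j" "v = Inl i" "i \<in> {1..n}" "j \<in> {1..n}" | i j where "u = Inr i" "v = Inr j" "i \<in> {1..n}" "j \<in> {1..n}"
        using uv by (auto simp: VH)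
      then show ?thesis
      proof cases
        case (1 i j)
        then show ?thesis using aux[OF pq(1,3), of i j] by (auto simp: f_def arcs)
      next
        case (2 i j)
        then have "p ! (i - 1) \<in> set p" "q ! (j - 1) \<in> set q" using pq(3,4) by auto
        then show ?thesis using 2 far by (auto simp: f_def arcs)
      next
        case (3 i j)
        then have "p ! (i - 1) \<in> set p" "q ! (j - 1) \<in> set q" using pq(3,4) by auto
        then have "p ! (i - 1) \<noteq> q ! (j - 1)" "\<not> adj G (p ! (i - 1)) (q ! (j - 1))" using far by auto
        then have "p ! (i - 1) \<noteq> q ! (j - 1)" "\<not> adj G (q ! (j - 1)) (p ! (i - 1))" using sym by auto
        then show ?thesis using 3 by (auto simp: f_def arcs)
      next
        case (4 i j)
        then show ?thesis using aux[OF pq(2,4), of i j] by (auto simp: f_def arcs)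
      qed
    qed
    have "induced_embedding ?H G f"
      unfolding induced_embedding_def using fe V by (auto intro!: inj_onI)
    then show "\<exists>f. induced_embedding ?H G f" by (rule exI[of _ f])
  qed
  then show ?thesis using contains_induced_iff[OF G wf_disjoint_paths] by simp
qed

text \<open>The vertices \<open>x\<^sub>1, \<dots>, x\<^sub>5, y\<^sub>1, y\<^sub>2\<close> of \<open>L\<^sub>5\<^sub>,\<^sub>3\<close> are numbered \<open>0, \<dots>, 6\<close>.\<close>

definition spider_edges :: "(nat \<times> nat) list" where
  "spider_edges = [(0,1), (1,0), (1,2), (2,1), (2,3), (3,2), (3,4), (4,3), (5,6), (6,5), (2,6), (6,2)]"

text \<open>Listed in the cyclic order of the hexagon: neighbours in the list, including the last
  and the first, share three vertices.\<close>

definition spider_paths :: "nat list list" where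
  "spider_paths = [[0,1,2,3], [1,2,3,4], [4,3,2,6], [3,2,6,5], [1,2,6,5], [0,1,2,6]]"

lemma spider_paths_complete:
  "\<forall>(a, b)\<in>set spider_edges. \<forall>(b', c)\<in>set spider_edges. b = b' \<and> a \<noteq> c \<longrightarrow>
     (\<forall>(c', d)\<in>set spider_edges. c = c' \<and> distinct [a, b, c, d] \<longrightarrow> (\<exists>i\<in>set [0..<6]. set [a, b, c, d] = set (spider_paths ! i)))"
  by code_simp

text \<open>The combinatorial hypotheses of \<open>hexagon_not_linear\<close> for the numbered copy,
  decided by evaluation.\<close>

lemma spider_paths_facts:
  "\<forall>i\<in>set [0..<6]. set (spider_paths ! i) \<subseteq> set [0..<7] \<and> distinct (spider_paths ! i) \<and> length (spider_paths ! i) = 4 \<and>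
      successively (\<lambda>a b. (a, b) \<in> set spider_edges) (spider_paths ! i)"
  "\<forall>i\<in>set [0..<6]. \<forall>j\<in>set [0..<6]. set (spider_paths ! i) = set (spider_paths ! j) \<longrightarrow> i = j"
  "\<forall>i\<in>set [0..<6]. card (set (spider_paths ! i) \<union> set (spider_paths ! hex_succ i)) = 5"
  "\<forall>i\<in>set [0..<6]. \<forall>j\<in>set [0..<6]. i \<noteq> j \<and> j \<noteq> hex_succ i \<and> i \<noteq> hex_succ j \<longrightarrow>
      5 < card (set (spider_paths ! i) \<union> set (spider_paths ! j))"
  "\<forall>i\<in>set [0..<6]. \<forall>j\<in>set [0..<6]. set (spider_paths ! i) \<union> set (spider_paths ! hex_succ i) =
      set (spider_paths ! j) \<union> set (spider_paths ! hex_succ j) \<longrightarrow> i = j"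
  "\<forall>w\<in>set [0..<7]. \<exists>i\<in>set [0..<6]. w \<in> set (spider_paths ! i) \<union> set (spider_paths ! hex_succ i)"
  by code_simp+

text \<open>The numbering \<open>h\<close> is injective and preserves adjacency in both directions,
  so the evaluated facts transfer to the tree.\<close>

theorem spider_hexagon_not_linear:
  fixes E :: "'a::finite \<Rightarrow> 'a \<Rightarrow> bool"
  assumes T: "utree E" and sp: "utree.spider E 5 2 x y"
  shows "\<not> linear_resolution (sqf_ideal (utree.path_sets E 4) :: ('a, 'k::field) pring set)"
proof -
  interpret utree E by fact
  note s = spiderD[OF sp]
  define h where "h = (\<lambda>i. [x 1, x 2, x 3, x 4, x 5, y 1, y 2] ! i)"
  have h: "h 0 = x 1" "h (Suc 0) = x 2" "h 2 = x 3" "h 3 = x 4" "h 4 = x 5" "h 5 = y 1" "h 6 = y 2"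
    by (simp_all add: h_def)
  have seven: "i \<in> {0, 1, 2, 3, 4, 5, 6}" if "i < 7" for i :: nat using that by auto
  have hinj: "i = j" if "i < 7" "j < 7" "h i = h j" for i j
    using seven[OF that(1)] seven[OF that(2)] that(3) s(1,3,5) s(5)[THEN not_sym] by (auto simp: h)
  have hE: "E (h i) (h j) \<longleftrightarrow> (i, j) \<in> set spider_edges" if "i < 7" "j < 7" for i j
  proof -
    have sy: "E (y k) (x l) \<longleftrightarrow> E (x l) (y k)" for k l using sym by blast
    show ?thesis
      using seven[OF that(1)] seven[OF that(2)]
      by (elim insertE emptyE; simp add: h s(2,4,6) sy spider_edges_def)
  qed
  have hinj': "inj_on h {..<7}" using hinj by (auto simp: inj_on_def)
  have f6: "i \<in> set [0..<6]" if "i < 6" for i :: nat using that by auto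
  note spf = spider_paths_facts
  define g where "g = (\<lambda>i. h ` set (spider_paths ! i))"
  have sub: "set (spider_paths ! i) \<subseteq> {..<7}" if "i < 6" for i
    using spf(1) f6[OF that] by (auto simp del: set_upt simp: atLeast0LessThan set_upt)
  have gU: "g i \<union> g j = h ` (set (spider_paths ! i) \<union> set (spider_paths ! j))" for i j by (auto simp: g_def)
  have subU: "set (spider_paths ! i) \<union> set (spider_paths ! j) \<subseteq> {..<7}" if "i < 6" "j < 6" for i j
    using sub that by simp
  have cU: "card (g i \<union> g j) = card (set (spider_paths ! i) \<union> set (spider_paths ! j))" if "i < 6" "j < 6" for i j
    unfolding gU by (rule card_image) (rule inj_on_subset[OF hinj' subU[OF that]])
  show ?thesis
  proof (rule hexagon_not_linear[where g = g and W = "h ` {..<7}" and d = 4])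
    show "\<forall>u\<in>path_sets 4. card u = 4" by (rule card_path_sets)
    show "g i \<in> path_sets 4" if i: "i < 6" for i
    proof -
      have q: "set (spider_paths ! i) \<subseteq> {..<7}" "distinct (spider_paths ! i)" "length (spider_paths ! i) = 4"
        "successively (\<lambda>a b. (a, b) \<in> set spider_edges) (spider_paths ! i)"
        using spf(1) f6[OF i] sub[OF i] by auto
      have "distinct (map h (spider_paths ! i))" using q(1,2) hinj' by (simp add: distinct_map inj_on_subset)
      moreover have "successively E (map h (spider_paths ! i))"
        unfolding successively_map by (rule successively_mono[OF q(4)]) (use hE q(1) in auto)
      moreover have "map h (spider_paths ! i) \<noteq> []" using q(3) by auto
      ultimately have "gp (map h (spider_paths ! i))" by (simp add: gp_def)
      moreover have "set (map h (spider_paths ! i)) = g i" "length (map h (spider_paths ! i)) = 4"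
        using q(3) by (auto simp: g_def)
      ultimately show ?thesis unfolding path_sets_def by (metis (mono_tags, lifting) mem_Collect_eq)
    qed
    show "g i \<subseteq> h ` {..<7}" if "i < 6" for i using sub[OF that] by (auto simp: g_def)
    show "i = j" if "i < 6" "j < 6" "g i = g j" for i j
    proof -
      have "set (spider_paths ! i) = set (spider_paths ! j)"
        using that(3) inj_on_image_eq_iff[OF hinj' sub[OF that(1)] sub[OF that(2)]] by (simp add: g_def)
      then show ?thesis using spf(2) f6[OF that(1)] f6[OF that(2)] by blast
    qed
    show "card (g i \<union> g (hex_succ i)) = 4 + 1" if "i < 6" for i
      using cU[OF that hex_succ_less[OF that]] spf(3) f6[OF that] by auto
    show "card (g i \<union> g j) > 4 + 1" if "i < 6" "j < 6" "i \<noteq> j" "j \<noteq> hex_succ i" "i \<noteq> hex_succ j" for i j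
      using cU[OF that(1,2)] spf(4) f6[OF that(1)] f6[OF that(2)] that(3-5) by auto
    show "i = j" if "i < 6" "j < 6" "g i \<union> g (hex_succ i) = g j \<union> g (hex_succ j)" for i j
    proof -
      have "set (spider_paths ! i) \<union> set (spider_paths ! hex_succ i) = set (spider_paths ! j) \<union> set (spider_paths ! hex_succ j)"
        using that(3) inj_on_image_eq_iff[OF hinj' subU[OF that(1) hex_succ_less[OF that(1)]] subU[OF that(2) hex_succ_less[OF that(2)]]]
        unfolding gU by simp
      then show ?thesis using spf(5) f6[OF that(1)] f6[OF that(2)] by blast
    qed
    show "\<exists>i<6. w \<in> g i \<union> g (hex_succ i)" if w: "w \<in> h ` {..<7}" for w
    proof -
      obtain l where l: "l < 7" "w = h l" using w by auto
      then have "l \<in> set [0..<7]" by simp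
      then obtain i where "i \<in> set [0..<6]" "l \<in> set (spider_paths ! i) \<union> set (spider_paths ! hex_succ i)"
        using spf(6) by blast
      then show ?thesis using l(2) unfolding gU by (intro exI[of _ i]) auto
    qed
    show "4 + 2 < card (h ` {..<7})" using card_image[OF hinj'] by simp
    show "\<exists>i<6. u = g i" if u: "u \<in> path_sets 4" "u \<subseteq> h ` {..<7}" for u
    proof -
      obtain p where p: "gp p" "length p = 4" "u = set p" using u(1) by (auto simp: path_sets_def)
      have "\<forall>v\<in>set p. \<exists>l<7. v = h l" using u(2) p(3) by auto
      then have "\<exists>q. length q = 4 \<and> set q \<subseteq> {..<7} \<and> p = map h q" using p(2)
      proof -
        obtain l where l: "\<And>v. v \<in> set p \<Longrightarrow> l v < 7 \<and> h (l v) = v" using \<open>\<forall>v\<in>set p. _\<close> by metis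
        have "map h (map l p) = p" by (simp add: map_idI l)
        then show ?thesis using l p(2) by (intro exI[of _ "map l p"]) auto
      qed
      then obtain q where q: "length q = 4" "set q \<subseteq> {..<7}" "p = map h q" by blast
      obtain a b c d where abcd: "q = [a, b, c, d]" using q(1) by (auto simp: length_Suc_conv eval_nat_numeral)
      have lt: "a < 7" "b < 7" "c < 7" "d < 7" using q(2) abcd by auto
      have dist: "distinct [a, b, c, d]" using p(1) q(3) abcd by (auto simp: gp_def)
      have e: "(a, b) \<in> set spider_edges" "(b, c) \<in> set spider_edges" "(c, d) \<in> set spider_edges"
        using p(1) q(3) abcd hE lt by (auto simp: gp_def)
      have "\<exists>i\<in>set [0..<6]. set [a, b, c, d] = set (spider_paths ! i)"
        using bspec[OF spider_paths_complete e(1)] e(2,3) dist by fastforce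
      then obtain i where i: "i \<in> set [0..<6]" "set [a, b, c, d] = set (spider_paths ! i)" by blast
      have "u = h ` set [a, b, c, d]" using p(3) q(3) abcd by simp
      then show ?thesis unfolding i(2) g_def using i(1) by auto
    qed
  qed simp
qed

lemma (in utree) longest_path_exists:
  assumes "finite (UNIV :: 'a set)"
  shows "\<exists>D. gp D \<and> (\<forall>p. gp p \<longrightarrow> length p \<le> length D)"
proof -
  have b: "\<forall>p. gp p \<longrightarrow> length p \<le> card (UNIV :: 'a set)"
    using card_mono[OF assms subset_UNIV] by (auto simp: gp_def distinct_card[symmetric])
  show ?thesis by (rule ex_has_greatest_nat[where k = "[undefined]" and b = "Suc (card (UNIV :: 'a set))"]) (use b in \<open>auto simp: less_Suc_eq_le\<close>)
qed

theorem theorem1p1: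
  fixes G :: "'a::finite pair_pre_digraph" and n :: nat
    and J :: "('a, 'k::field) pring set"
  assumes "tree_graph G" and "pverts G = UNIV"
    and "n \<ge> 4"
    and "J = path_ideal n G"
  shows "(linear_resolution J \<longleftrightarrow> linear_quotients J) \<and>
    (linear_quotients J \<longleftrightarrow>
      (n = 4 \<and> \<not> contains_induced G (disjoint_union (path_graph 4) (path_graph 4))
             \<and> \<not> contains_induced G (L_graph 5 3)) \<or>
      (n \<ge> 5 \<and> \<not> contains_induced G (disjoint_union (path_graph n) (path_graph n))
             \<and> (\<forall>k::nat. 3 \<le> k \<and> real k \<le> (real n + 1) / 2 \<longrightarrow>
                   \<not> contains_induced G (L_graph n k))))"
proof -
  let ?A = "n = 4 \<and> \<not> contains_induced G (disjoint_union (path_graph 4) (path_graph 4)) \<and> \<not> contains_induced G (L_graph 5 3)"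
  let ?B = "n \<ge> 5 \<and> \<not> contains_induced G (disjoint_union (path_graph n) (path_graph n)) \<and>
     (\<forall>k::nat. 3 \<le> k \<and> real k \<le> (real n + 1) / 2 \<longrightarrow> \<not> contains_induced G (L_graph n k))"
  note V = assms(2)
  have T: "utree (adj G)" by (rule utree_of_tree_graph[OF assms(1,2)])
  then interpret utree "adj G" .
  have J: "J = sqf_ideal (path_sets n)" unfolding assms(4) path_sets_def by (rule path_ideal_eq_sqf_ideal[OF assms(1,2)])
  have n0: "0 < n" "1 \<le> n" "2 \<le> n" using assms(3) by auto
  note d = card_path_sets[of n]
  have two: "contains_induced G (disjoint_union (path_graph n) (path_graph n)) \<longleftrightarrow>
    (\<exists>p q. gp p \<and> gp q \<and> length p = n \<and> length q = n \<and> (\<forall>u\<in>set p. \<forall>v\<in>set q. u \<noteq> v \<and> \<not> adj G u v))"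
    by (rule contains_two_paths_iff[OF T V n0(2)])
  have 1: "linear_resolution J" if "linear_quotients J"
    using linear_quotients_imp_linear_resolution[OF d n0(1)] that unfolding J by blast
  have 2: "?A \<or> ?B" if lr: "linear_resolution J"
  proof -
    have syz: "\<exists>u'\<in>path_sets n. card (u' - u) = 1 \<and> u' \<subseteq> u \<union> v"
      if "u \<in> path_sets n" "v \<in> path_sets n" "u \<noteq> v" for u v
      by (rule linear_first_syzygies[OF d n0(1) lr[unfolded J] that])
    have "\<not> contains_induced G (disjoint_union (path_graph n) (path_graph n))"
    proof
      assume "contains_induced G (disjoint_union (path_graph n) (path_graph n))"
      then obtain p q where pq: "gp p" "gp q" "length p = n" "length q = n"
        and far: "\<forall>u\<in>set p. \<forall>v\<in>set q. u \<noteq> v \<and> \<not> adj G u v"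
        unfolding two by (elim exE conjE) (rule that)
      show False
        by (rule two_paths_not_linear[OF pq(1,3,2,4) n0(3) _ syz]) (use far in auto)
    qed
    moreover have "\<not> contains_induced G (L_graph n k)" if k: "3 \<le> k" "real k \<le> (real n + 1) / 2" for k
    proof
      assume c: "contains_induced G (L_graph n k)"
      \<comment> \<open>In terms of the leg length \<open>a\<close> the bound on \<open>k\<close>
        reads 2a <= n - 1.\<close>
      define a where "a = k - 1"
      have "real (2 * k) \<le> real (n + 1)" using k(2) by (simp add: field_simps)
      then have "2 * k \<le> n + 1" unfolding of_nat_le_iff .
      then have a: "k = Suc a" "2 \<le> a" "2 * a \<le> n - 1" using k(1) by (auto simp: a_def)
      then have "1 \<le> a" "Suc a \<le> n" by auto
      then obtain x y where "spider n a x y" using c contains_L_graph_iff[OF T V] unfolding a(1) by blast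
      then show False by (rule spider_not_linear[OF _ a(2,3) syz])
    qed
    moreover have "\<not> contains_induced G (L_graph 5 3)" if "n = 4"
    proof
      assume "contains_induced G (L_graph 5 3)"
      then obtain x y where "spider 5 2 x y"
        using contains_L_graph_iff[OF T V, of 2 5] by (auto simp: numeral_3_eq_3 numeral_2_eq_2)
      then show False using spider_hexagon_not_linear[OF T, where 'k = 'k] lr \<open>n = 4\<close> unfolding J by blast
    qed
    ultimately show ?thesis using assms(3) by (cases "n = 4") auto
  qed
  have 3: "linear_quotients J" if AB: "?A \<or> ?B"
  proof -
    obtain D where D: "gp D" "\<forall>p. gp p \<longrightarrow> length p \<le> length D" using longest_path_exists[OF finite] by blast
    \<comment> \<open>Arms that are long enough are shortened to lengths a, a and m - 1 - a, which
      gives an induced \<open>L_graph m (Suc a)\<close>. The second alternative for \<open>m\<close>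
      serves n = 4.\<close>
    have nL: False if ar: "arms c p q r" and a: "n = m \<or> n = 4 \<and> m = 5 \<and> a = 2" "2 \<le> a" "2 * a \<le> m - 1"
      "a \<le> length p" "a \<le> length q" "m - 1 - a \<le> length r" for c p q r m a
    proof -
      have m: "1 \<le> a" "Suc a < m" "0 < a" "0 < m - Suc a" using a by auto
      have "arms c (take a p) (take a q) (take (m - Suc a) r)" by (rule arms_take[OF ar m(3,3,4)])
      then have "\<exists>x y. spider m a x y" using spider_of_arms[OF _ _ _ _ m(1,2)] a by fastforce
      then have c: "contains_induced G (L_graph m (Suc a))" using contains_L_graph_iff[OF T V m(1)] m(2) by simp
      show False
      proof (cases "n = 4")
        case True
        then have "m = 5 \<and> a = 2" using a(1-3) by auto
        then show False using c AB True by (simp add: numeral_3_eq_3 numeral_2_eq_2)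
      next
        case False
        then have "m = n" "\<forall>k::nat. 3 \<le> k \<and> real k \<le> (real n + 1) / 2 \<longrightarrow> \<not> contains_induced G (L_graph n k)"
          using AB a(1) by auto
        moreover have "3 \<le> Suc a" "real (Suc a) \<le> (real n + 1) / 2" using a(2,3) \<open>m = n\<close> by auto
        ultimately show False using c by blast
      qed
    qed
    have "longest_path_tree (adj G) n D"
    proof
      show "4 \<le> n" "gp D" using assms(3) D by auto
      show "length p \<le> length D" if "gp p" for p using D that by blast
      show "\<exists>u\<in>set p. \<exists>v\<in>set q. u = v \<or> adj G u v" if "gp p" "gp q" "length p = n" "length q = n" for p q
        using AB two that by auto
      show False if ar: "arms c p q r" and l: "2 \<le> length p" "2 \<le> length q" "2 \<le> length r" "length p \<le> length q"
        "n - 1 \<le> length p + length r" for c p q r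
      proof (cases "n = 4")
        case True
        then show False using nL[OF ar, of 5 2] l by simp
      next
        case False
        \<comment> \<open>The largest leg length that \<open>L_graph n k\<close> allows. If
          \<open>p\<close> or \<open>r\<close> has length at most \<open>?f\<close>, that arm
          determines the leg length. Otherwise the legs are cut to \<open>?f\<close>, and n - 1 -
          \<open>?f\<close> is at most \<open>?f\<close> + 1, so \<open>r\<close> is long enough for
          the third arm.\<close>
        let ?f = "(n - 1) div 2"
        have f: "2 \<le> ?f" "2 * ?f \<le> n - 1" "n - 1 \<le> 2 * ?f + 1" using False assms(3) by auto
        consider "length p \<le> ?f" | "?f < length p" "length r \<le> ?f" | "?f < length p" "?f < length r" by linarith
        then show False
        proof cases
          case 1
          then have "2 * length p \<le> n - 1" "n - 1 - length p \<le> length r" using l f by linarith+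
          then show False using nL[OF ar, of n "length p"] l by simp
        next
          case 2
          then have "2 * length r \<le> n - 1" "n - 1 - length r \<le> length p" using l f by linarith+
          moreover have "length r \<le> length q" using 2 l by linarith
          moreover have "arms c r q p" using ar by (auto simp: arms_def)
          ultimately show False using nL[of c r q p n "length r"] l by simp
        next
          case 3
          then have "n - 1 - ?f \<le> length r" "?f \<le> length p" "?f \<le> length q" using l f by linarith+
          then show False using nL[OF ar, of n ?f] l f by simp
        qed
      qed
    qed
    then interpret L: longest_path_tree "adj G" n D .
    show ?thesis unfolding J linear_quotients_iff[OF d] using L.path_sets_linear_order unfolding path_sets_def .
  qed
  show ?thesis using 1 2 3 by blast
qed

end
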